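(* Let $V$ be a real vector space with a fixed vector space basis $S$, let $S(V)$ be the symmetric algebra over $V$, and let $L$ be a linear functional on $S(V)$ such that $L(1)=1$. Suppose that one of the following assumptions is satisfied: (i) $L(a)\geq 0$ for all $a\in S(V)_+$; (ii) $L(a^2)\geq 0$ for all $a\in S(V)$, and Carleman's condition $\sum_{n=1}^\infty L(t^{2n})^{-\frac{1}{2n}}=+\infty$ holds for all $t\in S$. Then $L$ is a moment functional, that is, there exists a cylinder measure $\mu$ on the algebraic dual $V^*$ such that for every $f\in S(V)$ the function $\chi\mapsto f(\chi)$ is $\mu$-integrable and $$L(f)=\int_{V^*} f(\chi)\,d\mu(\chi)\quad\text{for all } f\in S(V).$$ Suppose in addition that $V$ is equipped with a nuclear locally convex Hausdorff topology, with continuous dual $V'$, and that there exists a continuous seminorm $q$ on $V$ such that $L(t^2)\leq q(t)^2$ for all $t\in V$. Then there exists a ($\sigma$-additive) measure $\mu$ on the $\sigma$-algebra on $V'$ generated by the cylinder sets of $V'$ such that $$L(f)=\int_{V'} f(\chi)\,d\mu(\chi)\quad\text{for all } f\in S(V).$$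
   Context: $S(V)$ is the free commutative unital real algebra over the vector space $V$ (so $V\subseteq S(V)$, and a basis of $V$ is a family of free polynomial generators). Each $\chi\in V^*$ (algebraic dual) extends uniquely to a character, i.e. a unital algebra homomorphism $S(V)\to\mathbb{R}$, again denoted $\chi$, and every character arises in this way; write $f(\chi):=\chi(f)$ for $f\in S(V)$. $S(V)_+:=\{f\in S(V): f(\chi)\geq 0\text{ for all }\chi\in V^*\}$. In Carleman's condition a term with $L(t^{2n})=0$ is read as $+\infty$. Cylinder measures: let $W$ be a real locally convex Hausdorff space with continuous dual $W'$. For a finite-dimensional subspace $F\subseteq W$ put $F^\circ=\{\ell\in W':\ell(f)=0\text{ for }f\in F\}$. A cylinder set of $W'$ is a set $\{\ell\in W':\ell+F^\circ\in M\}$ with $F$ finite-dimensional and $M$ (the base) a Borel subset of the finite-dimensional space $W'/F^\circ$ (the generating subspace). A cylinder measure on $W'$ is a function $\mu$ from the algebra of cylinder sets to $[0,1]$ with $\mu(W')=1$ such that $\mu(N)=\sum_n\mu(N_n)$ whenever $N$ is the union of pairwise disjoint cylinder sets $N_n$, $n\in\mathbb{N}$, with a common generating subspace. It induces for each $F$ a Borel probability measure $\nu_F$ on $W'/F^\circ$, $\nu_F(M):=\mu(N)$, $N$ the cylinder set with base $M$. A function $g(\ell)=h(\ell+F^\circ)$ on $W'$ with $h$ Borel is $\mu$-integrable if $h$ is $\nu_F$-integrable, and $\int_{W'}g\,d\mu:=\int h\,d\nu_F$. Cylinder measures on $V^*$ are understood with $W=V$ carrying its finest locally convex topology (so that $W'=V^*$).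 *)

theory Defs
  imports "HOL-Analysis.Analysis"
begin

section \<open>The symmetric algebra of a real vector space\<close>

text \<open>
  The symmetric algebra \<open>S(V)\<close>, \<open>V\<close> being the type \<open>'v\<close>, is realised as the term algebra over \<open>'v\<close>
  modulo the least congruence that enforces the laws of commutative unital real algebras and makes
  the inclusion of generators linear.  The lemma \<open>sym_alg_universal\<close> below is its universal
  property.
\<close>

datatype 'v sym_term =
    SGen 'v
  | SConst real
  | SAdd "'v sym_term" "'v sym_term"
  | SMul "'v sym_term" "'v sym_term"

inductive sym_eq :: "'v::real_vector sym_term \<Rightarrow> 'v sym_term \<Rightarrow> bool" where
  refl: "sym_eq a a"
| sym: "sym_eq a b \<Longrightarrow> sym_eq b a"
| trans: "sym_eq a b \<Longrightarrow> sym_eq b c \<Longrightarrow> sym_eq a c"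
| add_cong: "sym_eq a a' \<Longrightarrow> sym_eq b b' \<Longrightarrow> sym_eq (SAdd a b) (SAdd a' b')"
| mul_cong: "sym_eq a a' \<Longrightarrow> sym_eq b b' \<Longrightarrow> sym_eq (SMul a b) (SMul a' b')"
| add_assoc: "sym_eq (SAdd (SAdd a b) c) (SAdd a (SAdd b c))"
| add_comm: "sym_eq (SAdd a b) (SAdd b a)"
| add_zero: "sym_eq (SAdd (SConst 0) a) a"
| mul_assoc: "sym_eq (SMul (SMul a b) c) (SMul a (SMul b c))"
| mul_comm: "sym_eq (SMul a b) (SMul b a)"
| mul_one: "sym_eq (SMul (SConst 1) a) a"
| mul_zero: "sym_eq (SMul (SConst 0) a) (SConst 0)"
| distrib: "sym_eq (SMul (SAdd a b) c) (SAdd (SMul a c) (SMul b c))"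
| const_add: "sym_eq (SAdd (SConst r) (SConst s)) (SConst (r + s))"
| const_mul: "sym_eq (SMul (SConst r) (SConst s)) (SConst (r * s))"
| gen_add: "sym_eq (SGen (u + v)) (SAdd (SGen u) (SGen v))"
| gen_scale: "sym_eq (SGen (r *\<^sub>R v)) (SMul (SConst r) (SGen v))"

quotient_type (overloaded) 'v sym_alg = "'v::real_vector sym_term" / sym_eq
  by (intro equivpI reflpI sympI transpI) (auto intro: sym_eq.refl sym_eq.sym sym_eq.trans)

primrec term_eval :: "('v \<Rightarrow> 'b) \<Rightarrow> 'v sym_term \<Rightarrow> 'b::{comm_ring_1,real_algebra_1}" where
  "term_eval g (SGen v) = g v"
| "term_eval g (SConst r) = of_real r"
| "term_eval g (SAdd a b) = term_eval g a + term_eval g b"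
| "term_eval g (SMul a b) = term_eval g a * term_eval g b"

lemma term_eval_cong:
  assumes "linear g" "sym_eq a b"
  shows "term_eval g a = term_eval g b"
  using assms(2)
proof (induction rule: sym_eq.induct)
  case (gen_add u v)
  show ?case using linear_add[OF assms(1)] by simp
next
  case (gen_scale r v)
  show ?case using linear_scale[OF assms(1)] by (simp add: scaleR_conv_of_real)
qed (simp_all add: algebra_simps)

instantiation sym_alg :: (real_vector) "{comm_ring_1, real_algebra_1}"
begin

lift_definition zero_sym_alg :: "'a sym_alg" is "SConst 0" .
lift_definition one_sym_alg :: "'a sym_alg" is "SConst 1" .
lift_definition plus_sym_alg :: "'a sym_alg \<Rightarrow> 'a sym_alg \<Rightarrow> 'a sym_alg" is SAdd
  by (rule sym_eq.add_cong)
lift_definition times_sym_alg :: "'a sym_alg \<Rightarrow> 'a sym_alg \<Rightarrow> 'a sym_alg" is SMul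
  by (rule sym_eq.mul_cong)
lift_definition scaleR_sym_alg :: "real \<Rightarrow> 'a sym_alg \<Rightarrow> 'a sym_alg" is "\<lambda>r. SMul (SConst r)"
  by (intro sym_eq.mul_cong sym_eq.refl)
lift_definition uminus_sym_alg :: "'a sym_alg \<Rightarrow> 'a sym_alg" is "SMul (SConst (- 1))"
  by (intro sym_eq.mul_cong sym_eq.refl)
lift_definition minus_sym_alg :: "'a sym_alg \<Rightarrow> 'a sym_alg \<Rightarrow> 'a sym_alg"
  is "\<lambda>a b. SAdd a (SMul (SConst (- 1)) b)"
  by (intro sym_eq.add_cong sym_eq.mul_cong sym_eq.refl)

instance
proof
  fix a b c :: "'a sym_alg" and r s :: real
  show "a + b + c = a + (b + c)" by transfer (rule sym_eq.add_assoc)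
  show "a + b = b + a" by transfer (rule sym_eq.add_comm)
  show "0 + a = a" by transfer (rule sym_eq.add_zero)
  show "a * b * c = a * (b * c)" by transfer (rule sym_eq.mul_assoc)
  show "a * b = b * a" by transfer (rule sym_eq.mul_comm)
  show "1 * a = a" by transfer (rule sym_eq.mul_one)
  show "a * 1 = a" by transfer (meson sym_eq.mul_comm sym_eq.mul_one sym_eq.trans)
  show "a * (b + c) = a * b + a * c"
    by transfer (meson sym_eq.add_cong sym_eq.distrib sym_eq.mul_comm sym_eq.trans)
  show "(a + b) * c = a * c + b * c" by transfer (rule sym_eq.distrib)
  show "a - b = a + - b" by transfer (rule sym_eq.refl)
  show "- a + a = 0"
  proof transfer
    fix x :: "'a sym_term"
    have "sym_eq (SAdd (SMul (SConst (- 1)) x) x)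
                 (SAdd (SMul (SConst (- 1)) x) (SMul (SConst 1) x))"
      by (intro sym_eq.add_cong sym_eq.refl sym_eq.sym[OF sym_eq.mul_one])
    moreover have "sym_eq \<dots> (SMul (SAdd (SConst (- 1)) (SConst 1)) x)"
      by (rule sym_eq.sym[OF sym_eq.distrib])
    moreover have "sym_eq \<dots> (SMul (SConst (- 1 + 1)) x)"
      by (intro sym_eq.mul_cong sym_eq.refl sym_eq.const_add)
    moreover have "sym_eq \<dots> (SConst 0)" by (simp add: sym_eq.mul_zero)
    ultimately show "sym_eq (SAdd (SMul (SConst (- 1)) x) x) (SConst 0)"
      by (meson sym_eq.trans)
  qed
  show "(0::'a sym_alg) \<noteq> 1"
  proof transfer
    show "\<not> sym_eq (SConst 0 :: 'a sym_term) (SConst 1)"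
      using term_eval_cong[of "\<lambda>_::'a. 0::real" "SConst 0" "SConst 1"]
      by (auto simp: linear_zero)
  qed
  show "r *\<^sub>R (a + b) = r *\<^sub>R a + r *\<^sub>R b"
    by transfer
      (meson sym_eq.add_cong sym_eq.distrib sym_eq.mul_comm sym_eq.trans)
  show "(r + s) *\<^sub>R a = r *\<^sub>R a + s *\<^sub>R a"
    by transfer
      (meson sym_eq.const_add sym_eq.distrib sym_eq.mul_cong sym_eq.refl sym_eq.sym sym_eq.trans)
  show "r *\<^sub>R s *\<^sub>R a = (r * s) *\<^sub>R a"
    by transfer
      (meson sym_eq.const_mul sym_eq.mul_assoc sym_eq.mul_cong sym_eq.refl sym_eq.sym sym_eq.trans)
  show "1 *\<^sub>R a = a" by transfer (rule sym_eq.mul_one)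
  show "r *\<^sub>R a * b = r *\<^sub>R (a * b)" by transfer (rule sym_eq.mul_assoc)
  show "a * r *\<^sub>R b = r *\<^sub>R (a * b)"
    by transfer
      (meson sym_eq.mul_assoc sym_eq.mul_comm sym_eq.mul_cong sym_eq.refl sym_eq.sym sym_eq.trans)
qed

end

text \<open>The inclusion of \<open>V\<close> into \<open>S(V)\<close>.\<close>

lift_definition sym_incl :: "'v::real_vector \<Rightarrow> 'v sym_alg" is SGen .

lemma linear_sym_incl: "linear sym_incl"
  by (intro linearI; transfer) (rule sym_eq.gen_add sym_eq.gen_scale)+

definition alg_hom :: "('a::real_algebra_1 \<Rightarrow> 'b::real_algebra_1) \<Rightarrow> bool" where
  "alg_hom \<phi> \<longleftrightarrow> linear \<phi> \<and> \<phi> 1 = 1 \<and> (\<forall>a b. \<phi> (a * b) = \<phi> a * \<phi> b)"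

lemma sym_const: "abs_sym_alg (SConst r) = (r *\<^sub>R 1 :: 'v::real_vector sym_alg)"
proof -
  have "sym_eq (SMul (SConst r) (SConst 1) :: 'v sym_term) (SConst r)"
    using sym_eq.const_mul[of r 1] by simp
  then show ?thesis
    by transfer (rule sym_eq.sym)
qed

theorem sym_alg_universal:
  fixes g :: "'v::real_vector \<Rightarrow> 'b::{comm_ring_1,real_algebra_1}"
  assumes g: "linear g"
  shows "\<exists>!\<phi>. alg_hom \<phi> \<and> (\<forall>v. \<phi> (sym_incl v) = g v)"
proof -
  define \<phi> where "\<phi> x = term_eval g (rep_sym_alg x)" for x
  have abs: "\<phi> (abs_sym_alg a) = term_eval g a" for a
    unfolding \<phi>_def
    by (intro term_eval_cong[OF g]) (rule Quotient3_rep_abs[OF Quotient3_sym_alg sym_eq.refl])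
  have surj: "\<exists>a. x = abs_sym_alg a" for x :: "'v sym_alg"
    by (metis Quotient3_abs_rep[OF Quotient3_sym_alg])
  have add: "\<phi> (x + y) = \<phi> x + \<phi> y" for x y
    using surj[of x] surj[of y] by (auto simp: abs plus_sym_alg.abs_eq)
  have scale: "\<phi> (r *\<^sub>R x) = r *\<^sub>R \<phi> x" for r x
    using surj[of x] by (auto simp: abs scaleR_sym_alg.abs_eq scaleR_conv_of_real[where 'a='b])
  have mul: "\<phi> (x * y) = \<phi> x * \<phi> y" for x y
    using surj[of x] surj[of y] by (auto simp: abs times_sym_alg.abs_eq)
  have ex: "alg_hom \<phi> \<and> (\<forall>v. \<phi> (sym_incl v) = g v)"
    unfolding alg_hom_def
    by (auto intro!: linearI simp: add scale mul one_sym_alg.abs_eq sym_incl.abs_eq abs)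
  have unique: "\<psi> (abs_sym_alg a) = term_eval g a"
    if \<psi>: "alg_hom \<psi> \<and> (\<forall>v. \<psi> (sym_incl v) = g v)" for \<psi> and a :: "'v sym_term"
  proof (induction a)
    case (SGen v)
    then show ?case using \<psi> by (simp add: sym_incl.abs_eq[symmetric])
  next
    case (SConst r)
    have "\<psi> (r *\<^sub>R 1) = r *\<^sub>R 1" using \<psi> by (simp add: alg_hom_def linear_scale)
    then show ?case by (simp add: sym_const of_real_def)
  next
    case (SAdd a b)
    then show ?case using \<psi>
      by (simp add: plus_sym_alg.abs_eq[symmetric] alg_hom_def linear_add)
  next
    case (SMul a b)
    then show ?case using \<psi>
      by (simp add: times_sym_alg.abs_eq[symmetric] alg_hom_def)
  qed
  show ?thesis
  proof (rule ex1I, rule ex, rule ext)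
    fix \<psi> :: "'v sym_alg \<Rightarrow> 'b" and x :: "'v sym_alg"
    assume "alg_hom \<psi> \<and> (\<forall>v. \<psi> (sym_incl v) = g v)"
    note * = unique[OF this]
    obtain a where "x = abs_sym_alg a" using surj[of x] by blast
    then show "\<psi> x = \<phi> x" by (simp add: * abs)
  qed
qed

text \<open>
  \<open>char_ext \<xi> f\<close> is \<open>f(\<xi>)\<close>: the value at \<open>f\<close> of the unique character extending \<open>\<xi>\<close>
  (see \<open>sym_alg_universal\<close>).
\<close>

definition char_ext :: "('v::real_vector \<Rightarrow> real) \<Rightarrow> 'v sym_alg \<Rightarrow> real" where
  "char_ext \<xi> = (THE \<phi>. alg_hom \<phi> \<and> (\<forall>v. \<phi> (sym_incl v) = \<xi> v))"

definition alg_dual :: "('v::real_vector \<Rightarrow> real) set" where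
  "alg_dual = {\<xi>. linear \<xi>}"

definition sym_pos :: "'v::real_vector sym_alg set" where
  "sym_pos = {f. \<forall>\<xi>\<in>alg_dual. 0 \<le> char_ext \<xi> f}"

text \<open>
  The \<open>n\<close>-th term is that of index \<open>n + 1\<close> in the usual numbering, since the series starts
  at 1.  A sum of \<open>ennreal\<close>s always exists, so the condition is divergence to infinity.
\<close>

definition carleman :: "('v::real_vector sym_alg \<Rightarrow> real) \<Rightarrow> 'v \<Rightarrow> bool" where
  "carleman L t \<longleftrightarrow>
     (\<Sum>n. let m = L (sym_incl t ^ (2 * Suc n)) in
          if m = 0 then (\<infinity>::ennreal) else ennreal (m powr (- 1 / (2 * real (Suc n))))) = \<infinity>"


section \<open>Cylinder sets and cylinder measures\<close>

text \<open>
  Throughout, \<open>D\<close> is a space of linear functionals on \<open>'v\<close>: the continuous dual \<open>W'\<close> of a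
  locally convex topology.  The topology enters these notions only through \<open>D\<close>.  For the finest
  locally convex topology, \<open>D\<close> is \<open>alg_dual\<close>.
\<close>

definition fin_dim_subspace :: "'v::real_vector set \<Rightarrow> bool" where
  "fin_dim_subspace F \<longleftrightarrow> (\<exists>B. finite B \<and> F = span B)"

definition annihilator :: "('v \<Rightarrow> real) set \<Rightarrow> 'v set \<Rightarrow> ('v \<Rightarrow> real) set" where
  "annihilator D F = {l \<in> D. \<forall>f\<in>F. l f = 0}"

definition dual_coset ::
  "('v \<Rightarrow> real) set \<Rightarrow> 'v set \<Rightarrow> ('v \<Rightarrow> real) \<Rightarrow> ('v \<Rightarrow> real) set" where
  "dual_coset D F l = (\<lambda>m v. l v + m v) ` annihilator D F"

definition dual_quot :: "('v \<Rightarrow> real) set \<Rightarrow> 'v set \<Rightarrow> ('v \<Rightarrow> real) set set" where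
  "dual_quot D F = dual_coset D F ` D"

text \<open>
  The linear functionals on the finite-dimensional space \<open>W' / F\<degree>\<close> are exactly the
  evaluations at vectors of \<open>F\<close>.  Its unique Hausdorff vector space topology is therefore
  generated by the preimages of open sets under these evaluations.
\<close>

definition dual_quot_topology ::
  "('v \<Rightarrow> real) set \<Rightarrow> 'v set \<Rightarrow> ('v \<Rightarrow> real) set topology" where
  "dual_quot_topology D F =
     topology_generated_by {dual_coset D F ` {l \<in> D. l f \<in> U} |f U. f \<in> F \<and> open U}"

definition dual_quot_borel ::
  "('v \<Rightarrow> real) set \<Rightarrow> 'v set \<Rightarrow> ('v \<Rightarrow> real) set set set" where
  "dual_quot_borel D F =
     sigma_sets (dual_quot D F) {U. openin (dual_quot_topology D F) U}"

definition cyl_set ::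
  "('v \<Rightarrow> real) set \<Rightarrow> 'v set \<Rightarrow> ('v \<Rightarrow> real) set set \<Rightarrow> ('v \<Rightarrow> real) set" where
  "cyl_set D F M = {l \<in> D. dual_coset D F l \<in> M}"

definition cyl_sets_over ::
  "('v \<Rightarrow> real) set \<Rightarrow> 'v set \<Rightarrow> ('v \<Rightarrow> real) set set" where
  "cyl_sets_over D F = cyl_set D F ` dual_quot_borel D F"

definition cyl_sets :: "('v::real_vector \<Rightarrow> real) set \<Rightarrow> ('v \<Rightarrow> real) set set" where
  "cyl_sets D = (\<Union>F\<in>{F. fin_dim_subspace F}. cyl_sets_over D F)"

definition cylinder_measure ::
  "('v::real_vector \<Rightarrow> real) set \<Rightarrow> (('v \<Rightarrow> real) set \<Rightarrow> real) \<Rightarrow> bool" where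
  "cylinder_measure D \<mu> \<longleftrightarrow>
     (\<forall>N\<in>cyl_sets D. 0 \<le> \<mu> N \<and> \<mu> N \<le> 1) \<and>
     \<mu> D = 1 \<and>
     (\<forall>F N. fin_dim_subspace F \<and> (\<forall>n::nat. N n \<in> cyl_sets_over D F) \<and> disjoint_family N \<longrightarrow>
        (\<lambda>n. \<mu> (N n)) sums \<mu> (\<Union>n. N n))"

definition cyl_marginal ::
  "('v \<Rightarrow> real) set \<Rightarrow> (('v \<Rightarrow> real) set \<Rightarrow> real) \<Rightarrow> 'v set \<Rightarrow> ('v \<Rightarrow> real) set measure" where
  "cyl_marginal D \<mu> F =
     measure_of (dual_quot D F) (dual_quot_borel D F) (\<lambda>M. ennreal (\<mu> (cyl_set D F M)))"

text \<open>
  Measurability of \<open>h\<close> in the next definition is part of \<open>integrable\<close>.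
\<close>

definition cyl_representation ::
  "('v::real_vector \<Rightarrow> real) set \<Rightarrow> (('v \<Rightarrow> real) set \<Rightarrow> real) \<Rightarrow> (('v \<Rightarrow> real) \<Rightarrow> real) \<Rightarrow>
     'v set \<Rightarrow> (('v \<Rightarrow> real) set \<Rightarrow> real) \<Rightarrow> bool" where
  "cyl_representation D \<mu> g F h \<longleftrightarrow>
     fin_dim_subspace F \<and> (\<forall>l\<in>D. g l = h (dual_coset D F l)) \<and> integrable (cyl_marginal D \<mu> F) h"

definition cyl_integrable ::
  "('v::real_vector \<Rightarrow> real) set \<Rightarrow> (('v \<Rightarrow> real) set \<Rightarrow> real) \<Rightarrow> (('v \<Rightarrow> real) \<Rightarrow> real) \<Rightarrow> bool"
  where
  "cyl_integrable D \<mu> g \<longleftrightarrow> (\<exists>F h. cyl_representation D \<mu> g F h)"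

text \<open>The value does not depend on the representation, so the description is unique.\<close>

definition cyl_integral ::
  "('v::real_vector \<Rightarrow> real) set \<Rightarrow> (('v \<Rightarrow> real) set \<Rightarrow> real) \<Rightarrow> (('v \<Rightarrow> real) \<Rightarrow> real) \<Rightarrow> real"
  where
  "cyl_integral D \<mu> g =
     (THE r. \<exists>F h. cyl_representation D \<mu> g F h \<and> r = integral\<^sup>L (cyl_marginal D \<mu> F) h)"

definition moment_functional :: "('v::real_vector sym_alg \<Rightarrow> real) \<Rightarrow> bool" where
  "moment_functional L \<longleftrightarrow>
     (\<exists>\<mu>. cylinder_measure alg_dual \<mu> \<and>
        (\<forall>f. cyl_integrable alg_dual \<mu> (\<lambda>\<xi>. char_ext \<xi> f) \<and>
             L f = cyl_integral alg_dual \<mu> (\<lambda>\<xi>. char_ext \<xi> f)))"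


section \<open>Nuclear locally convex spaces\<close>

text \<open>
  Topologies on the vector space \<open>'v\<close> are explicit, since the type carries none of its own.
\<close>

definition locally_convex_hausdorff :: "'v::real_vector topology \<Rightarrow> bool" where
  "locally_convex_hausdorff T \<longleftrightarrow>
     topspace T = UNIV \<and>
     continuous_map (prod_topology T T) T (\<lambda>(x, y). x + y) \<and>
     continuous_map (prod_topology euclideanreal T) T (\<lambda>(c, x). c *\<^sub>R x) \<and>
     Hausdorff_space T \<and>
     (\<forall>U. openin T U \<and> 0 \<in> U \<longrightarrow> (\<exists>C. openin T C \<and> convex C \<and> 0 \<in> C \<and> C \<subseteq> U))"

definition cont_seminorm :: "'v::real_vector topology \<Rightarrow> ('v \<Rightarrow> real) \<Rightarrow> bool" where
  "cont_seminorm T p \<longleftrightarrow>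
     (\<forall>x y. p (x + y) \<le> p x + p y) \<and> (\<forall>c x. p (c *\<^sub>R x) = \<bar>c\<bar> * p x) \<and>
     continuous_map T euclideanreal p"

definition top_dual :: "'v::real_vector topology \<Rightarrow> ('v \<Rightarrow> real) set" where
  "top_dual T = {l. linear l \<and> continuous_map T euclideanreal l}"

text \<open>
  For seminorms \<open>p \<le> q\<close>, the canonical map from \<open>V / ker q\<close> (normed by \<open>q\<close>) to \<open>V / ker p\<close>
  (normed by \<open>p\<close>) is nuclear.  This is the definition of a nuclear map
  \<open>x \<mapsto> (\<Sum>n. a n x *\<^sub>R y n)\<close> between normed spaces, with the classes of the target given by
  representatives \<open>y n\<close> in \<open>V\<close> and with \<open>c n\<close> bounding the norm of the functional \<open>a n\<close>.  (Passing
  to completions gives the same notion, because every element of the completion is the sum of an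
  absolutely convergent series in the space, of total norm arbitrarily close to its own norm.)
\<close>

definition nuclear_canonical_map :: "('v::real_vector \<Rightarrow> real) \<Rightarrow> ('v \<Rightarrow> real) \<Rightarrow> bool" where
  "nuclear_canonical_map q p \<longleftrightarrow>
     (\<exists>(a :: nat \<Rightarrow> 'v \<Rightarrow> real) (c :: nat \<Rightarrow> real) (y :: nat \<Rightarrow> 'v).
        (\<forall>n. linear (a n) \<and> 0 \<le> c n \<and> (\<forall>x. \<bar>a n x\<bar> \<le> c n * q x)) \<and>
        summable (\<lambda>n. c n * p (y n)) \<and>
        (\<forall>x. (\<lambda>N. p (x - (\<Sum>n<N. a n x *\<^sub>R y n))) \<longlonglongrightarrow> 0))"

definition nuclear_topology :: "'v::real_vector topology \<Rightarrow> bool" where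
  "nuclear_topology T \<longleftrightarrow>
     locally_convex_hausdorff T \<and>
     (\<forall>p. cont_seminorm T p \<longrightarrow>
        (\<exists>q. cont_seminorm T q \<and> (\<forall>x. p x \<le> q x) \<and> nuclear_canonical_map q p))"

end

theory Submission
  imports Defs "HOL-Probability.Probability"
begin

text \<open>
  In both cases \<open>L\<close> is nonnegative on a cone \<open>P\<close> that contains the squares, is stable under
  multiplication by squares, and is stable under division by \<open>1 + t\<^sup>2\<close> for \<open>t \<in> S\<close>.  In case (i) this
  is \<open>sym_pos\<close>.  In case (ii) it is the cone of all \<open>a\<close> with \<open>L (a b\<^sup>2) \<ge> 0\<close> for every \<open>b\<close>: by Carleman's
  condition and the Christoffel--Darboux identity, \<open>1 + t\<^sup>2\<close> has approximate inverses with respect to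
  every weight.  A Hahn--Banach argument then extends \<open>L\<close> to the fractions with denominators
  \<open>\<Prod> (1 + t\<^sup>2)\<close>, positively on \<open>P\<close>.

  Among these fractions are \<open>1 / (1 + t\<^sup>2)\<close> and \<open>1 / 2 + t / (1 + t\<^sup>2)\<close>, which take their values in
  \<open>[0, 1]\<close>.  The extended functional on monomials in them and in their complements is the law of
  exchangeable coin tosses, so that Kolmogorov's theorem and de Finetti's averages replace the Riesz
  representation theorem.  This yields a random linear functional \<open>X\<close> on \<open>V\<close> with moments \<open>L\<close>, whose
  law is the cylinder measure.

  In the nuclear case, \<open>x = \<Sum> a\<^sub>n(x) y\<^sub>n\<close> with respect to \<open>q\<close>, where \<open>\<bar>a\<^sub>n(x)\<bar> \<le> c\<^sub>n p(x)\<close> and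
  \<open>\<Sum> c\<^sub>n q(y\<^sub>n) < \<infinity>\<close>.  As \<open>E \<bar>X(y\<^sub>n)\<bar> \<le> q(y\<^sub>n)\<close>, the sum \<open>\<Sum> c\<^sub>n \<bar>X(y\<^sub>n)\<bar>\<close> is almost surely finite,
  and \<open>\<Sum> a\<^sub>n(x) X(y\<^sub>n)\<close> is a version of \<open>X(x)\<close> that is continuous in \<open>x\<close>.
\<close>


section \<open>Carleman's inequality\<close>

text \<open>In several variables, positivity on squares does not imply positivity on
  \<open>sym_pos\<close>; in case (ii) division by \<open>1 + t\<^sup>2\<close> must therefore be
  justified inside the algebra, before any measure is available. Carleman's condition concerns one
  basis vector, while the weights involve all the others. Cauchy-Schwarz, L(t^(2n) w)^2 <= L(t^(4n))
  L(w^2), passes the condition on to every weight, at the price of keeping only every second term.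
  What Carleman's condition yields is that t - i has approximate inverses: the approximation error
  is the reciprocal of a sum of squares of orthonormal polynomials at i, and this sum diverges.

  The fractions only see the compactified line, where t = infinity corresponds to the value 0 of 1 /
  (1 + t^2). This value is almost surely not taken because L is finite on the denominators: the
  geometric series for 1 + t^2 has bounded expected partial sums. Since a basis may be uncountable,
  null sets may not be collected over it. For this reason the random functional is defined by linear
  extension from the basis for every outcome, and in the nuclear case one random bound controls all
  vectors at once.\<close>

lemma exp_mean_le:
  fixes y :: "nat \<Rightarrow> real"
  assumes "n > 0"
  shows "exp ((\<Sum>j<n. y j) / n) \<le> (\<Sum>j<n. exp (y j)) / n"
proof -
  define m where "m = (\<Sum>j<n. y j) / n"
  \<comment> \<open>The tangent line of \<open>exp\<close> at the mean \<open>m\<close>; after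
    summation the linear terms cancel.\<close>
  have "exp m * (1 + (y j - m)) \<le> exp (y j)" for j
    using mult_left_mono[OF exp_ge_add_one_self[of "y j - m"], of "exp m"] by (simp add: exp_diff)
  then have "(\<Sum>j<n. exp m * (1 + (y j - m))) \<le> (\<Sum>j<n. exp (y j))" by (intro sum_mono)
  moreover have "(\<Sum>j<n. exp m * (1 + (y j - m))) = exp m * n"
    using assms by (simp add: sum_distrib_left[symmetric] sum.distrib sum_subtractf m_def)
  ultimately show ?thesis using assms by (simp add: m_def field_simps)
qed

text \<open>Polya's proof: the weights \<open>(j + 2) ^ (j + 1) / (j + 1) ^ j\<close> have geometric means \<open>n + 1\<close>.\<close>

lemma carleman_inequality:
  fixes a :: "nat \<Rightarrow> real"
  assumes pos: "\<And>j. 0 < a j"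
  shows "(\<Sum>n<N. exp ((\<Sum>j<Suc n. ln (a j)) / Suc n)) \<le> exp 1 * (\<Sum>j<N. a j)"
proof -
  define c :: "nat \<Rightarrow> real" where "c j = (real j + 2) ^ (j + 1) / (real j + 1) ^ j" for j
  have cpos: "0 < c j" for j by (simp add: c_def)
  have lnc: "(\<Sum>j<n. ln (c j)) = n * ln (real n + 1)" for n
  proof (induction n)
    case (Suc n)
    have "ln (c n) = (n + 1) * ln (real n + 2) - n * ln (real n + 1)"
      by (simp add: c_def ln_div ln_mult ln_realpow del: power_Suc) 
    then show ?case using Suc by (simp add: algebra_simps)
  qed simp
  have cle: "c j \<le> exp 1 * (real j + 1)" for j
  proof -
    have "(1 + 1 / real (j + 1)) ^ (j + 1) \<le> exp (1 / real (j + 1)) ^ (j + 1)"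
      by (intro power_mono) (auto intro: exp_ge_add_one_self)
    also have "\<dots> = exp 1" by (simp only: exp_of_nat_mult[symmetric]) simp
    finally have "((real j + 2) / (real j + 1)) ^ (j + 1) \<le> exp 1"
      by (simp add: field_simps del: power_Suc)
    moreover have "c j = ((real j + 2) / (real j + 1)) ^ (j + 1) * (real j + 1)"
      by (simp add: c_def power_divide)
    ultimately show ?thesis by (simp only: mult_right_mono)
  qed
  \<comment> \<open>The inequality of the means for the numbers \<open>c j * a j\<close>: the first
    \<open>Suc n\<close> weights have geometric mean n + 2. The factor 1 / ((n + 1)(n + 2)) is
    written as a difference so that it telescopes.\<close>
  have term_le: "exp ((\<Sum>j<Suc n. ln (a j)) / Suc n)
      \<le> (\<Sum>j<Suc n. c j * a j) * (1 / Suc n - 1 / (Suc n + 1))" for n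
  proof -
    have "ln (c j * a j) = ln (c j) + ln (a j)" for j
      using cpos[of j] pos[of j] by (simp add: ln_mult)
    then have "(\<Sum>j<Suc n. ln (c j * a j)) = (\<Sum>j<Suc n. ln (a j)) + Suc n * ln (real (Suc n) + 1)"
      using lnc[of "Suc n"] by (simp only: sum.distrib)
    then have "exp ((\<Sum>j<Suc n. ln (c j * a j)) / Suc n)
        = exp ((\<Sum>j<Suc n. ln (a j)) / Suc n) * (real (Suc n) + 1)"
      by (simp add: add_divide_distrib exp_add del: of_nat_Suc sum.lessThan_Suc)
    moreover have "exp ((\<Sum>j<Suc n. ln (c j * a j)) / Suc n) \<le> (\<Sum>j<Suc n. c j * a j) / Suc n"
      using exp_mean_le[of "Suc n" "\<lambda>j. ln (c j * a j)"] cpos pos by simp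
    ultimately have "exp ((\<Sum>j<Suc n. ln (a j)) / Suc n)
        \<le> (\<Sum>j<Suc n. c j * a j) / Suc n / (real (Suc n) + 1)"
      by (simp add: pos_le_divide_eq mult_ac del: sum.lessThan_Suc)
    also have "\<dots> = (\<Sum>j<Suc n. c j * a j) * (1 / Suc n - 1 / (Suc n + 1))"
      by (simp add: field_simps)
    finally show ?thesis .
  qed
  have "(\<Sum>n<N. exp ((\<Sum>j<Suc n. ln (a j)) / Suc n))
      \<le> (\<Sum>n<N. (\<Sum>j<Suc n. c j * a j) * (1 / Suc n - 1 / (Suc n + 1)))"
    by (intro sum_mono term_le)
  \<comment> \<open>Exchange of the two summations: the factors of \<open>c j * a j\<close>
    telescope over n from j to N - 1.\<close>
  also have "\<dots> = (\<Sum>j<N. c j * a j * (1 / Suc j - 1 / (real N + 1)))"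
  proof (induction N)
    case (Suc N)
    have "(\<Sum>j<Suc N. c j * a j * (1 / Suc j - 1 / (real (Suc N) + 1)))
      = (\<Sum>j<N. c j * a j * (1 / Suc j - 1 / (real N + 1)))
        + (\<Sum>j<Suc N. c j * a j) * (1 / Suc N - 1 / (Suc N + 1))"
      by (simp add: algebra_simps sum.distrib sum_subtractf sum_distrib_left)
    then show ?case using Suc by simp
  qed simp
  also have "\<dots> \<le> (\<Sum>j<N. exp 1 * a j)"
  proof (intro sum_mono)
    fix j
    have "c j * a j * (1 / Suc j - 1 / (real N + 1)) \<le> c j * a j * (1 / Suc j)"
      using cpos[of j] pos[of j] by (intro mult_left_mono) auto
    also have "\<dots> = c j / (real j + 1) * a j" by simp
    also have "\<dots> \<le> exp 1 * a j"
      using cle[of j] pos[of j] by (intro mult_right_mono) (auto simp: pos_divide_le_eq)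
    finally show "c j * a j * (1 / Suc j - 1 / (real N + 1)) \<le> exp 1 * a j" .
  qed
  finally show ?thesis by (simp add: sum_distrib_left)
qed

section \<open>Orthogonal polynomials at the imaginary unit\<close>

locale psd_functional =
  fixes L :: "'a::{comm_ring_1,real_algebra_1} \<Rightarrow> real"
  assumes lin: "linear L" and psd: "0 \<le> L (b\<^sup>2)"
begin

lemmas L_simps = linear_add[OF lin] linear_diff[OF lin] linear_scale[OF lin] linear_0[OF lin]
  linear_neg[OF lin]

lemma Cauchy_Schwarz: "(L (a * b))\<^sup>2 \<le> L (a\<^sup>2) * L (b\<^sup>2)"
proof -
  have quad: "0 \<le> L (a\<^sup>2) + 2 * r * L (a * b) + r\<^sup>2 * L (b\<^sup>2)" for r
  proof -
    have "(a + r *\<^sub>R b)\<^sup>2 = a\<^sup>2 + (2 * r) *\<^sub>R (a * b) + r\<^sup>2 *\<^sub>R b\<^sup>2"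
      by (simp add: power2_eq_square algebra_simps scaleR_2 flip: scaleR_scaleR)
    then show ?thesis using psd[of "a + r *\<^sub>R b"] by (simp add: L_simps)
  qed
  show ?thesis
  proof (cases "L (b\<^sup>2) = 0")
    case True
    have "L (a * b) = 0"
    proof (rule ccontr)
      assume nz: "L (a * b) \<noteq> 0"
      \<comment> \<open>At this value of \<open>r\<close> the quadratic, here of degree one, equals
        -1.\<close>
      show False using quad[of "- (L (a\<^sup>2) + 1) / (2 * L (a * b))"] nz True by (simp add: field_simps)
    qed
    then show ?thesis using True by simp
  next
    case False
    then have pos: "0 < L (b\<^sup>2)" using psd[of b] by simp
    have "0 \<le> L (a\<^sup>2) - (L (a * b))\<^sup>2 / L (b\<^sup>2)"
      using quad[of "- L (a * b) / L (b\<^sup>2)"] pos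
      by (simp add: power2_eq_square divide_simps)
    then show ?thesis using pos by (simp add: field_simps)
  qed
qed

lemma L_mult_eq_0:
  assumes "L (a\<^sup>2) = 0"
  shows "L (a * b) = 0"
  using Cauchy_Schwarz[of a b] assms by simp

end

text \<open>\<open>a + \<i> b\<close> is a multiple \<open>(t - \<i>) (q1 + \<i> q2)\<close> of \<open>t - \<i>\<close> in the complexification.\<close>

definition i_multiple :: "'a::comm_ring_1 \<Rightarrow> 'a \<Rightarrow> 'a \<Rightarrow> bool" where
  "i_multiple t a b \<longleftrightarrow> (\<exists>q1 q2. a = t * q1 + q2 \<and> b = t * q2 - q1)"

text \<open>A vanishing moment is split off because \<open>0 powr x = 0\<close>, while Carleman's
  convention counts such a term as infinite.\<close>

definition carleman_at :: "('a::comm_ring_1 \<Rightarrow> real) \<Rightarrow> 'a \<Rightarrow> bool" where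
  "carleman_at L t \<longleftrightarrow> (\<exists>n. L (t ^ (2 * Suc n)) = 0) \<or>
     \<not> summable (\<lambda>n. L (t ^ (2 * Suc n)) powr (- 1 / (2 * real (Suc n))))"

context
  fixes L :: "'a::{comm_ring_1,real_algebra_1} \<Rightarrow> real" and t :: 'a
begin

text \<open>Monic orthogonal polynomials in \<open>t\<close> for the form L(a b), by their
  three-term recurrence. Division by zero sets in after the first polynomial of norm 0; the results
  below only use the polynomials up to that one.\<close>

fun orth :: "nat \<Rightarrow> 'a" where
  "orth 0 = 1"
| "orth (Suc 0) = t - (L (t * 1\<^sup>2) / L (1\<^sup>2)) *\<^sub>R 1"
| "orth (Suc (Suc n)) = t * orth (Suc n) - (L (t * (orth (Suc n))\<^sup>2) / L ((orth (Suc n))\<^sup>2)) *\<^sub>R orth (Suc n)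
     - (L ((orth (Suc n))\<^sup>2) / L ((orth n)\<^sup>2)) *\<^sub>R orth n"

definition orth_norm2 :: "nat \<Rightarrow> real" where
  "orth_norm2 n = L ((orth n)\<^sup>2)"

definition jacobi_diag :: "nat \<Rightarrow> real" where
  "jacobi_diag n = L (t * (orth n)\<^sup>2) / orth_norm2 n"

text \<open>The value 0 at 0 lets one recurrence cover all indices: for n = 0 the term with index
  \<open>n - 1\<close>, which is again 0, is removed.\<close>

definition jacobi_off :: "nat \<Rightarrow> real" where
  "jacobi_off n = (if n = 0 then 0 else orth_norm2 n / orth_norm2 (n - 1))"

text \<open>Values at the imaginary unit of the polynomials whose values at \<open>t\<close> are the
  \<open>orth n\<close>. An element of the algebra need not determine a polynomial in
  \<open>t\<close>, so the recurrence is run again over the complex numbers.\<close>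

fun orth_at_i :: "nat \<Rightarrow> complex" where
  "orth_at_i 0 = 1"
| "orth_at_i (Suc 0) = \<i> - jacobi_diag 0"
| "orth_at_i (Suc (Suc n)) =
     (\<i> - jacobi_diag (Suc n)) * orth_at_i (Suc n) - jacobi_off (Suc n) * orth_at_i n"

end

context psd_functional
begin

context
  fixes t :: 'a
begin

abbreviation "P \<equiv> orth L t"
abbreviation "h \<equiv> orth_norm2 L t"
abbreviation "\<alpha> \<equiv> jacobi_diag L t"
abbreviation "\<beta> \<equiv> jacobi_off L t"
abbreviation "z \<equiv> orth_at_i L t"

lemma orth_Suc: "P (Suc n) = t * P n - \<alpha> n *\<^sub>R P n - \<beta> n *\<^sub>R P (n - 1)"
  by (cases n) (simp_all add: orth_norm2_def jacobi_diag_def jacobi_off_def)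

lemma t_mult_orth: "t * P n = P (Suc n) + \<alpha> n *\<^sub>R P n + \<beta> n *\<^sub>R P (n - 1)"
  by (simp add: orth_Suc)

lemma orth_at_i_Suc: "z (Suc n) = (\<i> - \<alpha> n) * z n - \<beta> n * z (n - 1)"
  by (cases n) (simp_all add: jacobi_off_def)

text \<open>Multiplication by \<open>t\<close> is symmetric for the form, so in L(t P_k P_m) the
  factor \<open>t\<close> can be moved to P_m and expanded there. Only m = k and m + 1 = k leave a
  nonzero term, and the Jacobi coefficients are chosen to cancel these two.\<close>

lemma orth_orthogonal:
  assumes "\<And>j. j < n \<Longrightarrow> h j \<noteq> 0" "m < n"
  shows "L (P n * P m) = 0"
  using assms
proof (induction n arbitrary: m rule: less_induct)
  case (less n)
  then obtain k where n: "n = Suc k" by (cases n) auto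
  have IH: "L (P i * P j) = 0" if "i \<le> k" "j < i" for i j
    using less.IH[of i j] less.prems(1) that n by auto
  have hP: "L (P i * P i) = h i" for i by (simp add: orth_norm2_def power2_eq_square)
  have "P n * P m = P k * (t * P m) - \<alpha> k *\<^sub>R (P k * P m) - \<beta> k *\<^sub>R (P (k - 1) * P m)"
    unfolding n orth_Suc by (simp add: algebra_simps)
  then have eq: "L (P n * P m) = L (P k * (t * P m)) - \<alpha> k * L (P k * P m) - \<beta> k * L (P (k - 1) * P m)"
    by (simp add: L_simps)
  show ?case
  proof (cases "m = k")
    case True
    have "P k * (t * P k) = t * (P k)\<^sup>2" by (simp add: power2_eq_square algebra_simps)
    then have "L (P k * (t * P m)) = \<alpha> k * h k"
      using less.prems(1)[of k] n True by (simp add: jacobi_diag_def)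
    moreover have "\<beta> k * L (P (k - 1) * P m) = 0"
      using IH[of k "k - 1"] True by (cases "k = 0") (auto simp: jacobi_off_def mult.commute)
    ultimately show ?thesis using eq True hP by simp
  next
    case False
    then have mk: "m < k" using less.prems(2) n by simp
    have "P k * (t * P m) = P k * P (Suc m) + \<alpha> m *\<^sub>R (P k * P m) + \<beta> m *\<^sub>R (P k * P (m - 1))"
      unfolding t_mult_orth by (simp add: algebra_simps)
    then have "L (P k * (t * P m)) = L (P k * P (Suc m))"
      using IH[of k m] IH[of k "m - 1"] mk by (simp add: L_simps)
    moreover have "L (P k * P (Suc m)) = \<beta> k * L (P (k - 1) * P m)"
    proof (cases "Suc m = k")
      case True
      then show ?thesis using hP[of k] hP[of m] less.prems(1)[of m] n
        by (auto simp: jacobi_off_def)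
    next
      case False
      then show ?thesis using IH[of k "Suc m"] IH[of "k - 1" m] mk by auto
    qed
    ultimately show ?thesis using eq IH[of k m] mk by simp
  qed
qed

text \<open>Repeated use of the recurrence turns \<open>t ^ k * P m\<close> into
  \<open>P (k + m)\<close> plus terms of lower index. With m = 0 this expresses that
  \<open>P n\<close> is monic, without a notion of degree.\<close>

lemma orth_mult_power:
  assumes "\<And>j. j < n \<Longrightarrow> h j \<noteq> 0" "k + m \<le> n"
  shows "L (P n * (t ^ k * P m)) = (if k + m = n then h n else 0)"
  using assms(2)
proof (induction k arbitrary: m)
  case 0
  then show ?case using orth_orthogonal[of n m] assms(1)
    by (auto simp: orth_norm2_def power2_eq_square)
next
  case (Suc k)
  have "P n * (t ^ Suc k * P m) = P n * (t ^ k * (t * P m))" by (simp add: algebra_simps)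
  also have "\<dots> = P n * (t ^ k * P (Suc m)) + \<alpha> m *\<^sub>R (P n * (t ^ k * P m)) + \<beta> m *\<^sub>R (P n * (t ^ k * P (m - 1)))"
    unfolding t_mult_orth by (simp add: algebra_simps)
  finally show ?case using Suc.IH[of "Suc m"] Suc.IH[of m] Suc.IH[of "m - 1"] Suc.prems
    by (simp add: L_simps)
qed

lemma orth_norm2_nonneg: "0 \<le> h n"
  unfolding orth_norm2_def by (rule psd)

text \<open>\<open>orth n\<close> has the least norm among the monic polynomials of degree \<open>n\<close>.\<close>

lemma orth_norm2_le:
  assumes "\<And>j. j < n \<Longrightarrow> h j \<noteq> 0"
  shows "h n \<le> L (t ^ (2 * n))"
proof -
  have "L (P n * t ^ n) = h n" using orth_mult_power[of n n 0] assms by simp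
  then have "(h n)\<^sup>2 \<le> h n * L (t ^ (2 * n))"
    using Cauchy_Schwarz[of "P n" "t ^ n"]
    by (simp add: orth_norm2_def power_mult[symmetric] mult.commute)
  moreover have "0 \<le> L (t ^ (2 * n))" using psd[of "t ^ n"] by (simp add: power_mult[symmetric] mult.commute)
  ultimately show ?thesis
    by (cases "h n = 0") (use orth_norm2_nonneg[of n] in \<open>auto simp: power2_eq_square\<close>)
qed

text \<open>The Christoffel-Darboux kernel on the diagonal at i. Its reciprocal is the error of the
  approximation constructed in \<open>i_approximation\<close>.\<close>

definition "christoffel n = (\<Sum>k\<le>n. (cmod (z k))\<^sup>2 / h k)"

text \<open>The identity at the pair i and -i. The diagonal Jacobi coefficients are real and drop
  out of the imaginary part, the summand i contributes \<open>(cmod (z n))\<^sup>2\<close>, and the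
  off-diagonal coefficients \<open>\<beta> (Suc n) = h (Suc n) / h n\<close> make the rest
  telescope.\<close>

lemma christoffel_darboux:
  assumes "\<And>j. j \<le> n \<Longrightarrow> h j \<noteq> 0"
  shows "Im (z (Suc n) * cnj (z n)) = h n * christoffel n"
  using assms
proof (induction n)
  case 0
  then show ?case by (simp add: christoffel_def jacobi_off_def)
next
  case (Suc n)
  have IH: "Im (z (Suc n) * cnj (z n)) = h n * christoffel n" using Suc by simp
  have "Im (z (Suc (Suc n)) * cnj (z (Suc n)))
      = (cmod (z (Suc n)))\<^sup>2 + \<beta> (Suc n) * Im (z (Suc n) * cnj (z n))"
    unfolding orth_at_i_Suc[of "Suc n"] cmod_power2
    by (simp add: algebra_simps power2_eq_square)
  also have "\<dots> = (cmod (z (Suc n)))\<^sup>2 + h (Suc n) * christoffel n"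
    using IH Suc.prems[of n] by (simp add: jacobi_off_def)
  also have "\<dots> = h (Suc n) * christoffel (Suc n)"
    using Suc.prems[of "Suc n"] by (simp add: christoffel_def field_simps)
  finally show ?case .
qed

text \<open>The factor theorem in the complexification: p(t) - p(i) is a multiple of t - i.\<close>

lemma orth_minus_value:
  "\<exists>q1 q2. P n - Re (z n) *\<^sub>R 1 = t * q1 + q2 \<and> - (Im (z n) *\<^sub>R 1) = t * q2 - q1"
proof (induction n rule: less_induct)
  case (less n)
  consider "n = 0" | k where "n = Suc k" by (cases n) auto
  then show ?case
  proof cases
    case 1
    then show ?thesis by (intro exI[of _ 0]) simp
  next
    case (2 k)
    obtain q1 q2 where q: "P k - Re (z k) *\<^sub>R 1 = t * q1 + q2" "- (Im (z k) *\<^sub>R 1) = t * q2 - q1"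
      using less.IH[of k] 2 by auto
    obtain r1 r2 where r: "P (k - 1) - Re (z (k - 1)) *\<^sub>R 1 = t * r1 + r2"
        "- (Im (z (k - 1)) *\<^sub>R 1) = t * r2 - r1"
    proof -
      have "k - 1 < n" using 2 by simp
      from less.IH[OF this] show ?thesis using that by blast
    qed
    have Pk: "P k = t * q1 + q2 + Re (z k) *\<^sub>R 1" "P (k - 1) = t * r1 + r2 + Re (z (k - 1)) *\<^sub>R 1"
      using q(1) r(1) by (simp_all add: algebra_simps)
    have Im: "q1 = t * q2 + Im (z k) *\<^sub>R 1" "r1 = t * r2 + Im (z (k - 1)) *\<^sub>R 1"
      using q(2) r(2) by (simp_all add: algebra_simps)
    show ?thesis
    proof (intro exI conjI)
      \<comment> \<open>Real and imaginary part of the quotient, which obeys the recurrence Q_(k+1)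
        = (t - \<open>\<alpha> k\<close>) Q_k + z_k - \<open>\<beta> k\<close> Q_(k-1).\<close>
      let ?Q1 = "t * q1 - \<alpha> k *\<^sub>R q1 + Re (z k) *\<^sub>R 1 - \<beta> k *\<^sub>R r1"
      let ?Q2 = "t * q2 - \<alpha> k *\<^sub>R q2 + Im (z k) *\<^sub>R 1 - \<beta> k *\<^sub>R r2"
      show "P n - Re (z n) *\<^sub>R 1 = t * ?Q1 + ?Q2"
        unfolding 2 orth_Suc orth_at_i_Suc Pk by (simp add: algebra_simps)
      show "- (Im (z n) *\<^sub>R 1) = t * ?Q2 - ?Q1"
        unfolding 2 orth_at_i_Suc Im by (simp add: algebra_simps)
    qed
  qed
qed

text \<open>The normalisation of \<open>c\<close> says that 1 - sum c_k cnj(z_k) P_k vanishes at i.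
  By the factor theorem it is a multiple of t - i; the two arguments of \<open>i_multiple\<close>
  are its real and imaginary part.\<close>

lemma i_multiple_combination:
  fixes c :: "nat \<Rightarrow> real"
  assumes "finite N" "(\<Sum>k\<in>N. c k * (cmod (z k))\<^sup>2) = 1"
  shows "i_multiple t (1 - (\<Sum>k\<in>N. (c k * Re (z k)) *\<^sub>R P k)) (\<Sum>k\<in>N. (c k * Im (z k)) *\<^sub>R P k)"
proof -
  obtain q1 q2 where q: "\<And>n. P n - Re (z n) *\<^sub>R 1 = t * q1 n + q2 n"
      "\<And>n. - (Im (z n) *\<^sub>R 1) = t * q2 n - q1 n"
    using orth_minus_value by metis
  have P: "P k = t * q1 k + q2 k + Re (z k) *\<^sub>R 1" for k
    using q(1)[of k] by (simp add: algebra_simps)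
  have q1: "q1 k = t * q2 k + Im (z k) *\<^sub>R 1" for k
    using q(2)[of k] by (simp add: algebra_simps)
  have one: "1 = (\<Sum>k\<in>N. (c k * (cmod (z k))\<^sup>2) *\<^sub>R (1::'a))"
    using assms(2) by (simp flip: scaleR_sum_left)
  let ?Q1 = "\<lambda>k. - (c k *\<^sub>R (Re (z k) *\<^sub>R q1 k + Im (z k) *\<^sub>R q2 k))"
  let ?Q2 = "\<lambda>k. - (c k *\<^sub>R (Re (z k) *\<^sub>R q2 k - Im (z k) *\<^sub>R q1 k))"
  show ?thesis unfolding i_multiple_def
  proof (intro exI conjI)
    have "1 - (\<Sum>k\<in>N. (c k * Re (z k)) *\<^sub>R P k)
        = (\<Sum>k\<in>N. (c k * (cmod (z k))\<^sup>2) *\<^sub>R 1 - (c k * Re (z k)) *\<^sub>R P k)"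
      by (simp add: sum_subtractf flip: one)
    also have "\<dots> = (\<Sum>k\<in>N. t * ?Q1 k + ?Q2 k)"
    proof (rule sum.cong[OF HOL.refl])
      fix k
      show "(c k * (cmod (z k))\<^sup>2) *\<^sub>R 1 - (c k * Re (z k)) *\<^sub>R P k = t * ?Q1 k + ?Q2 k"
        unfolding P q1 cmod_power2 by (simp add: algebra_simps power2_eq_square)
    qed
    finally show "1 - (\<Sum>k\<in>N. (c k * Re (z k)) *\<^sub>R P k) = t * (\<Sum>k\<in>N. ?Q1 k) + (\<Sum>k\<in>N. ?Q2 k)"
      by (simp only: sum.distrib sum_distrib_left)
    have "(\<Sum>k\<in>N. (c k * Im (z k)) *\<^sub>R P k) = (\<Sum>k\<in>N. t * ?Q2 k - ?Q1 k)"
    proof (rule sum.cong[OF HOL.refl])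
      fix k
      show "(c k * Im (z k)) *\<^sub>R P k = t * ?Q2 k - ?Q1 k"
        unfolding P q1 by (simp add: algebra_simps)
    qed
    then show "(\<Sum>k\<in>N. (c k * Im (z k)) *\<^sub>R P k) = t * (\<Sum>k\<in>N. ?Q2 k) - (\<Sum>k\<in>N. ?Q1 k)"
      by (simp only: sum_subtractf sum_distrib_left)
  qed
qed

lemma L_orth_combination:
  fixes c :: "nat \<Rightarrow> real"
  assumes "finite N" "\<And>j k. k \<in> N \<Longrightarrow> j < k \<Longrightarrow> h j \<noteq> 0"
  shows "L ((\<Sum>k\<in>N. c k *\<^sub>R P k)\<^sup>2) = (\<Sum>k\<in>N. (c k)\<^sup>2 * h k)"
proof -
  have "L ((\<Sum>k\<in>N. c k *\<^sub>R P k)\<^sup>2) = (\<Sum>k\<in>N. \<Sum>j\<in>N. c k * (c j * L (P k * P j)))"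
    by (simp add: power2_eq_square sum_product linear_sum[OF lin] L_simps ac_simps)
  also have "\<dots> = (\<Sum>k\<in>N. \<Sum>j\<in>N. if j = k then (c k)\<^sup>2 * h k else 0)"
  proof (intro sum.cong HOL.refl)
    fix k j assume kj: "k \<in> N" "j \<in> N"
    consider "j = k" | "j < k" | "k < j" by linarith
    then show "c k * (c j * L (P k * P j)) = (if j = k then (c k)\<^sup>2 * h k else 0)"
    proof cases
      case 1
      then show ?thesis by (simp add: orth_norm2_def power2_eq_square)
    next
      case 2
      then show ?thesis using orth_orthogonal[of k j] assms(2)[of k] kj by simp
    next
      case 3
      then show ?thesis using orth_orthogonal[of j k] assms(2)[of j] kj by (simp add: mult.commute)
    qed
  qed
  also have "\<dots> = (\<Sum>k\<in>N. (c k)\<^sup>2 * h k)" using assms(1) by simp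
  finally show ?thesis .
qed


text \<open>If some \<open>h n\<close> is 0, the first such \<open>P n\<close>, divided by its
  nonzero value at i, gives error 0. Otherwise the error 1 / \<open>christoffel N\<close> is
  reached. Were these kernels bounded, the sum of the roots of h_n / h_(n+1) would be finite by
  Christoffel-Darboux, and Carleman's inequality would make Carleman's series converge.\<close>

lemma i_approximation:
  assumes carl: "carleman_at L t"
    and "0 < \<epsilon>"
  shows "\<exists>a b. i_multiple t (1 - a) b \<and> L (a\<^sup>2) + L (b\<^sup>2) < \<epsilon>"
proof (cases "\<exists>n. h n = 0")
  case True
  define n where "n = (LEAST n. h n = 0)"
  have hn: "h n = 0" unfolding n_def using True by (rule LeastI_ex)
  have hj: "h j \<noteq> 0" if "j < n" for j using not_less_Least that unfolding n_def by blast
  \<comment> \<open>Orthogonal polynomials have no zero at i: Christoffel-Darboux makes an imaginary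
    part with factor \<open>z n\<close> strictly positive.\<close>
  have "z n \<noteq> 0"
  proof (cases n)
    case (Suc k)
    have "0 < christoffel k"
      unfolding christoffel_def
    proof (rule sum_pos2[of _ 0])
      show "0 < (cmod (z 0))\<^sup>2 / h 0" using hj[of 0] Suc orth_norm2_nonneg[of 0] by (simp add: less_le)
    qed (auto simp: orth_norm2_nonneg)
    moreover have "0 < h k" using hj[of k] Suc orth_norm2_nonneg[of k] by (simp add: less_le)
    ultimately have "0 < Im (z n * cnj (z k))"
      using christoffel_darboux[of k] hj Suc by simp
    then show ?thesis by (metis less_irrefl mult_zero_left zero_complex.sel(2))
  qed simp
  then have *: "(\<Sum>k\<in>{n}. 1 / (cmod (z n))\<^sup>2 * (cmod (z k))\<^sup>2) = 1" by simp
  have "L ((r *\<^sub>R P n)\<^sup>2) = 0" for r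
    using L_orth_combination[of "{n}" "\<lambda>_. r"] hj hn by simp
  then show ?thesis using i_multiple_combination[OF _ *] \<open>0 < \<epsilon>\<close>
    by (intro exI conjI) (assumption | simp)+
next
  case False
  then have nz: "h n \<noteq> 0" for n by auto
  then have pos: "0 < h n" for n using orth_norm2_nonneg[of n] by (simp add: less_le)
  define K where "K = christoffel"
  define e where "e n = cmod (z n) / sqrt (h n)" for n
  \<comment> \<open>The reciprocals of the off-diagonal entries of the symmetric Jacobi matrix;
    divergence of their sum is a classical criterion for determinacy.\<close>
  define r where "r n = sqrt (h n / h (Suc n))" for n
  have e2: "(e n)\<^sup>2 = (cmod (z n))\<^sup>2 / h n" for n
    using pos[of n] by (simp add: e_def power_divide)
  have K_eq: "K n = (\<Sum>k\<le>n. (e k)\<^sup>2)" for n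
    by (simp add: K_def christoffel_def e2)
  have K0: "1 / h 0 \<le> K n" for n
  proof -
    have "1 / h 0 = (e 0)\<^sup>2" by (simp add: e2)
    also have "\<dots> \<le> K n" unfolding K_eq by (rule member_le_sum) auto
    finally show ?thesis .
  qed
  have Kpos: "0 < K n" for n using K0[of n] pos[of 0] by (smt (verit) divide_pos_pos)
  \<comment> \<open>Christoffel-Darboux with the kernel bounded below by its term of index 0,
    followed by the inequality of the means.\<close>
  have r_le: "r n / h 0 \<le> ((e (Suc n))\<^sup>2 + (e n)\<^sup>2) / 2" for n
  proof -
    have "h n * (1 / h 0) \<le> h n * K n" using K0 pos[of n] by (intro mult_left_mono) auto
    also have "\<dots> = Im (z (Suc n) * cnj (z n))"
      unfolding K_def using christoffel_darboux[of n] nz by simp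
    also have "\<dots> \<le> cmod (z (Suc n) * cnj (z n))" by (rule abs_Im_le_cmod[THEN abs_le_D1])
    also have "\<dots> = cmod (z (Suc n)) * cmod (z n)" by (simp add: norm_mult)
    also have "\<dots> = e (Suc n) * e n * (sqrt (h (Suc n)) * sqrt (h n))"
      using pos[of n] pos[of "Suc n"] by (simp add: e_def)
    finally have "h n / h 0 / (sqrt (h (Suc n)) * sqrt (h n)) \<le> e (Suc n) * e n"
      by (subst pos_divide_le_eq) (use pos[of n] pos[of "Suc n"] in auto)
    moreover have "h n / h 0 / (sqrt (h (Suc n)) * sqrt (h n)) = r n / h 0"
    proof -
      have "h n = sqrt (h n) * sqrt (h n)" using pos[of n] by simp
      then have "h n / (sqrt (h (Suc n)) * sqrt (h n)) = r n"
        unfolding r_def real_sqrt_divide using pos[of n] pos[of "Suc n"]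
        by (metis nonzero_mult_divide_mult_cancel_right real_sqrt_eq_zero_cancel_iff nz)
      then show ?thesis by (simp add: divide_simps mult.commute)
    qed
    moreover have "e (Suc n) * e n \<le> ((e (Suc n))\<^sup>2 + (e n)\<^sup>2) / 2"
      using sum_squares_bound[of "e (Suc n)" "e n"] by simp
    ultimately show ?thesis by linarith
  qed
  have sum_r: "(\<Sum>n<N. r n) \<le> h 0 * K N" for N
  proof -
    have "(\<Sum>n<N. r n / h 0) \<le> (\<Sum>n<N. ((e (Suc n))\<^sup>2 + (e n)\<^sup>2) / 2)"
      by (intro sum_mono r_le)
    also have "\<dots> = K N - ((e 0)\<^sup>2 + (e N)\<^sup>2) / 2"
      unfolding K_eq by (induction N) (simp_all add: field_simps)
    also have "\<dots> \<le> K N" by simp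
    finally show ?thesis using pos[of 0] by (simp add: sum_divide_distrib[symmetric] field_simps)
  qed
  \<comment> \<open>The product of the first n + 1 numbers \<open>r j\<close> telescopes to sqrt(h_0
    / h_(n+1)). The constant \<open>min 1 (sqrt (h 0))\<close> bounds all roots of sqrt(h_0) from
    below, whether \<open>h 0\<close> is large or small.\<close>
  have term_le: "min 1 (sqrt (h 0)) * L (t ^ (2 * Suc n)) powr (- 1 / (2 * real (Suc n)))
      \<le> exp ((\<Sum>j<Suc n. ln (r j)) / Suc n)" for n
  proof -
    define m where "m = L (t ^ (2 * Suc n))"
    have hm: "h (Suc n) \<le> m" unfolding m_def using nz by (intro orth_norm2_le) auto
    have mpos: "0 < m" using hm pos[of "Suc n"] by linarith
    have lnr: "(\<Sum>j<k. ln (r j)) = (ln (h 0) - ln (h k)) / 2" for k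
    proof (induction k)
      case (Suc k)
      have "ln (r k) = (ln (h k) - ln (h (Suc k))) / 2"
        using pos[of k] pos[of "Suc k"] by (simp add: r_def ln_sqrt ln_div)
      then show ?case using Suc by (simp add: field_simps)
    qed simp
    have "ln (min 1 (sqrt (h 0))) \<le> ln (h 0) / 2 / Suc n"
    proof (cases "h 0 \<ge> 1")
      case True
      then show ?thesis by (simp add: min_def)
    next
      case False
      then have "ln (min 1 (sqrt (h 0))) = ln (h 0) / 2" using pos[of 0] by (simp add: min_def ln_sqrt)
      moreover have "ln (h 0) / 2 \<le> ln (h 0) / 2 / Suc n"
        using False pos[of 0] mult_nonneg_nonpos[of "real n" "ln (h 0)"] by (simp add: field_simps)
      ultimately show ?thesis by (simp only:)
    qed
    moreover have lnh: "ln (h (Suc n)) \<le> ln m" using hm pos[of "Suc n"] mpos by simp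
    have "ln (h 0) / 2 / Suc n - ln m / (2 * Suc n) \<le> (\<Sum>j<Suc n. ln (r j)) / Suc n"
    proof -
      have "(ln (h 0) - ln m) / 2 / Suc n \<le> (ln (h 0) - ln (h (Suc n))) / 2 / Suc n"
        using lnh by (intro divide_right_mono) auto
      then show ?thesis unfolding lnr by (simp add: diff_divide_distrib)
    qed
    ultimately have "ln (min 1 (sqrt (h 0))) - ln m / (2 * Suc n) \<le> (\<Sum>j<Suc n. ln (r j)) / Suc n"
      by linarith
    then have "exp (ln (min 1 (sqrt (h 0))) - ln m / (2 * Suc n)) \<le> exp ((\<Sum>j<Suc n. ln (r j)) / Suc n)"
      by (simp only: exp_le_cancel_iff)
    moreover have "exp (ln (min 1 (sqrt (h 0))) - ln m / (2 * Suc n)) = min 1 (sqrt (h 0)) * m powr (- 1 / (2 * real (Suc n)))"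
      using mpos pos[of 0] by (simp add: powr_def exp_diff exp_minus divide_inverse)
    ultimately show ?thesis by (simp only: m_def)
  qed
  have "\<exists>N. 1 / \<epsilon> < K N"
  proof (rule ccontr)
    assume "\<not> (\<exists>N. 1 / \<epsilon> < K N)"
    then have bound: "K N \<le> 1 / \<epsilon>" for N by (simp add: not_less)
    define d where "d = min 1 (sqrt (h 0))"
    have dpos: "0 < d" using pos[of 0] by (simp add: d_def)
    have m_nz: "L (t ^ (2 * Suc n)) \<noteq> 0" for n
      using orth_norm2_le[of "Suc n"] nz pos[of "Suc n"] by force
    have "summable (\<lambda>n. L (t ^ (2 * Suc n)) powr (- 1 / (2 * real (Suc n))))"
    proof (rule summableI_nonneg_bounded)
      fix N
      have "d * (\<Sum>n<N. L (t ^ (2 * Suc n)) powr (- 1 / (2 * real (Suc n))))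
          \<le> (\<Sum>n<N. exp ((\<Sum>j<Suc n. ln (r j)) / Suc n))"
        unfolding sum_distrib_left using term_le d_def by (intro sum_mono) auto
      also have "\<dots> \<le> exp 1 * (\<Sum>j<N. r j)"
        using pos by (intro carleman_inequality) (simp add: r_def)
      also have "\<dots> \<le> exp 1 * (h 0 * (1 / \<epsilon>))"
        using sum_r[of N] bound[of N] pos[of 0]
        by (intro mult_left_mono order_trans[OF sum_r]) auto
      finally show "(\<Sum>n<N. L (t ^ (2 * Suc n)) powr (- 1 / (2 * real (Suc n)))) \<le> exp 1 * (h 0 * (1 / \<epsilon>)) / d"
        by (simp only: pos_le_divide_eq[OF dpos] mult.commute)
    qed simp
    then show False using carl m_nz unfolding carleman_at_def by blast
  qed
  then obtain N where N: "1 / \<epsilon> < K N" by blast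
  \<comment> \<open>These coefficients give the kernel with one argument at i, scaled to the value 1
    at i.\<close>
  define c where "c k = 1 / (h k * K N)" for k
  have *: "(\<Sum>k\<in>{..N}. c k * (cmod (z k))\<^sup>2) = 1"
  proof -
    have "(\<Sum>k\<in>{..N}. c k * (cmod (z k))\<^sup>2) = (\<Sum>k\<in>{..N}. (e k)\<^sup>2 / K N)"
      by (simp add: c_def e2)
    also have "\<dots> = 1" using Kpos[of N] by (simp add: sum_divide_distrib[symmetric] flip: K_eq)
    finally show ?thesis .
  qed
  let ?a = "\<Sum>k\<in>{..N}. (c k * Re (z k)) *\<^sub>R P k"
  let ?b = "\<Sum>k\<in>{..N}. (c k * Im (z k)) *\<^sub>R P k"
  have "L (?a\<^sup>2) + L (?b\<^sup>2) = (\<Sum>k\<in>{..N}. (c k * Re (z k))\<^sup>2 * h k) + (\<Sum>k\<in>{..N}. (c k * Im (z k))\<^sup>2 * h k)"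
    by (subst (1 2) L_orth_combination) (auto simp: nz)
  also have "\<dots> = (\<Sum>k\<in>{..N}. c k * (cmod (z k))\<^sup>2 * (1 / K N))"
    unfolding sum.distrib[symmetric]
  proof (rule sum.cong[OF HOL.refl])
    fix k
    have "c k * h k = 1 / K N" using nz[of k] by (simp add: c_def)
    moreover have "(c k * Re (z k))\<^sup>2 * h k + (c k * Im (z k))\<^sup>2 * h k = c k * (cmod (z k))\<^sup>2 * (c k * h k)"
      unfolding cmod_power2 by (simp add: power2_eq_square algebra_simps)
    ultimately show "(c k * Re (z k))\<^sup>2 * h k + (c k * Im (z k))\<^sup>2 * h k = c k * (cmod (z k))\<^sup>2 * (1 / K N)"
      by (simp only:)
  qed
  also have "\<dots> = 1 / K N" using * by (simp only: sum_distrib_right[symmetric])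
  also have "\<dots> < \<epsilon>" using N Kpos[of N] \<open>0 < \<epsilon>\<close> by (simp add: field_simps)
  finally show ?thesis using i_multiple_combination[OF _ *] by blast
qed

end

end

section \<open>Approximate inverses under Carleman's condition\<close>

text \<open>Each even term after the first is bounded by the odd term before it. This recovers the
  full Carleman series from the half that a comparison of weighted moments reaches.\<close>

lemma summable_decreasing_odd:
  fixes f :: "nat \<Rightarrow> real"
  assumes nonneg: "\<And>n. 0 \<le> f n" and dec: "\<And>n. f (Suc n) \<le> f n"
    and "summable (\<lambda>n. f (2 * n + 1))"
  shows "summable f"
proof -
  define S where "S = (\<Sum>n. f (2 * n + 1))"
  have partial: "(\<Sum>n<2 * N + 1. f n) \<le> f 0 + 2 * (\<Sum>n<N. f (2 * n + 1))" for N
  proof (induction N)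
    case (Suc N)
    show ?case using Suc dec[of "2 * N + 1"] by simp
  qed simp
  have "(\<Sum>n<N. f n) \<le> f 0 + 2 * S" for N
  proof -
    have "(\<Sum>n<N. f n) \<le> (\<Sum>n<2 * N + 1. f n)" by (intro sum_mono2) (auto simp: nonneg)
    also have "\<dots> \<le> f 0 + 2 * (\<Sum>n<N. f (2 * n + 1))" by (rule partial)
    also have "\<dots> \<le> f 0 + 2 * S"
      unfolding S_def using assms(3) nonneg by (intro add_left_mono mult_left_mono sum_le_suminf) auto
    finally show ?thesis .
  qed
  then show ?thesis by (intro summableI_nonneg_bounded nonneg)
qed

context psd_functional
begin

lemma power_double: "(b ^ n)\<^sup>2 = b ^ (2 * n)" for b :: 'a
  by (simp add: power_mult[symmetric] mult.commute)

lemma even_moment_nonneg: "0 \<le> L (t ^ (2 * n))"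
  using psd[of "t ^ n"] by (simp add: power_double)

lemma moment_eq_0:
  assumes "L (t ^ (2 * n)) = 0"
  shows "L (t ^ (2 * n) * b) = 0"
proof -
  have "L (t ^ n * (t ^ n * b)) = 0" using assms by (intro L_mult_eq_0) (simp add: power_double)
  then show ?thesis by (simp add: mult.assoc[symmetric] power_add[symmetric] mult_2)
qed

text \<open>Lyapunov's inequality without a measure: by Cauchy-Schwarz the logarithms of the even
  moments are convex, and they start at ln 1 = 0, so their slopes from the origin increase.\<close>

lemma moment_root_antimono:
  assumes L1: "L 1 = 1" and pos: "\<And>n. 0 < L (t ^ (2 * n))" and n: "0 < n"
  shows "L (t ^ (2 * Suc n)) powr (- 1 / (2 * real (Suc n))) \<le> L (t ^ (2 * n)) powr (- 1 / (2 * real n))"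
proof -
  define x where "x n = ln (L (t ^ (2 * n)))" for n
  have logconvex: "2 * x (Suc n) \<le> x n + x (Suc (Suc n))" for n
  proof -
    have "(L (t ^ n * t ^ Suc (Suc n)))\<^sup>2 \<le> L (t ^ (2 * n)) * L (t ^ (2 * Suc (Suc n)))"
      using Cauchy_Schwarz[of "t ^ n" "t ^ Suc (Suc n)"] by (simp only: power_double)
    moreover have "t ^ n * t ^ Suc (Suc n) = t ^ (2 * Suc n)"
      by (simp add: power_add[symmetric] mult_2 del: power_Suc)
    ultimately have "(L (t ^ (2 * Suc n)))\<^sup>2 \<le> L (t ^ (2 * n)) * L (t ^ (2 * Suc (Suc n)))" by simp
    then have "ln ((L (t ^ (2 * Suc n)))\<^sup>2) \<le> ln (L (t ^ (2 * n)) * L (t ^ (2 * Suc (Suc n))))"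
      using pos[of n] pos[of "Suc n"] pos[of "Suc (Suc n)"] by (subst ln_le_cancel_iff) auto
    moreover have "ln ((L (t ^ (2 * Suc n)))\<^sup>2) = 2 * x (Suc n)"
      using pos[of "Suc n"] by (simp only: x_def ln_realpow)
    moreover have "ln (L (t ^ (2 * n)) * L (t ^ (2 * Suc (Suc n)))) = x n + x (Suc (Suc n))"
      using pos[of n] pos[of "Suc (Suc n)"] by (simp add: x_def ln_mult del: power_Suc mult_Suc_right)
    ultimately show ?thesis by simp
  qed
  have incr: "real (Suc n) * x n \<le> n * x (Suc n)" for n
  proof (induction n)
    case (Suc n)
    have "real (Suc n) * (2 * x (Suc n)) \<le> real (Suc n) * (x n + x (Suc (Suc n)))"
      by (intro mult_left_mono logconvex) simp
    then show ?case using Suc by (simp add: algebra_simps)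
  qed (simp add: x_def L1)
  have "- 1 / (2 * real (Suc n)) * x (Suc n) \<le> - 1 / (2 * real n) * x n"
    using incr[of n] n by (simp add: field_simps)
  then show ?thesis using pos[of n] pos[of "Suc n"] unfolding powr_def x_def by simp
qed

lemma psd_functional_weight:
  assumes "\<And>b. 0 \<le> L (b\<^sup>2 * w)"
  shows "psd_functional (\<lambda>f. L (f * w))"
proof (rule psd_functional.intro)
  show "linear (\<lambda>f. L (f * w))"
    by (rule linearI) (simp_all add: L_simps algebra_simps)
qed (rule assms)

text \<open>By Cauchy-Schwarz, L(t^(2n) w)^2 <= L(t^(4n)) L(w^2): up to a constant, every second
  term of the series of \<open>L\<close> is a lower bound for a term of the weighted series. A
  vanishing moment of \<open>L\<close> forces the weighted one to vanish too.\<close>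

lemma carleman_at_weight:
  assumes L1: "L 1 = 1" and carl: "carleman_at L t" and w: "\<And>b. 0 \<le> L (b\<^sup>2 * w)"
  shows "carleman_at (\<lambda>f. L (f * w)) t"
proof (cases "\<exists>n. L (t ^ (2 * Suc n)) = 0 \<or> L (t ^ (2 * Suc n) * w) = 0")
  case True
  then show ?thesis unfolding carleman_at_def using moment_eq_0 by blast
next
  case False
  then have pos: "0 < L (t ^ (2 * n))" for n
    using even_moment_nonneg[of t n] L1 by (cases n) (auto simp: less_le)
  have wpos: "0 < L (t ^ (2 * Suc n) * w)" for n
    using w[of "t ^ Suc n"] False by (metis less_le power_double)
  define g where "g n = L (t ^ (2 * Suc n)) powr (- 1 / (2 * real (Suc n)))" for n
  \<comment> \<open>With \<open>C\<close> at least 1, its roots are at most \<open>C\<close>, so one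
    constant serves all n.\<close>
  define C where "C = max 1 (L (w\<^sup>2))"
  have C: "1 \<le> C" "L (w\<^sup>2) \<le> C" by (auto simp: C_def)
  \<comment> \<open>Index 2n + 1 belongs to the power 4(n + 1), the square of the power in the
    weighted moment of index n.\<close>
  have bound: "g (2 * n + 1) \<le> C * L (t ^ (2 * Suc n) * w) powr (- 1 / (2 * real (Suc n)))" for n
  proof -
    define m where "m = L (t ^ (2 * Suc (2 * n + 1)))"
    define v where "v = L (t ^ (2 * Suc n) * w)"
    have mp: "0 < m" "0 < v" using pos wpos by (simp_all only: m_def v_def)
    have "v\<^sup>2 \<le> L ((t ^ (2 * Suc n))\<^sup>2) * L (w\<^sup>2)" unfolding v_def by (rule Cauchy_Schwarz)
    also have "L ((t ^ (2 * Suc n))\<^sup>2) = m" by (simp only: power_double m_def) simp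
    also have "m * L (w\<^sup>2) \<le> m * C" using mp C by (intro mult_left_mono) auto
    finally have "ln (v\<^sup>2) \<le> ln (m * C)" using mp C by (subst ln_le_cancel_iff) auto
    then have "2 * ln v \<le> ln m + ln C" using mp C by (simp add: ln_mult ln_realpow)
    moreover have "ln C \<le> 4 * real (Suc n) * ln C" using mult_right_mono[of 1 "4 * real (Suc n)" "ln C"] ln_ge_zero[OF C(1)]
      by simp
    ultimately have "2 * ln v \<le> ln m + 4 * real (Suc n) * ln C" by linarith
    moreover define N where "N = real (Suc n)"
    ultimately have "2 * ln v / (4 * N) \<le> (ln m + 4 * N * ln C) / (4 * N)"
      by (intro divide_right_mono) auto
    moreover have "0 < N" "2 * real (Suc (2 * n + 1)) = 4 * N" by (simp_all add: N_def)
    ultimately have "- 1 / (2 * real (Suc (2 * n + 1))) * ln m \<le> ln C + - 1 / (2 * real (Suc n)) * ln v"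
      unfolding N_def[symmetric] by (simp add: field_simps)
    then have "exp (- 1 / (2 * real (Suc (2 * n + 1))) * ln m) \<le> exp (ln C + - 1 / (2 * real (Suc n)) * ln v)"
      by (simp only: exp_le_cancel_iff)
    then have "m powr (- 1 / (2 * real (Suc (2 * n + 1)))) \<le> C * v powr (- 1 / (2 * real (Suc n)))"
      using mp C unfolding powr_def exp_add by simp
    then show ?thesis by (simp only: g_def m_def v_def)
  qed
  have "\<not> summable (\<lambda>n. L (t ^ (2 * Suc n) * w) powr (- 1 / (2 * real (Suc n))))"
  proof
    assume "summable (\<lambda>n. L (t ^ (2 * Suc n) * w) powr (- 1 / (2 * real (Suc n))))"
    then have "summable (\<lambda>n. C * L (t ^ (2 * Suc n) * w) powr (- 1 / (2 * real (Suc n))))"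
      by (rule summable_mult)
    then have "summable (\<lambda>n. g (2 * n + 1))"
      by (rule summable_comparison_test') (use bound in \<open>auto simp: g_def\<close>)
    moreover have "g (Suc n) \<le> g n" for n
      unfolding g_def using moment_root_antimono[OF L1 pos zero_less_Suc] .
    moreover have "0 \<le> g n" for n by (simp add: g_def)
    ultimately have "summable g" using summable_decreasing_odd[of g] by blast
    then show False using carl False unfolding carleman_at_def g_def by blast
  qed
  then show ?thesis unfolding carleman_at_def by blast
qed

text \<open>
  Approximate division by \<open>t - \<i>\<close> and, for the correspondingly changed weight, by \<open>t + \<i>\<close> yields
  approximate division by \<open>1 + t\<^sup>2\<close>.
\<close>

lemma inverse_approximation:
  assumes L1: "L 1 = 1" and carl: "carleman_at L t" and w: "\<And>b. 0 \<le> L (b\<^sup>2 * w)" and "0 < \<epsilon>"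
  shows "\<exists>q. L ((1 - (1 + t\<^sup>2) * q)\<^sup>2 * w) < \<epsilon>"
proof -
  interpret w: psd_functional "\<lambda>f. L (f * w)" using w by (rule psd_functional_weight)
  obtain a b q1 q2 where q: "1 - a = t * q1 + q2" "b = t * q2 - q1"
    and ab: "L (a\<^sup>2 * w) + L (b\<^sup>2 * w) < \<epsilon> / 4"
    using w.i_approximation[OF carleman_at_weight[OF L1 carl w], of "\<epsilon> / 4"] \<open>0 < \<epsilon>\<close>
    unfolding i_multiple_def by auto
  \<comment> \<open>The weight times the squared modulus of (1 - a) + i b: the error of the second
    approximation gets multiplied by this first factor.\<close>
  define w' where "w' = ((1 - a)\<^sup>2 + b\<^sup>2) * w"
  have w': "0 \<le> L (c\<^sup>2 * w')" for c
  proof -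
    have "c\<^sup>2 * w' = (c * (1 - a))\<^sup>2 * w + (c * b)\<^sup>2 * w"
      by (simp only: w'_def power_mult_distrib distrib_left distrib_right mult.assoc)
    then show ?thesis using w[of "c * (1 - a)"] w[of "c * b"] by (simp add: L_simps)
  qed
  interpret w': psd_functional "\<lambda>f. L (f * w')" using w' by (rule psd_functional_weight)
  obtain a' b' r1 r2 where r: "1 - a' = t * r1 + r2" "b' = t * r2 - r1"
    and ab': "L (a'\<^sup>2 * w') + L (b'\<^sup>2 * w') < \<epsilon> / 4"
    using w'.i_approximation[OF carleman_at_weight[OF L1 carl w'], of "\<epsilon> / 4"] \<open>0 < \<epsilon>\<close>
    unfolding i_multiple_def by auto
  \<comment> \<open>The real part of (q1 + i q2)(r1 - i r2). Conjugating the second relation turns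
    its factor t - i into t + i.\<close>
  define q where "q = q1 * r1 + q2 * r2"
  define e where "e = 1 - (1 + t\<^sup>2) * q"
  have "(1 + t\<^sup>2) * q = (1 - a) * (1 - a') + b * b'"
    unfolding q_def q r by (simp add: algebra_simps power2_eq_square)
  then have e: "e = a + ((1 - a) * a' - b * b')" by (simp add: e_def algebra_simps)
  \<comment> \<open>Put x + i y = ((1 - a) + i b)(a' + i b'), so that e = a + x. The identity is 2
    a^2 + 2 (x^2 + y^2) - (a + x)^2 = (a - x)^2 + 2 y^2.\<close>
  have "2 *\<^sub>R (a\<^sup>2 * w) + 2 *\<^sub>R (a'\<^sup>2 * w') + 2 *\<^sub>R (b'\<^sup>2 * w') - e\<^sup>2 * w
    = (a - ((1 - a) * a' - b * b'))\<^sup>2 * w + 2 *\<^sub>R (((1 - a) * b' + b * a')\<^sup>2 * w)"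
    unfolding e w'_def by (simp add: algebra_simps power2_eq_square scaleR_2)
  from arg_cong[OF this, of L]
  have "2 * L (a\<^sup>2 * w) + 2 * L (a'\<^sup>2 * w') + 2 * L (b'\<^sup>2 * w') - L (e\<^sup>2 * w)
    = L ((a - ((1 - a) * a' - b * b'))\<^sup>2 * w) + 2 * L (((1 - a) * b' + b * a')\<^sup>2 * w)"
    by (simp only: L_simps real_scaleR_def)
  then have "L (e\<^sup>2 * w) < \<epsilon>"
    using ab ab' w[of b] w[of "a - ((1 - a) * a' - b * b')"] w[of "(1 - a) * b' + b * a'"] by linarith
  then show ?thesis unfolding e_def by blast
qed

text \<open>With (1 + t^2) q close to 1, the element x = a b^2 is close to ((1 + t^2) q)^2 x, which
  is (1 + t^2) a times the sum of squares (q b)^2 + (t q b)^2 and hence has a nonnegative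
  value.\<close>

lemma positive_division:
  assumes L1: "L 1 = 1" and carl: "carleman_at L t"
    and pos: "\<And>b. 0 \<le> L ((1 + t\<^sup>2) * a * b\<^sup>2)"
  shows "0 \<le> L (a * b\<^sup>2)"
proof (rule field_le_epsilon)
  fix \<eta> :: real assume "0 < \<eta>"
  define x where "x = a * b\<^sup>2"
  define M where "M = L (x\<^sup>2)"
  have M: "0 \<le> M" unfolding M_def by (rule psd)
  define \<delta> where "\<delta> = min 1 (\<eta> / (2 + M))"
  have \<delta>: "0 < \<delta>" "\<delta> \<le> 1" "\<delta> * (2 + M) \<le> \<eta>"
    using M \<open>0 < \<eta>\<close> by (simp_all add: \<delta>_def flip: pos_le_divide_eq)
  \<comment> \<open>The weight 1 + x^2 controls L(e^2) and L((e x)^2) simultaneously.\<close>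
  have "0 \<le> L (c\<^sup>2 * (1 + x\<^sup>2))" for c
  proof -
    have "c\<^sup>2 * (1 + x\<^sup>2) = c\<^sup>2 + (c * x)\<^sup>2" by (simp add: algebra_simps power_mult_distrib)
    then show ?thesis using psd[of c] psd[of "c * x"] by (simp add: L_simps)
  qed
  from inverse_approximation[OF L1 carl this, of "\<delta>\<^sup>2"] \<delta>
  obtain q where q: "L ((1 - (1 + t\<^sup>2) * q)\<^sup>2 * (1 + x\<^sup>2)) < \<delta>\<^sup>2" by auto
  define e where "e = 1 - (1 + t\<^sup>2) * q"
  have ex: "L (e\<^sup>2) + L ((e * x)\<^sup>2) < \<delta>\<^sup>2"
    using q unfolding e_def[symmetric] by (simp add: distrib_left power_mult_distrib L_simps)
  have x_split: "x = (1 + t\<^sup>2) * a * (q * b)\<^sup>2 + (1 + t\<^sup>2) * a * (t * q * b)\<^sup>2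
      + 2 *\<^sub>R (e * x) - e\<^sup>2 * x"
  proof -
    have "x = (1 - e)\<^sup>2 * x + 2 *\<^sub>R (e * x) - e\<^sup>2 * x"
      by (simp add: algebra_simps power2_eq_square scaleR_2)
    moreover have "(1 - e)\<^sup>2 * x = (1 + t\<^sup>2) * a * (q * b)\<^sup>2 + (1 + t\<^sup>2) * a * (t * q * b)\<^sup>2"
      by (simp add: e_def x_def algebra_simps power2_eq_square)
    ultimately show ?thesis by simp
  qed
  have "L (e\<^sup>2 * x) \<le> \<delta>\<^sup>2 / 2"
  proof -
    have "e\<^sup>2 + (e * x)\<^sup>2 - 2 *\<^sub>R (e\<^sup>2 * x) = (e - e * x)\<^sup>2"
      by (simp add: algebra_simps power2_eq_square scaleR_2)
    then have "0 \<le> L (e\<^sup>2 + (e * x)\<^sup>2 - 2 *\<^sub>R (e\<^sup>2 * x))" using psd by simp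
    then show ?thesis using ex by (simp add: L_simps)
  qed
  \<comment> \<open>The inequality of the means with weights 1 / \<open>\<delta>\<close> and
    \<open>\<delta>\<close>; the large weight is affordable since L(e^2) is below
    \<open>\<delta>\<^sup>2\<close>.\<close>
  moreover have "- \<delta> - \<delta> * M \<le> 2 * L (e * x)"
  proof -
    have "(1 / \<delta>) *\<^sub>R e\<^sup>2 + \<delta> *\<^sub>R x\<^sup>2 + 2 *\<^sub>R (e * x) = (1 / \<delta>) *\<^sub>R (e + \<delta> *\<^sub>R x)\<^sup>2"
      using \<delta> by (simp add: algebra_simps power2_eq_square scaleR_2)
    then have "0 \<le> L ((1 / \<delta>) *\<^sub>R e\<^sup>2 + \<delta> *\<^sub>R x\<^sup>2 + 2 *\<^sub>R (e * x))"
      using psd[of "e + \<delta> *\<^sub>R x"] \<delta> by (simp add: L_simps)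
    then have "0 \<le> L (e\<^sup>2) / \<delta> + \<delta> * M + 2 * L (e * x)" by (simp add: L_simps M_def)
    moreover have "L (e\<^sup>2) / \<delta> \<le> \<delta>"
      using ex psd[of "e * x"] \<delta> by (simp add: field_simps power2_eq_square)
    ultimately show ?thesis by linarith
  qed
  moreover have "L x = L ((1 + t\<^sup>2) * a * (q * b)\<^sup>2) + L ((1 + t\<^sup>2) * a * (t * q * b)\<^sup>2)
      + 2 * L (e * x) - L (e\<^sup>2 * x)"
    by (subst x_split) (simp add: L_simps)
  ultimately have "- \<delta> - \<delta> * M - \<delta>\<^sup>2 / 2 \<le> L x" using pos[of "q * b"] pos[of "t * q * b"] by linarith
  moreover have "\<delta>\<^sup>2 \<le> \<delta>" using \<delta> by (simp add: power2_eq_square mult_left_le)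
  ultimately have "0 \<le> L x + \<delta> * (2 + M)" using \<delta> by (simp add: algebra_simps)
  then show "0 \<le> L (a * b\<^sup>2) + \<eta>" using \<delta>(3) by (simp add: x_def)
qed

end

section \<open>Positive extension to fractions\<close>

text \<open>
  \<open>P\<close> plays the role of the nonnegative elements.  A pair \<open>(a, m)\<close> below stands for the
  fraction \<open>a / den m\<close>; functionals on fractions are functions of two arguments.
\<close>

locale positive_cone =
  fixes L :: "'a::{comm_ring_1,real_algebra_1} \<Rightarrow> real" and P :: "'a set" and g :: "'i \<Rightarrow> 'a"
  assumes lin: "linear L" and L_one: "L 1 = 1" and L_nonneg: "a \<in> P \<Longrightarrow> 0 \<le> L a"
    and one_P: "1 \<in> P" and add_P: "a \<in> P \<Longrightarrow> b \<in> P \<Longrightarrow> a + b \<in> P"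
    and square_P: "a \<in> P \<Longrightarrow> a * b\<^sup>2 \<in> P"
    and divide_P: "(1 + (g i)\<^sup>2) * a \<in> P \<Longrightarrow> a \<in> P"
begin

lemmas L_simps = linear_add[OF lin] linear_diff[OF lin] linear_scale[OF lin] linear_0[OF lin]
  linear_neg[OF lin]

definition den :: "'i multiset \<Rightarrow> 'a" where
  "den m = (\<Prod>i\<in>#m. 1 + (g i)\<^sup>2)"

lemma den_simps [simp]: "den {#} = 1" "den (add_mset i m) = (1 + (g i)\<^sup>2) * den m"
  "den (m + n) = den m * den n"
  by (simp_all add: den_def)

lemma scale_P: "a \<in> P \<Longrightarrow> 0 \<le> r \<Longrightarrow> r *\<^sub>R a \<in> P"
  using square_P[of a "sqrt r *\<^sub>R 1"] by (simp add: power2_eq_square)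

lemma zero_P: "0 \<in> P"
  using scale_P[OF one_P, of 0] by simp

lemma den_mult_P: "a \<in> P \<Longrightarrow> den m * a \<in> P"
proof (induction m)
  case (add i m)
  then have "den m * a + den m * a * (g i)\<^sup>2 \<in> P" by (intro add_P square_P)
  then show ?case by (simp add: algebra_simps)
qed simp

lemma den_divide_P: "den m * a \<in> P \<Longrightarrow> a \<in> P"
  by (induction m) (auto simp: mult.assoc dest: divide_P)

lemma den_diff_one_P: "a \<in> P \<Longrightarrow> (den m - 1) * a \<in> P"
proof (induction m)
  case (add i m)
  then have "(den m - 1) * a + den m * a * (g i)\<^sup>2 \<in> P" by (intro add_P square_P den_mult_P)
  then show ?case by (simp add: algebra_simps)
qed (simp add: zero_P)

text \<open>Since (a^2 + 1) / 2 - a is half a square, \<open>c\<close> lies above \<open>a\<close>,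
  and multiplying the positive \<open>c\<close> by \<open>den m\<close> only increases it. Thus
  every fraction lies below an element of the algebra and \<open>majorant\<close> is an infimum over
  a nonempty set.\<close>

lemma den_dominates: "\<exists>c. den m * c - a \<in> P"
proof
  define c where "c = (1 / 2) *\<^sub>R (a\<^sup>2 + 1)"
  have "c \<in> P" unfolding c_def using square_P[OF one_P, of a] one_P by (intro scale_P add_P) auto
  then have "(den m - 1) * c \<in> P" by (rule den_diff_one_P)
  moreover have "(1 / 2) *\<^sub>R (1 * (a - 1)\<^sup>2) \<in> P" by (intro scale_P square_P one_P) simp
  ultimately have "(den m - 1) * c + (1 / 2) *\<^sub>R (1 * (a - 1)\<^sup>2) \<in> P" by (rule add_P)
  moreover have "(den m - 1) * c + (1 / 2) *\<^sub>R (1 * (a - 1)\<^sup>2) = den m * c - a"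
  proof -
    have "(a - 1)\<^sup>2 = a\<^sup>2 + 1 - 2 *\<^sub>R a" by (simp add: power2_eq_square algebra_simps scaleR_2)
    then have "(1 / 2) *\<^sub>R (a - 1)\<^sup>2 = c - a" by (simp only: c_def scaleR_diff_right) simp
    then show ?thesis by (simp add: algebra_simps)
  qed
  ultimately show "den m * c - a \<in> P" by simp
qed

text \<open>The upper bound for the value of a positive extension at a / den m:
  \<open>den m * c - a \<in> P\<close> says that \<open>c\<close> lies above this fraction.\<close>

definition majorant :: "'a \<Rightarrow> 'i multiset \<Rightarrow> real" where
  "majorant a m = Inf (L ` {c. den m * c - a \<in> P})"

text \<open>Subadditivity is stated for common denominators; the third clause, invariance under
  expanding a fraction, makes this sufficient and makes \<open>q\<close> a function of the
  fraction.\<close>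

definition sublinear :: "('a \<Rightarrow> 'i multiset \<Rightarrow> real) \<Rightarrow> bool" where
  "sublinear q \<longleftrightarrow> (\<forall>a b m. q (a + b) m \<le> q a m + q b m) \<and>
     (\<forall>r a m. 0 \<le> r \<longrightarrow> q (r *\<^sub>R a) m = r * q a m) \<and>
     (\<forall>a m n. q (den n * a) (m + n) = q a m)"

lemma sublinearD:
  assumes "sublinear q"
  shows "q (a + b) m \<le> q a m + q b m" "0 \<le> r \<Longrightarrow> q (r *\<^sub>R a) m = r * q a m"
    "q (den n * a) (m + n) = q a m" "q (den m * b) (m + n) = q b n" "q 0 m = 0"
    "- q (- a) m \<le> q a m"
proof -
  show "q (a + b) m \<le> q a m + q b m" "0 \<le> r \<Longrightarrow> q (r *\<^sub>R a) m = r * q a m"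
    "q (den n * a) (m + n) = q a m"
    using assms by (auto simp: sublinear_def)
  show "q (den m * b) (m + n) = q b n" using assms by (metis add.commute sublinear_def)
  have "q (0 *\<^sub>R 0) m = 0 * q 0 m" using assms unfolding sublinear_def by blast
  then show 0: "q 0 m = 0" by simp
  have "q (a + (- a)) m \<le> q a m + q (- a) m" using assms unfolding sublinear_def by blast
  then show "- q (- a) m \<le> q a m" using 0 by simp
qed

text \<open>Homogeneity follows from the inequality, applied to \<open>r\<close> and to \<open>1 / r\<close>.\<close>

lemma sublinearI:
  assumes "\<And>a b m. q (a + b) m \<le> q a m + q b m" "\<And>m. q 0 m = 0"
    "\<And>r a m. 0 < r \<Longrightarrow> q (r *\<^sub>R a) m \<le> r * q a m"
    "\<And>a m n. q (den n * a) (m + n) = q a m"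
  shows "sublinear q"
proof -
  have "q (r *\<^sub>R a) m = r * q a m" if "0 \<le> r" for r a m
  proof (cases "r = 0")
    case False
    then have "0 < r" using that by simp
    then have "q ((1 / r) *\<^sub>R r *\<^sub>R a) m \<le> 1 / r * q (r *\<^sub>R a) m" by (intro assms(3)) simp
    then have "r * q a m \<le> q (r *\<^sub>R a) m" using \<open>0 < r\<close> by (simp add: field_simps)
    then show ?thesis using assms(3)[OF \<open>0 < r\<close>] by (intro antisym)
  qed (simp add: assms(2))
  then show ?thesis unfolding sublinear_def using assms by blast
qed

lemma bdd_below_majorant: "bdd_below (L ` {c. den m * c - a \<in> P})"
proof -
  obtain c0 where c0: "den m * c0 - (- a) \<in> P" using den_dominates by blast
  have "- L c0 \<le> L c" if "den m * c - a \<in> P" for c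
  proof -
    have "den m * (c + c0) \<in> P" using add_P[OF that c0] by (simp add: algebra_simps)
    then have "0 \<le> L (c + c0)" by (rule L_nonneg[OF den_divide_P])
    then show ?thesis by (simp add: L_simps)
  qed
  then show ?thesis by (intro bdd_belowI2[of _ "- L c0"]) simp
qed

lemma majorant_le: "den m * c - a \<in> P \<Longrightarrow> majorant a m \<le> L c"
  unfolding majorant_def by (intro cInf_lower bdd_below_majorant) auto

lemma majorant_greatest: "(\<And>c. den m * c - a \<in> P \<Longrightarrow> x \<le> L c) \<Longrightarrow> x \<le> majorant a m"
  unfolding majorant_def using den_dominates[of m a] by (intro cInf_greatest) auto

lemma sublinear_majorant: "sublinear majorant"
proof (rule sublinearI)
  fix a b m
  show "majorant (a + b) m \<le> majorant a m + majorant b m"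
  proof -
    have *: "majorant (a + b) m - L c \<le> L d" if "den m * c - a \<in> P" "den m * d - b \<in> P" for c d
    proof -
      have "den m * (c + d) - (a + b) \<in> P" using add_P[OF that] by (simp add: algebra_simps)
      then show ?thesis using majorant_le by (fastforce simp: L_simps)
    qed
    have "majorant (a + b) m - majorant b m \<le> L c" if "den m * c - a \<in> P" for c
      using majorant_greatest[of m b "majorant (a + b) m - L c"] *[OF that] by fastforce
    then show ?thesis using majorant_greatest[of m a "majorant (a + b) m - majorant b m"] by fastforce
  qed
next
  fix m
  have "majorant 0 m \<le> 0" using majorant_le[of m 0 0] by (simp add: zero_P L_simps)
  moreover have "0 \<le> majorant 0 m"
    by (rule majorant_greatest) (use den_divide_P L_nonneg in auto)
  ultimately show "majorant 0 m = 0" by simp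
next
  fix r :: real and a m assume "0 < r"
  have "majorant (r *\<^sub>R a) m / r \<le> L c" if "den m * c - a \<in> P" for c
  proof -
    have "den m * (r *\<^sub>R c) - r *\<^sub>R a \<in> P" using scale_P[OF that, of r] \<open>0 < r\<close> by (simp add: algebra_simps)
    then have "majorant (r *\<^sub>R a) m \<le> L (r *\<^sub>R c)" by (rule majorant_le)
    then show ?thesis using \<open>0 < r\<close> by (simp add: L_simps field_simps)
  qed
  then have "majorant (r *\<^sub>R a) m / r \<le> majorant a m" by (rule majorant_greatest)
  then show "majorant (r *\<^sub>R a) m \<le> r * majorant a m" using \<open>0 < r\<close> by (simp add: field_simps)
next
  fix a m n
  have "den (m + n) * c - den n * a \<in> P \<longleftrightarrow> den m * c - a \<in> P" for c
    using den_mult_P[of "den m * c - a" n] den_divide_P[of n "den m * c - a"]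
    by (auto simp: algebra_simps)
  then show "majorant (den n * a) (m + n) = majorant a m" unfolding majorant_def by simp
qed

text \<open>The infimum of a family of sublinear functionals is in general not subadditive. In a
  chain, two members have a common lower bound in the family, and its subadditivity
  suffices.\<close>

lemma sublinear_Inf_chain:
  assumes ne: "C \<noteq> {}" and sub: "\<And>q. q \<in> C \<Longrightarrow> sublinear q \<and> q \<le> majorant"
    and chain: "\<And>q q'. q \<in> C \<Longrightarrow> q' \<in> C \<Longrightarrow> q \<le> q' \<or> q' \<le> q"
  shows "\<exists>u. sublinear u \<and> u \<le> majorant \<and> (\<forall>q\<in>C. u \<le> q)"
proof -
  define u where "u a m = (INF q\<in>C. q a m)" for a m
  have bdd: "bdd_below ((\<lambda>q. q a m) ` C)" for a m
  proof (rule bdd_belowI2)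
    fix q assume q: "q \<in> C"
    have "q (- a) m \<le> majorant (- a) m" using sub[OF q] by (simp add: le_fun_def)
    then show "- majorant (- a) m \<le> q a m" using sublinearD(6)[of q a m] sub[OF q] by linarith
  qed
  have u_le: "u a m \<le> q a m" if "q \<in> C" for q a m
    unfolding u_def using bdd that by (rule cINF_lower)
  have u_ge: "x \<le> u a m" if "\<And>q. q \<in> C \<Longrightarrow> x \<le> q a m" for x a m
    unfolding u_def using ne that by (rule cINF_greatest)
  have "sublinear u"
  proof (rule sublinearI)
    fix a b m
    have *: "u (a + b) m \<le> q a m + q' b m" if q: "q \<in> C" "q' \<in> C" for q q'
    proof -
      obtain r where r: "r \<in> C" "r \<le> q" "r \<le> q'" using chain[OF q] q by blast
      have "u (a + b) m \<le> r (a + b) m" by (rule u_le[OF r(1)])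
      also have "\<dots> \<le> r a m + r b m" using sub[OF r(1)] sublinearD(1) by blast
      also have "\<dots> \<le> q a m + q' b m" using r by (intro add_mono) (auto simp: le_fun_def)
      finally show ?thesis .
    qed
    have "u (a + b) m - u b m \<le> q a m" if "q \<in> C" for q
    proof -
      have "u (a + b) m - q a m \<le> u b m" using *[OF that] by (intro u_ge) (simp add: algebra_simps)
      then show ?thesis by simp
    qed
    then have "u (a + b) m - u b m \<le> u a m" by (rule u_ge)
    then show "u (a + b) m \<le> u a m + u b m" by simp
  next
    fix m
    obtain q where "q \<in> C" using ne by blast
    then have "u 0 m \<le> 0" using u_le[of q 0 m] sublinearD(5)[of q m] sub by auto
    moreover have "0 \<le> u 0 m" using sub sublinearD(5) by (intro u_ge) (metis order_refl)
    ultimately show "u 0 m = 0" by simp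
  next
    fix r :: real and a m assume "0 < r"
    have "u (r *\<^sub>R a) m / r \<le> q a m" if "q \<in> C" for q
      using u_le[OF that, of "r *\<^sub>R a" m] sublinearD(2)[of q r a m] sub[OF that] \<open>0 < r\<close>
      by (simp add: field_simps)
    then have "u (r *\<^sub>R a) m / r \<le> u a m" by (rule u_ge)
    then show "u (r *\<^sub>R a) m \<le> r * u a m" using \<open>0 < r\<close> by (simp add: field_simps)
  next
    fix a m n
    show "u (den n * a) (m + n) = u a m"
      unfolding u_def using sub sublinearD(3) by (intro INF_cong) auto
  qed
  moreover have "u \<le> majorant"
  proof -
    obtain q where q: "q \<in> C" using ne by blast
    have "u \<le> q" using u_le[OF q] by (simp add: le_fun_def)
    then show ?thesis using sub[OF q] by (blast intro: order_trans)
  qed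
  moreover have "\<forall>q\<in>C. u \<le> q" using u_le by (auto simp: le_fun_def)
  ultimately show ?thesis by (intro exI[of _ u] conjI)
qed

lemma minimal_sublinear:
  obtains q where "sublinear q" "q \<le> majorant" "\<And>q'. sublinear q' \<Longrightarrow> q' \<le> q \<Longrightarrow> q' = q"
proof -
  define Q where "Q = {q. sublinear q \<and> q \<le> majorant}"
  \<comment> \<open>The order is reversed, so that Zorn's maximal element is a minimal
    functional.\<close>
  let ?le = "\<lambda>q q' :: 'a \<Rightarrow> 'i multiset \<Rightarrow> real. q' \<le> q"
  have "\<exists>m\<in>Q. \<forall>a\<in>Q. ?le m a \<longrightarrow> a = m"
  proof (rule predicate_Zorn)
    show "partial_order_on Q (relation_of ?le Q)"
      by (rule partial_order_on_relation_ofI) auto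
    fix C assume C: "C \<in> Chains (relation_of ?le Q)"
    show "\<exists>u\<in>Q. \<forall>a\<in>C. ?le a u"
    proof (cases "C = {}")
      case True
      then show ?thesis using sublinear_majorant by (auto simp: Q_def)
    next
      case False
      have "q \<in> Q" if "q \<in> C" for q using C that by (auto simp: Chains_def relation_of_def)
      moreover have "q \<le> q' \<or> q' \<le> q" if "q \<in> C" "q' \<in> C" for q q'
        using C that by (auto simp: Chains_def relation_of_def)
      ultimately obtain u where "sublinear u" "u \<le> majorant" "\<forall>q\<in>C. u \<le> q"
        using sublinear_Inf_chain[OF False] unfolding Q_def by blast
      then show ?thesis by (auto simp: Q_def)
    qed
  qed
  then obtain q where q: "q \<in> Q" "\<forall>a\<in>Q. a \<le> q \<longrightarrow> a = q" by blast
  show thesis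
  proof (rule that)
    fix q' assume "sublinear q'" "q' \<le> q"
    moreover have "q \<le> majorant" using q(1) by (simp add: Q_def)
    ultimately show "q' = q" using q(2) by (auto simp: Q_def dest: order_trans)
  qed (use q in \<open>auto simp: Q_def\<close>)
qed

text \<open>
  For every \<open>y\<close>, the functional \<open>x \<mapsto> inf\<^sub>r (q (x + r y) - r q y)\<close>, where \<open>r \<ge> 0\<close>, is sublinear and at
  most \<open>q\<close>, hence equal to \<open>q\<close>; the case \<open>r = 1\<close> is superadditivity.
\<close>

lemma minimal_sublinear_additive:
  assumes q: "sublinear q" and min: "\<And>q'. sublinear q' \<Longrightarrow> q' \<le> q \<Longrightarrow> q' = q"
  shows "q (a + b) n = q a n + q b n"
proof -
  \<comment> \<open>The vector a / den m + r (b / den n), written over the common denominator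
    \<open>den (m + n)\<close>.\<close>
  let ?f = "\<lambda>a m r. q (den n * a + r *\<^sub>R (den m * b)) (m + n) - r * q b n"
  define q' where "q' a m = (INF r\<in>{0..}. ?f a m r)" for a m
  note qD = sublinearD[OF q]
  have f_ge: "- q (- a) m \<le> ?f a m r" if "0 \<le> r" for a m r
  proof -
    have "r * q b n = q (r *\<^sub>R (den m * b)) (m + n)" using qD(2)[OF that] qD(4) by simp
    also have "\<dots> \<le> q (den n * a + r *\<^sub>R (den m * b)) (m + n) + q (den n * (- a)) (m + n)"
      using qD(1)[of "den n * a + r *\<^sub>R (den m * b)" "den n * (- a)" "m + n"] by simp
    also have "q (den n * (- a)) (m + n) = q (- a) m" by (rule qD(3))
    finally show ?thesis by simp
  qed
  have bdd: "bdd_below (?f a m ` {0..})" for a m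
    using f_ge by (intro bdd_belowI2[of _ "- q (- a) m"]) simp
  have le: "q' a m \<le> ?f a m r" if "0 \<le> r" for a m r
    unfolding q'_def using bdd by (rule cINF_lower) (use that in auto)
  have ge: "x \<le> q' a m" if "\<And>r. 0 \<le> r \<Longrightarrow> x \<le> ?f a m r" for x a m
    unfolding q'_def by (rule cINF_greatest) (use that in auto)
  have q'_le: "q' a m \<le> q a m" for a m using le[of 0 a m] qD(3) by simp
  have "sublinear q'"
  proof (rule sublinearI)
    fix a a' m
    have *: "q' (a + a') m \<le> ?f a m r + ?f a' m s" if "0 \<le> r" "0 \<le> s" for r s
    proof -
      have "den n * (a + a') + (r + s) *\<^sub>R (den m * b)
          = (den n * a + r *\<^sub>R (den m * b)) + (den n * a' + s *\<^sub>R (den m * b))"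
        by (simp add: algebra_simps)
      then have "?f (a + a') m (r + s) \<le> ?f a m r + ?f a' m s"
        using qD(1)[of "den n * a + r *\<^sub>R (den m * b)" "den n * a' + s *\<^sub>R (den m * b)" "m + n"]
        by (simp add: distrib_right)
      then show ?thesis using le[of "r + s" "a + a'" m] that by linarith
    qed
    have "q' (a + a') m - q' a' m \<le> ?f a m r" if "0 \<le> r" for r
    proof -
      have "q' (a + a') m - ?f a m r \<le> q' a' m"
        using *[OF that] by (intro ge) (simp add: algebra_simps)
      then show ?thesis by simp
    qed
    then have "q' (a + a') m - q' a' m \<le> q' a m" by (rule ge)
    then show "q' (a + a') m \<le> q' a m + q' a' m" by simp
  next
    fix m
    have "0 \<le> q' 0 m" by (rule ge) (use f_ge[of _ 0 m] qD(5) in auto)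
    then show "q' 0 m = 0" using q'_le[of 0 m] qD(5)[of m] by simp
  next
    fix r :: real and a m assume r: "0 < r"
    have "q' (r *\<^sub>R a) m / r \<le> ?f a m s" if "0 \<le> s" for s
    proof -
      have "q' (r *\<^sub>R a) m \<le> ?f (r *\<^sub>R a) m (r * s)" using r that by (intro le) simp
      also have "\<dots> = r * ?f a m s"
        using qD(2)[of r "den n * a + s *\<^sub>R (den m * b)" "m + n"] r by (simp add: algebra_simps)
      finally show ?thesis using r by (simp add: field_simps)
    qed
    then have "q' (r *\<^sub>R a) m / r \<le> q' a m" by (rule ge)
    then show "q' (r *\<^sub>R a) m \<le> r * q' a m" using r by (simp add: field_simps)
  next
    fix a m k
    have "?f (den k * a) (m + k) r = ?f a m r" for r
      using qD(3)[of k "den n * a + r *\<^sub>R (den m * b)" "m + n"]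
      by (simp add: algebra_simps)
    then show "q' (den k * a) (m + k) = q' a m" unfolding q'_def by simp
  qed
  then have "q' = q" using q'_le by (intro min) (auto simp: le_fun_def)
  then have "q a n \<le> ?f a n 1" using le[of 1 a n] by simp
  also have "\<dots> = q (den n * (a + b)) (n + n) - q b n" by (simp add: distrib_left)
  also have "q (den n * (a + b)) (n + n) = q (a + b) n" by (rule qD(3))
  finally show ?thesis using qD(1)[of a b n] by simp
qed

theorem extension_to_fractions:
  obtains \<Lambda> :: "'a \<Rightarrow> 'i multiset \<Rightarrow> real"
  where "\<And>m. linear (\<lambda>a. \<Lambda> a m)" "\<And>a m n. \<Lambda> (den n * a) (m + n) = \<Lambda> a m"
    "\<And>a. \<Lambda> a {#} = L a" "\<And>a m. a \<in> P \<Longrightarrow> 0 \<le> \<Lambda> a m"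
proof -
  obtain q where q: "sublinear q" "q \<le> majorant" "\<And>q'. sublinear q' \<Longrightarrow> q' \<le> q \<Longrightarrow> q' = q"
    by (rule minimal_sublinear) blast
  note qD = sublinearD[OF q(1)]
  have add: "q (a + b) m = q a m + q b m" for a b m
    using q(1,3) by (rule minimal_sublinear_additive)
  have neg: "q (- a) m = - q a m" for a m
    using add[of a "- a" m] qD(5)[of m] by simp
  have scale: "q (r *\<^sub>R a) m = r * q a m" for r a m
    using qD(2)[of r a m] qD(2)[of "- r" a m] neg[of "r *\<^sub>R a" m] by (cases "0 \<le> r") auto
  have le: "q a m \<le> majorant a m" for a m using q(2) by (simp add: le_fun_def)
  show thesis
  proof (rule that[of q])
    show "linear (\<lambda>a. q a m)" for m by (rule linearI) (simp_all add: add scale)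
    show "q (den n * a) (m + n) = q a m" for a m n by (rule qD(3))
    have leL: "q a {#} \<le> L a" for a
      using le[of a "{#}"] majorant_le[of "{#}" a a] zero_P by simp
    show "q a {#} = L a" for a
      using leL[of a] leL[of "- a"] by (simp add: neg L_simps)
    \<comment> \<open>The element 0 lies above -a / den m, so the majorant, and with it
      \<open>q\<close>, is at most L 0 = 0 there.\<close>
    show "0 \<le> q a m" if "a \<in> P" for a m
      using le[of "- a" m] majorant_le[of m 0 "- a"] that by (simp add: neg L_simps)
  qed
qed

end

section \<open>An infinite-dimensional Hausdorff moment problem\<close>

text \<open>
  \<open>\<Phi> m n\<close> is to become the expectation of \<open>\<Prod>i\<in>m. Y i\<close> times \<open>\<Prod>i\<in>n. 1 - Y i\<close>.  As in de Finetti's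
  theorem, \<open>\<Phi>\<close> is read as the law of coin tosses, \<open>Y i\<close> being the random bias of the \<open>i\<close>-th coin.
\<close>

locale hausdorff_moments =
  fixes \<Phi> :: "'i multiset \<Rightarrow> 'i multiset \<Rightarrow> real"
  assumes nonneg: "0 \<le> \<Phi> m n" and normalized: "\<Phi> {#} {#} = 1"
    and split: "\<Phi> (add_mset i m) n + \<Phi> m (add_mset i n) = \<Phi> m n"
begin

text \<open>A pair consists of a coin and the number of a toss. Forgetting the number is what makes
  the tosses of one coin exchangeable.\<close>

definition coins :: "('i \<times> nat) set \<Rightarrow> 'i multiset" where
  "coins A = image_mset fst (mset_set A)"

lemma coins_insert: "finite A \<Longrightarrow> k \<notin> A \<Longrightarrow> coins (insert k A) = add_mset (fst k) (coins A)"
  by (simp add: coins_def)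

lemma coins_empty [simp]: "coins {} = {#}"
  by (simp add: coins_def)

text \<open>The probability that among the tosses in \<open>J\<close> exactly those in
  \<open>A\<close> show heads.\<close>

definition weight :: "('i \<times> nat) set \<Rightarrow> ('i \<times> nat) set \<Rightarrow> real" where
  "weight J A = \<Phi> (coins A) (coins (J - A))"

lemma weight_split:
  assumes "finite J" "k \<notin> J" "A \<subseteq> J"
  shows "weight (insert k J) (insert k A) + weight (insert k J) A = weight J A"
proof -
  have "insert k J - insert k A = J - A" "insert k J - A = insert k (J - A)" using assms by auto
  moreover have "finite A" using assms finite_subset by blast
  moreover have "k \<notin> A" using assms by blast
  ultimately show ?thesis
    using assms split[of "fst k" "coins A" "coins (J - A)"]
    by (simp add: weight_def coins_insert)
qed

text \<open>Kolmogorov's consistency condition: the tosses in \<open>K\<close> are summed out one by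
  one with \<open>weight_split\<close>.\<close>

lemma sum_weight_restrict:
  fixes \<phi> :: "('i \<times> nat) set \<Rightarrow> real"
  assumes "finite J" "finite K" "J \<inter> K = {}"
  shows "(\<Sum>A\<in>Pow (J \<union> K). weight (J \<union> K) A * \<phi> (A \<inter> J)) = (\<Sum>A\<in>Pow J. weight J A * \<phi> A)"
  using assms(2,3)
proof (induction K rule: finite_induct)
  case empty
  show ?case by (auto intro!: sum.cong simp: Int_absorb2)
next
  case (insert k K)
  define H where "H = J \<union> K"
  have H: "finite H" "k \<notin> H" using insert assms(1) by (auto simp: H_def)
  have "(\<Sum>A\<in>Pow (insert k H). weight (insert k H) A * \<phi> (A \<inter> J))
      = (\<Sum>A\<in>Pow H. weight (insert k H) A * \<phi> (A \<inter> J))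
        + (\<Sum>A\<in>insert k ` Pow H. weight (insert k H) A * \<phi> (A \<inter> J))"
    unfolding Pow_insert using H by (intro sum.union_disjoint) auto
  also have "(\<Sum>A\<in>insert k ` Pow H. weight (insert k H) A * \<phi> (A \<inter> J))
      = (\<Sum>A\<in>Pow H. weight (insert k H) (insert k A) * \<phi> (insert k A \<inter> J))"
    proof (subst sum.reindex)
    show "inj_on (insert k) (Pow H)" by (intro inj_onI) (metis H(2) PowD insert_ident subset_iff)
  qed simp
  also have "\<dots> = (\<Sum>A\<in>Pow H. weight (insert k H) (insert k A) * \<phi> (A \<inter> J))"
    using insert by (intro sum.cong HOL.refl) (auto simp: Int_insert_left)
  finally have "(\<Sum>A\<in>Pow (insert k H). weight (insert k H) A * \<phi> (A \<inter> J))
      = (\<Sum>A\<in>Pow H. (weight (insert k H) (insert k A) + weight (insert k H) A) * \<phi> (A \<inter> J))"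
    by (simp add: sum.distrib distrib_right)
  also have "\<dots> = (\<Sum>A\<in>Pow H. weight H A * \<phi> (A \<inter> J))"
    using H by (intro sum.cong) (auto simp: weight_split)
  also have "\<dots> = (\<Sum>A\<in>Pow J. weight J A * \<phi> A)" unfolding H_def using insert by auto
  finally show ?case by (simp add: H_def)
qed

text \<open>Heads and tails are the reals 1 and 0, so that the projective limit is taken over the
  Borel sets of a Polish space.\<close>

definition toss :: "('i \<times> nat) set \<Rightarrow> ('i \<times> nat) set \<Rightarrow> ('i \<times> nat \<Rightarrow> real)" where
  "toss J A = (\<lambda>j\<in>J. indicator A j)"

definition toss_law :: "('i \<times> nat) set \<Rightarrow> ('i \<times> nat \<Rightarrow> real) measure" where
  "toss_law J = distr (point_measure (Pow J) (\<lambda>A. ennreal (weight J A))) (PiM J (\<lambda>_. borel)) (toss J)"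

lemma toss_measurable: "toss J \<in> measurable (point_measure (Pow H) f) (PiM J (\<lambda>_. borel))"
  by (auto simp: toss_def measurable_point_measure_eq1 space_PiM)

lemma emeasure_toss_law:
  assumes "finite J" "X \<in> sets (PiM J (\<lambda>_. borel))"
  shows "emeasure (toss_law J) X = ennreal (\<Sum>A\<in>Pow J. weight J A * indicator X (toss J A))"
proof -
  let ?M = "point_measure (Pow J) (\<lambda>A. ennreal (weight J A))"
  have "emeasure (toss_law J) X = emeasure ?M (toss J -` X \<inter> Pow J)"
    unfolding toss_law_def using assms by (subst emeasure_distr[OF toss_measurable]) (auto simp: space_point_measure)
  also have "\<dots> = (\<Sum>A\<in>toss J -` X \<inter> Pow J. ennreal (weight J A))"
    using assms by (intro emeasure_point_measure_finite) auto
  also have "\<dots> = ennreal (\<Sum>A\<in>toss J -` X \<inter> Pow J. weight J A)"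
    by (intro sum_ennreal) (simp add: weight_def nonneg)
  also have "(\<Sum>A\<in>toss J -` X \<inter> Pow J. weight J A) = (\<Sum>A\<in>Pow J. weight J A * indicator X (toss J A))"
    using assms by (intro sum.mono_neutral_cong_left) (auto simp: indicator_def)
  finally show ?thesis .
qed

lemma polish_projective_toss_law: "polish_projective UNIV toss_law"
proof (rule polish_projective.intro, rule projective_family.intro)
  fix J H :: "('i \<times> nat) set"
  assume JH: "J \<subseteq> H" "finite H"
  then have J: "finite J" by (auto intro: finite_subset)
  show "toss_law J = distr (toss_law H) (PiM J (\<lambda>_. borel)) (\<lambda>f. restrict f J)"
  proof (rule measure_eqI)
    fix X assume "X \<in> sets (toss_law J)"
    then have X: "X \<in> sets (PiM J (\<lambda>_. borel))" by (simp add: toss_law_def)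
    have meas: "(\<lambda>f. restrict f J) \<in> measurable (PiM H (\<lambda>_. borel :: real measure)) (PiM J (\<lambda>_. borel))"
      using JH by (intro measurable_restrict_subset)
    have toss_in: "toss H A \<in> space (PiM H (\<lambda>_. borel :: real measure))" for A
      by (simp add: toss_def space_PiM)
    have restr: "restrict (toss H A) J = toss J (A \<inter> J)" for A
      using JH by (auto simp: toss_def fun_eq_iff restrict_def indicator_def)
    have "emeasure (distr (toss_law H) (PiM J (\<lambda>_. borel)) (\<lambda>f. restrict f J)) X
        = emeasure (toss_law H) ((\<lambda>f. restrict f J) -` X \<inter> space (PiM H (\<lambda>_. borel)))"
      using meas X by (subst emeasure_distr) (auto simp: toss_law_def)
    also have "\<dots> = ennreal (\<Sum>A\<in>Pow H. weight H A
        * indicator ((\<lambda>f. restrict f J) -` X \<inter> space (PiM H (\<lambda>_. borel))) (toss H A))"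
      using JH meas X by (intro emeasure_toss_law measurable_sets)
    also have "(\<Sum>A\<in>Pow H. weight H A
        * indicator ((\<lambda>f. restrict f J) -` X \<inter> space (PiM H (\<lambda>_. borel))) (toss H A))
        = (\<Sum>A\<in>Pow (J \<union> (H - J)). weight (J \<union> (H - J)) A * indicator X (toss J (A \<inter> J)))"
    proof -
      have "J \<union> (H - J) = H" using JH by blast
      then show ?thesis using toss_in by (simp add: indicator_def restr)
    qed
    also have "\<dots> = (\<Sum>A\<in>Pow J. weight J A * indicator X (toss J A))"
      using J JH by (intro sum_weight_restrict) auto
    also have "ennreal \<dots> = emeasure (toss_law J) X"
      using J X by (rule emeasure_toss_law[symmetric])
    finally show "emeasure (toss_law J) X
        = emeasure (distr (toss_law H) (PiM J (\<lambda>_. borel)) (\<lambda>f. restrict f J)) X" ..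
  qed (simp add: toss_law_def)
next
  fix J :: "('i \<times> nat) set" assume J: "finite J"
  show "prob_space (toss_law J)"
  proof
    have sp: "space (toss_law J) = space (PiM J (\<lambda>_. borel))" by (simp add: toss_law_def)
    have "emeasure (toss_law J) (space (toss_law J)) = ennreal (\<Sum>A\<in>Pow J. weight J A)"
      unfolding sp by (subst emeasure_toss_law[OF J sets.top]) (auto simp: toss_def space_PiM indicator_def)
    also have "(\<Sum>A\<in>Pow J. weight J A) = 1"
      using sum_weight_restrict[of "{}" J "\<lambda>_. 1"] J by (simp add: weight_def normalized)
    finally show "emeasure (toss_law J) (space (toss_law J)) = 1" by simp
  qed
qed

lemma coin_tosses:
  obtains N :: "('i \<times> nat \<Rightarrow> real) measure" and c :: "'i \<times> nat \<Rightarrow> ('i \<times> nat \<Rightarrow> real) \<Rightarrow> real"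
  where "prob_space N" "\<And>j. c j \<in> borel_measurable N" "\<And>j \<omega>. c j \<omega> \<in> {0, 1}"
    "\<And>A. finite A \<Longrightarrow> (\<integral>\<omega>. (\<Prod>j\<in>A. c j \<omega>) \<partial>N) = \<Phi> (coins A) {#}"
proof -
  interpret T: polish_projective UNIV toss_law by (rule polish_projective_toss_law)
  \<comment> \<open>Using the indicator instead of the coordinate itself gives values in {0, 1} at
    every point and not just almost everywhere.\<close>
  define c where "c j \<omega> = (indicator {1} (\<omega> j) :: real)" for j and \<omega> :: "'i \<times> nat \<Rightarrow> real"
  have sets_lim: "sets T.lim = sets (PiM UNIV (\<lambda>_. borel))" by simp
  have comp: "(\<lambda>\<omega>. \<omega> j) \<in> borel_measurable T.lim" for j
    unfolding measurable_cong_sets[OF sets_lim HOL.refl] by (rule measurable_component_singleton) simp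
  have meas: "c j \<in> borel_measurable T.lim" for j
    unfolding c_def using comp[of j] by measurable
  show thesis
  proof (rule that[of T.lim c])
    show "prob_space T.lim" by unfold_locales
    show "c j \<in> borel_measurable T.lim" for j by (rule meas)
    show "c j \<omega> \<in> {0, 1}" for j \<omega> by (simp add: c_def indicator_def)
    fix A :: "('i \<times> nat) set" assume A: "finite A"
    let ?X = "{\<lambda>j\<in>A. 1} :: ('i \<times> nat \<Rightarrow> real) set"
    have X: "?X \<in> sets (PiM A (\<lambda>_. borel))"
    proof -
      have "?X = PiE A (\<lambda>_. {1})" by (auto simp: PiE_eq_singleton)
      then show ?thesis using A by (simp only:) (intro sets_PiM_I_finite, auto)
    qed
    have emb: "T.emb UNIV A ?X = {\<omega> \<in> space T.lim. \<forall>j\<in>A. \<omega> j = 1}"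
    proof -
      have "restrict x A = (\<lambda>j\<in>A. 1) \<longleftrightarrow> (\<forall>j\<in>A. x j = 1)" for x :: "'i \<times> nat \<Rightarrow> real"
        by (metis restrict_apply' restrict_ext)
      then show ?thesis by (auto simp: prod_emb_def space_PiM)
    qed
    have "(\<integral>\<omega>. (\<Prod>j\<in>A. c j \<omega>) \<partial>T.lim) = (\<integral>\<omega>. indicator (T.emb UNIV A ?X) \<omega> \<partial>T.lim)"
    proof (rule Bochner_Integration.integral_cong[OF HOL.refl])
      fix \<omega> assume "\<omega> \<in> space T.lim"
      then show "(\<Prod>j\<in>A. c j \<omega>) = indicator (T.emb UNIV A ?X) \<omega>"
        unfolding emb using A by (auto simp: c_def indicator_def prod_zero_iff)
    qed
    also have "\<dots> = measure T.lim (T.emb UNIV A ?X)"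
      by (simp add: Int_absorb2 sets.sets_into_space emb)
    also have "\<dots> = measure (toss_law A) ?X" using A X by (intro T.measure_lim_emb) auto
    also have "\<dots> = (\<Sum>B\<in>Pow A. weight A B * indicator ?X (toss A B))"
      unfolding measure_def by (subst emeasure_toss_law[OF A X], rule enn2real_ennreal)
        (auto intro!: sum_nonneg mult_nonneg_nonneg simp: weight_def nonneg)
    \<comment> \<open>Within \<open>Pow A\<close>, the event that all tosses in \<open>A\<close>
      show heads is the single outcome \<open>B = A\<close>.\<close>
    also have "\<dots> = (\<Sum>B\<in>Pow A. if B = A then weight A A else 0)"
    proof (intro sum.cong HOL.refl)
      fix B assume "B \<in> Pow A"
      then have "toss A B \<in> ?X \<longleftrightarrow> B = A"
        by (auto simp: toss_def fun_eq_iff restrict_def indicator_def)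
      then show "weight A B * indicator ?X (toss A B) = (if B = A then weight A A else 0)"
        by (auto simp: indicator_def)
    qed
    also have "\<dots> = \<Phi> (coins A) {#}" using A by (simp add: weight_def)
    finally show "(\<integral>\<omega>. (\<Prod>j\<in>A. c j \<omega>) \<partial>T.lim) = \<Phi> (coins A) {#}" .
  qed
qed

end

section \<open>De Finetti averages: recovering the random biases from the tosses\<close>

context hausdorff_moments
begin

lemma moment_le_one: "\<Phi> m n \<le> 1"
proof -
  have "\<Phi> m {#} \<le> 1" for m
  proof (induction m)
    case (add i m)
    then show ?case using split[of i m "{#}"] nonneg[of m "{#i#}"] by simp
  qed (simp add: normalized)
  then have "\<Phi> m {#} \<le> 1" .
  moreover have "\<Phi> m n \<le> \<Phi> m {#}"
  proof (induction n)
    case (add i n)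
    then show ?case using split[of i m n] nonneg[of "add_mset i m" n] by simp
  qed simp
  ultimately show ?thesis by simp
qed

end

lemma prod_mset_unit_interval:
  fixes f :: "'i \<Rightarrow> real"
  assumes "\<And>i. f i \<in> {0..1}"
  shows "(\<Prod>i\<in>#m. f i) \<in> {0..1}"
  using assms by (induction m) (auto intro: mult_le_one)

lemma borel_measurable_prod_mset [measurable (raw)]:
  fixes f :: "'i \<Rightarrow> 'w \<Rightarrow> real"
  assumes "\<And>i. f i \<in> borel_measurable M"
  shows "(\<lambda>\<omega>. \<Prod>i\<in>#m. f i \<omega>) \<in> borel_measurable M"
  using assms by (induction m) auto

locale coin_tossing = hausdorff_moments \<Phi> + prob_space N
  for \<Phi> :: "'i multiset \<Rightarrow> 'i multiset \<Rightarrow> real" and N :: "'w measure" +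
  fixes c :: "'i \<times> nat \<Rightarrow> 'w \<Rightarrow> real"
  assumes c_meas [measurable]: "c j \<in> borel_measurable N" and c_01: "c j \<omega> \<in> {0, 1}"
    and c_moment: "finite A \<Longrightarrow> (\<integral>\<omega>. (\<Prod>j\<in>A. c j \<omega>) \<partial>N) = \<Phi> (coins A) {#}"
begin

lemma c_bounds [simp]: "0 \<le> c j \<omega>" "c j \<omega> \<le> 1"
  using c_01[of j \<omega>] by auto

lemma integrable_bounded:
  fixes f :: "'w \<Rightarrow> real"
  assumes "f \<in> borel_measurable N" "\<And>\<omega>. \<bar>f \<omega>\<bar> \<le> B"
  shows "integrable N f"
  using assms by (intro integrable_const_bound[of _ B]) auto

definition avg :: "'i \<Rightarrow> nat \<Rightarrow> 'w \<Rightarrow> real" where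
  "avg i n \<omega> = (\<Sum>j<n. c (i, j) \<omega>) / n"

lemma avg_meas [measurable]: "avg i n \<in> borel_measurable N"
  unfolding avg_def by measurable

lemma avg_unit: "avg i n \<omega> \<in> {0..1}"
proof -
  have "0 \<le> (\<Sum>j<n. c (i, j) \<omega>)" by (intro sum_nonneg) auto
  moreover have "(\<Sum>j<n. c (i, j) \<omega>) \<le> (\<Sum>j<n. 1)" by (intro sum_mono) auto
  ultimately show ?thesis by (auto simp: avg_def divide_le_eq)
qed

lemma pair_moment:
  assumes "a \<noteq> b"
  shows "(\<integral>\<omega>. c (i, a) \<omega> * c (i, b) \<omega> \<partial>N) = \<Phi> {#i, i#} {#}"
  using c_moment[of "{(i, a), (i, b)}"] assms by (simp add: coins_insert)

lemma integrable_c_mult: "integrable N (\<lambda>\<omega>. c j \<omega> * c k \<omega>)"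
  by (intro integrable_bounded[of _ 1]) (auto simp: abs_mult intro!: mult_le_one)

text \<open>The difference is an average of the \<open>d j\<close>, which pair the tosses n + j and
  j. For distinct indices E(d_j d_k) is an alternating sum of four equal pair moments, hence 0, and
  only the n diagonal terms remain.\<close>

lemma avg_doubling:
  assumes "0 < n"
  shows "(\<integral>\<omega>. (avg i (2 * n) \<omega> - avg i n \<omega>)\<^sup>2 \<partial>N) \<le> 1 / n"
proof -
  define d where "d j \<omega> = c (i, n + j) \<omega> - c (i, j) \<omega>" for j \<omega>
  have avg_diff: "avg i (2 * n) \<omega> - avg i n \<omega> = (\<Sum>j<n. d j \<omega>) / (2 * n)" for \<omega>
  proof -
    have "(\<Sum>j<n + m. c (i, j) \<omega>) = (\<Sum>j<n. c (i, j) \<omega>) + (\<Sum>j<m. c (i, n + j) \<omega>)" for m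
      by (induction m) simp_all
    from this[of n] have "(\<Sum>j<2 * n. c (i, j) \<omega>) = (\<Sum>j<n. c (i, j) \<omega>) + (\<Sum>j<n. c (i, n + j) \<omega>)"
      by (simp add: mult_2)
    then show ?thesis using assms by (simp add: avg_def d_def sum_subtractf field_simps)
  qed
  have dd: "d j \<omega> * d k \<omega> = c (i, n + j) \<omega> * c (i, n + k) \<omega> - c (i, n + j) \<omega> * c (i, k) \<omega>
      - c (i, j) \<omega> * c (i, n + k) \<omega> + c (i, j) \<omega> * c (i, k) \<omega>" for j k \<omega>
    by (simp add: d_def algebra_simps)
  have int_dd: "integrable N (\<lambda>\<omega>. d j \<omega> * d k \<omega>)" for j k
    unfolding dd by (intro Bochner_Integration.integrable_add Bochner_Integration.integrable_diff integrable_c_mult)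
  have E_dd: "(\<integral>\<omega>. d j \<omega> * d k \<omega> \<partial>N) \<le> (if j = k then 1 else 0)" if "j < n" "k < n" for j k
  proof (cases "j = k")
    case True
    have "(\<integral>\<omega>. d j \<omega> * d k \<omega> \<partial>N) \<le> (\<integral>\<omega>. 1 \<partial>N)"
    proof (intro integral_mono int_dd)
      fix \<omega>
      show "d j \<omega> * d k \<omega> \<le> 1"
        using c_01[of "(i, n + j)" \<omega>] c_01[of "(i, j)" \<omega>] True by (auto simp: d_def)
    qed simp
    then show ?thesis using True by (simp add: prob_space)
  next
    case False
    have "(\<integral>\<omega>. d j \<omega> * d k \<omega> \<partial>N) = \<Phi> {#i, i#} {#} - \<Phi> {#i, i#} {#} - \<Phi> {#i, i#} {#} + \<Phi> {#i, i#} {#}"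
      unfolding dd using False that
      by (simp add: integrable_c_mult pair_moment)
    then show ?thesis using False by simp
  qed
  have "(\<integral>\<omega>. (avg i (2 * n) \<omega> - avg i n \<omega>)\<^sup>2 \<partial>N)
      = (\<integral>\<omega>. (\<Sum>j<n. \<Sum>k<n. d j \<omega> * d k \<omega>) / (2 * n)\<^sup>2 \<partial>N)"
    by (simp add: avg_diff power_divide power2_eq_square[of "sum _ _"] sum_product)
  also have "\<dots> = (\<Sum>j<n. \<Sum>k<n. (\<integral>\<omega>. d j \<omega> * d k \<omega> \<partial>N)) / (2 * n)\<^sup>2"
    by (simp add: int_dd Bochner_Integration.integral_sum Bochner_Integration.integrable_sum)
  also have "\<dots> \<le> (\<Sum>j<n. \<Sum>k<n. if j = k then 1 else 0) / (2 * n)\<^sup>2"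
    by (intro divide_right_mono sum_mono E_dd) auto
  also have "\<dots> = real n / (2 * n)\<^sup>2" by simp
  also have "\<dots> \<le> 1 / n" using assms by (simp add: field_simps power2_eq_square)
  finally show ?thesis .
qed

text \<open>Along powers of 2 the increments have L1 norm at most 2^(-k/2), so their sum converges
  absolutely almost surely. The dyadic subsequence replaces a law of large numbers.\<close>

lemma AE_convergent_avg: "AE \<omega> in N. convergent (\<lambda>k. avg i (2 ^ k) \<omega>)"
proof -
  define D where "D k \<omega> = avg i (2 ^ Suc k) \<omega> - avg i (2 ^ k) \<omega>" for k \<omega>
  have [measurable]: "D k \<in> borel_measurable N" for k unfolding D_def by measurable
  have D_le: "\<bar>D k \<omega>\<bar> \<le> 1" for k \<omega>
    using avg_unit[of i "2 ^ Suc k" \<omega>] avg_unit[of i "2 ^ k" \<omega>] by (auto simp: D_def)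
  have int: "integrable N (\<lambda>\<omega>. \<bar>D k \<omega>\<bar>)" "integrable N (\<lambda>\<omega>. (D k \<omega>)\<^sup>2)" for k
    using D_le by (auto intro!: integrable_bounded[of _ 1] simp: abs_square_le_1)
  have E_D: "(\<integral>\<omega>. \<bar>D k \<omega>\<bar> \<partial>N) \<le> (1 / sqrt 2) ^ k" for k
  proof -
    have "((\<integral>\<omega>. \<bar>D k \<omega>\<bar> \<partial>N))\<^sup>2 \<le> (\<integral>\<omega>. (D k \<omega>)\<^sup>2 \<partial>N)"
      using variance_eq[of "\<lambda>\<omega>. \<bar>D k \<omega>\<bar>"] variance_positive[of "\<lambda>\<omega>. \<bar>D k \<omega>\<bar>"] int[of k] by simp
    also have "\<dots> \<le> 1 / 2 ^ k"
      using avg_doubling[of "2 ^ k" i] by (simp add: D_def mult.commute)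
    also have "1 / 2 ^ k = ((1 / sqrt 2) ^ k)\<^sup>2"
      by (simp add: power_divide power_mult[symmetric] mult.commute[of _ 2]) (simp add: power_mult)
    finally show ?thesis by (rule power2_le_imp_le) simp
  qed
  have "(\<integral>\<^sup>+\<omega>. (\<Sum>k. ennreal \<bar>D k \<omega>\<bar>) \<partial>N) = (\<Sum>k. \<integral>\<^sup>+\<omega>. ennreal \<bar>D k \<omega>\<bar> \<partial>N)"
    by (intro nn_integral_suminf) measurable
  also have "\<dots> = (\<Sum>k. ennreal (\<integral>\<omega>. \<bar>D k \<omega>\<bar> \<partial>N))"
    using int by (simp add: nn_integral_eq_integral)
  also have "\<dots> \<le> (\<Sum>k. ennreal ((1 / sqrt 2) ^ k))"
    by (intro suminf_le ennreal_leI E_D) auto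
  also have "\<dots> < \<infinity>"
  proof -
    have "summable (\<lambda>k. (1 / sqrt 2) ^ k :: real)"
      by (rule summable_geometric) simp
    then show ?thesis by (subst suminf_ennreal2) auto
  qed
  finally have "AE \<omega> in N. (\<Sum>k. ennreal \<bar>D k \<omega>\<bar>) \<noteq> \<infinity>"
    by (intro nn_integral_noteq_infinite) auto
  then show ?thesis
  proof eventually_elim
    case (elim \<omega>)
    have "summable (\<lambda>k. \<bar>D k \<omega>\<bar>)"
      using elim by (intro summable_suminf_not_top) auto
    then have "summable (\<lambda>k. D k \<omega>)" by (rule summable_rabs_cancel)
    then have "convergent (\<lambda>n. \<Sum>k<n. D k \<omega>)" by (simp add: summable_iff_convergent)
    moreover have "(\<Sum>k<n. D k \<omega>) = avg i (2 ^ n) \<omega> - avg i 1 \<omega>" for n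
      unfolding D_def using sum_lessThan_telescope[of "\<lambda>k. avg i (2 ^ k) \<omega>" n] by simp
    ultimately have "convergent (\<lambda>n. avg i (2 ^ n) \<omega> - avg i 1 \<omega>)" by simp
    then show ?case by (simp add: convergent_diff_const_right_iff)
  qed
qed

text \<open>The clipping puts the value into [0, 1] also at points where the averages diverge and
  \<open>lim\<close> is unspecified.\<close>

definition bias :: "'i \<Rightarrow> 'w \<Rightarrow> real" where
  "bias i \<omega> = max 0 (min 1 (lim (\<lambda>k. avg i (2 ^ k) \<omega>)))"

lemma bias_meas [measurable]: "bias i \<in> borel_measurable N"
  unfolding bias_def by measurable

lemma bias_unit: "bias i \<omega> \<in> {0..1}"
  by (auto simp: bias_def)

lemma AE_avg_tendsto: "AE \<omega> in N. (\<lambda>k. avg i (2 ^ k) \<omega>) \<longlonglongrightarrow> bias i \<omega>"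
  using AE_convergent_avg[of i]
proof eventually_elim
  case (elim \<omega>)
  then have lim: "(\<lambda>k. avg i (2 ^ k) \<omega>) \<longlonglongrightarrow> lim (\<lambda>k. avg i (2 ^ k) \<omega>)"
    by (simp add: convergent_LIMSEQ_iff)
  have "0 \<le> lim (\<lambda>k. avg i (2 ^ k) \<omega>)" "lim (\<lambda>k. avg i (2 ^ k) \<omega>) \<le> 1"
    using avg_unit by (auto intro!: LIMSEQ_le_const[OF lim] LIMSEQ_le_const2[OF lim])
  then show ?case using lim by (simp add: bias_def)
qed

lemma mixed_unit: "finite J \<Longrightarrow> (\<Prod>i\<in>#m. bias i \<omega>) * (\<Prod>j\<in>J. c j \<omega>) \<in> {0..1}"
  using prod_mset_unit_interval[of "\<lambda>i. bias i \<omega>" m] bias_unit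
    prod_nonneg[of J "\<lambda>j. c j \<omega>"] prod_le_1[of J "\<lambda>j. c j \<omega>"]
  by (auto intro: mult_le_one)

text \<open>In the limit, \<open>bias i\<close> may be replaced by an average of tosses of coin i. A
  toss not yet in \<open>J\<close> contributes exactly the desired moment by the induction
  hypothesis for \<open>insert (i, j) J\<close>; at most \<open>card J\<close> of the n tosses are
  already used, and their error vanishes.\<close>

lemma bias_moment:
  assumes "finite J"
  shows "(\<integral>\<omega>. (\<Prod>i\<in>#m. bias i \<omega>) * (\<Prod>j\<in>J. c j \<omega>) \<partial>N) = \<Phi> (m + coins J) {#}"
  using assms
proof (induction m arbitrary: J)
  case empty
  then show ?case by (simp add: c_moment)
next
  case (add i m)
  define Z where "Z \<omega> = (\<Prod>i\<in>#m. bias i \<omega>) * (\<Prod>j\<in>J. c j \<omega>)" for \<omega>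
  have Z_meas [measurable]: "Z \<in> borel_measurable N" unfolding Z_def by measurable
  have Z_unit: "Z \<omega> \<in> {0..1}" for \<omega> unfolding Z_def by (rule mixed_unit[OF add.prems])
  define \<phi> where "\<phi> = \<Phi> (add_mset i m + coins J) {#}"
  have int_Zc: "integrable N (\<lambda>\<omega>. Z \<omega> * c j \<omega>)" for j
    using Z_unit by (intro integrable_bounded[of _ 1]) (auto simp: abs_mult intro!: mult_le_one)
  have E_Zc: "\<bar>(\<integral>\<omega>. Z \<omega> * c (i, j) \<omega> \<partial>N) - \<phi>\<bar> \<le> indicator {j. (i, j) \<in> J} j" for j
  proof (cases "(i, j) \<in> J")
    case True
    have "0 \<le> (\<integral>\<omega>. Z \<omega> * c (i, j) \<omega> \<partial>N)" using Z_unit by (intro integral_nonneg_AE) auto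
    moreover have "(\<integral>\<omega>. Z \<omega> * c (i, j) \<omega> \<partial>N) \<le> (\<integral>\<omega>. 1 \<partial>N)"
      using Z_unit by (intro integral_mono int_Zc) (auto intro!: mult_le_one)
    moreover have "0 \<le> \<phi>" "\<phi> \<le> 1" unfolding \<phi>_def by (rule nonneg moment_le_one)+
    ultimately show ?thesis using True by (auto simp: prob_space abs_le_iff)
  next
    case False
    have "Z \<omega> * c (i, j) \<omega> = (\<Prod>i\<in>#m. bias i \<omega>) * (\<Prod>j\<in>insert (i, j) J. c j \<omega>)" for \<omega>
      using False add.prems by (simp add: Z_def)
    then have "(\<integral>\<omega>. Z \<omega> * c (i, j) \<omega> \<partial>N) = \<Phi> (m + coins (insert (i, j) J)) {#}"
      using add.IH[of "insert (i, j) J"] add.prems by (simp only: finite_insert)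
    then show ?thesis using add.prems False by (simp add: coins_insert \<phi>_def)
  qed
  have E_Zavg: "\<bar>(\<integral>\<omega>. Z \<omega> * avg i n \<omega> \<partial>N) - \<phi>\<bar> \<le> card J / n" if "0 < n" for n
  proof -
    have "(\<integral>\<omega>. Z \<omega> * avg i n \<omega> \<partial>N) = (\<Sum>j<n. (\<integral>\<omega>. Z \<omega> * c (i, j) \<omega> \<partial>N)) / n"
      by (simp add: avg_def sum_distrib_left int_Zc Bochner_Integration.integral_sum)
    then have "(\<integral>\<omega>. Z \<omega> * avg i n \<omega> \<partial>N) - \<phi> = (\<Sum>j<n. (\<integral>\<omega>. Z \<omega> * c (i, j) \<omega> \<partial>N) - \<phi>) / n"
      using that by (simp add: sum_subtractf field_simps)
    then have "\<bar>(\<integral>\<omega>. Z \<omega> * avg i n \<omega> \<partial>N) - \<phi>\<bar> = \<bar>\<Sum>j<n. (\<integral>\<omega>. Z \<omega> * c (i, j) \<omega> \<partial>N) - \<phi>\<bar> / n"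
      by simp
    also have "\<bar>\<Sum>j<n. (\<integral>\<omega>. Z \<omega> * c (i, j) \<omega> \<partial>N) - \<phi>\<bar> \<le> (\<Sum>j<n. indicator {j. (i, j) \<in> J} j)"
      using E_Zc by (intro order_trans[OF sum_abs] sum_mono)
    also have "\<dots> = card ({..<n} \<inter> {j. (i, j) \<in> J})"
      by (simp add: indicator_def sum.If_cases)
    also have "\<dots> \<le> card J"
    proof -
      have "{..<n} \<inter> {j. (i, j) \<in> J} \<subseteq> snd ` J" by force
      then have "card ({..<n} \<inter> {j. (i, j) \<in> J}) \<le> card (snd ` J)"
        using add.prems by (intro card_mono) auto
      also have "\<dots> \<le> card J" using add.prems by (rule card_image_le)
      finally show ?thesis by simp
    qed
    finally show ?thesis by (simp add: divide_right_mono)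
  qed
  have "(\<lambda>k. \<integral>\<omega>. Z \<omega> * avg i (2 ^ k) \<omega> \<partial>N) \<longlonglongrightarrow> \<phi>"
  proof (rule LIM_zero_cancel, rule Lim_null_comparison)
    show "\<forall>\<^sub>F k in sequentially. norm ((\<integral>\<omega>. Z \<omega> * avg i (2 ^ k) \<omega> \<partial>N) - \<phi>) \<le> card J * (1 / 2) ^ k"
      using E_Zavg[of "2 ^ _"] by (auto intro!: always_eventually simp: power_divide)
    show "(\<lambda>k. card J * (1 / 2) ^ k :: real) \<longlonglongrightarrow> 0"
      by (rule tendsto_mult_right_zero) (simp add: LIMSEQ_realpow_zero)
  qed
  moreover have "(\<lambda>k. \<integral>\<omega>. Z \<omega> * avg i (2 ^ k) \<omega> \<partial>N) \<longlonglongrightarrow> (\<integral>\<omega>. Z \<omega> * bias i \<omega> \<partial>N)"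
  proof (rule integral_dominated_convergence[where w = "\<lambda>_. 1"])
    show "AE \<omega> in N. (\<lambda>k. Z \<omega> * avg i (2 ^ k) \<omega>) \<longlonglongrightarrow> Z \<omega> * bias i \<omega>"
      using AE_avg_tendsto[of i] by eventually_elim (intro tendsto_intros)
    show "AE \<omega> in N. norm (Z \<omega> * avg i (2 ^ k) \<omega>) \<le> 1" for k
      using Z_unit avg_unit by (auto simp: abs_mult intro!: mult_le_one)
  qed auto
  ultimately have "(\<integral>\<omega>. Z \<omega> * bias i \<omega> \<partial>N) = \<phi>" by (rule LIMSEQ_unique[OF _ , rotated])
  then show ?case by (simp add: Z_def \<phi>_def mult_ac)
qed

lemma bias_mixed_moment:
  "(\<integral>\<omega>. (\<Prod>i\<in>#m. bias i \<omega>) * (\<Prod>i\<in>#n. 1 - bias i \<omega>) \<partial>N) = \<Phi> m n"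
proof (induction n arbitrary: m)
  case empty
  then show ?case using bias_moment[of "{}" m] by simp
next
  case (add i n)
  have int: "integrable N (\<lambda>\<omega>. (\<Prod>i\<in>#m. bias i \<omega>) * (\<Prod>i\<in>#n. 1 - bias i \<omega>))" for m n
  proof (rule integrable_bounded[of _ 1])
    fix \<omega>
    have "(\<Prod>i\<in>#m. bias i \<omega>) \<in> {0..1}" "(\<Prod>i\<in>#n. 1 - bias i \<omega>) \<in> {0..1}"
      using bias_unit by (intro prod_mset_unit_interval; force)+
    then show "\<bar>(\<Prod>i\<in>#m. bias i \<omega>) * (\<Prod>i\<in>#n. 1 - bias i \<omega>)\<bar> \<le> 1"
      by (auto simp: abs_mult intro!: mult_le_one)
  qed measurable
  have "(\<integral>\<omega>. (\<Prod>i\<in>#m. bias i \<omega>) * (\<Prod>i\<in>#add_mset i n. 1 - bias i \<omega>) \<partial>N)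
    = (\<integral>\<omega>. (\<Prod>i\<in>#m. bias i \<omega>) * (\<Prod>i\<in>#n. 1 - bias i \<omega>)
        - (\<Prod>i\<in>#add_mset i m. bias i \<omega>) * (\<Prod>i\<in>#n. 1 - bias i \<omega>) \<partial>N)"
    by (intro Bochner_Integration.integral_cong) (auto simp: algebra_simps)
  also have "\<dots> = \<Phi> m n - \<Phi> (add_mset i m) n"
    by (subst Bochner_Integration.integral_diff[OF int int]) (simp only: add.IH)
  also have "\<dots> = \<Phi> m (add_mset i n)" using split[of i m n] by simp
  finally show ?case .
qed

end

theorem (in hausdorff_moments) solution:
  obtains N :: "('i \<times> nat \<Rightarrow> real) measure" and Y :: "'i \<Rightarrow> ('i \<times> nat \<Rightarrow> real) \<Rightarrow> real"
  where "prob_space N" "\<And>i. Y i \<in> borel_measurable N" "\<And>i \<omega>. Y i \<omega> \<in> {0..1}"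
    "\<And>m n. (\<integral>\<omega>. (\<Prod>i\<in>#m. Y i \<omega>) * (\<Prod>i\<in>#n. 1 - Y i \<omega>) \<partial>N) = \<Phi> m n"
proof -
  obtain N and c :: "'i \<times> nat \<Rightarrow> ('i \<times> nat \<Rightarrow> real) \<Rightarrow> real"
    where N: "prob_space N" "\<And>j. c j \<in> borel_measurable N" "\<And>j \<omega>. c j \<omega> \<in> {0, 1}"
    "\<And>A. finite A \<Longrightarrow> (\<integral>\<omega>. (\<Prod>j\<in>A. c j \<omega>) \<partial>N) = \<Phi> (coins A) {#}"
    by (rule coin_tosses) blast
  interpret coin_tossing \<Phi> N c
    using N by (intro coin_tossing.intro coin_tossing_axioms.intro hausdorff_moments_axioms) auto
  show thesis
    using that[of N bias] bias_unit bias_meas bias_mixed_moment N(1) by blast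
qed

section \<open>Realising a functional by random variables\<close>

text \<open>
  The coins \<open>(i, True)\<close> and \<open>(i, False)\<close> have the biases \<open>1 / (1 + t\<^sup>2)\<close> and
  \<open>(1 + t)\<^sup>2 / (2 (1 + t\<^sup>2)) = 1 / 2 + t / (1 + t\<^sup>2)\<close> for \<open>t = g i\<close>; the numerators of the biases and of
  their complements are sums of squares.
\<close>

context positive_cone
begin

definition heads_num :: "'i \<times> bool \<Rightarrow> 'a" where
  "heads_num x = (if snd x then 1 else (1 / 2) *\<^sub>R (1 + g (fst x))\<^sup>2)"

definition tails_num :: "'i \<times> bool \<Rightarrow> 'a" where
  "tails_num x = (if snd x then (g (fst x))\<^sup>2 else (1 / 2) *\<^sub>R (1 - g (fst x))\<^sup>2)"

lemma heads_plus_tails: "heads_num x + tails_num x = 1 + (g (fst x))\<^sup>2"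
proof (cases "snd x")
  case False
  have "(1 + t)\<^sup>2 + (1 - t)\<^sup>2 = 2 *\<^sub>R (1 + t\<^sup>2)" for t :: 'a
    by (simp add: power2_eq_square algebra_simps scaleR_2)
  then show ?thesis using False
    by (simp add: heads_num_def tails_num_def flip: scaleR_add_right)
qed (simp add: heads_num_def tails_num_def)

lemma num_mult_P: "a \<in> P \<Longrightarrow> heads_num x * a \<in> P" "a \<in> P \<Longrightarrow> tails_num x * a \<in> P"
  using scale_P[OF square_P[of a "1 + g (fst x)"], of "1 / 2"]
    scale_P[OF square_P[of a "1 - g (fst x)"], of "1 / 2"] square_P[of a "g (fst x)"]
  by (auto simp: heads_num_def tails_num_def mult.commute)

lemma num_prod_P: "a \<in> P \<Longrightarrow> (\<Prod>x\<in>#m. heads_num x) * a \<in> P"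
    "a \<in> P \<Longrightarrow> (\<Prod>x\<in>#m. tails_num x) * a \<in> P"
  by (induction m) (simp_all add: mult.assoc num_mult_P)

end

locale fraction_functional = positive_cone L P g
  for L :: "'a::{comm_ring_1,real_algebra_1} \<Rightarrow> real" and P :: "'a set" and g :: "'i \<Rightarrow> 'a" +
  fixes \<Lambda> :: "'a \<Rightarrow> 'i multiset \<Rightarrow> real"
  assumes linear_\<Lambda>: "linear (\<lambda>a. \<Lambda> a m)" and cancel_\<Lambda>: "\<Lambda> (den n * a) (m + n) = \<Lambda> a m"
    and \<Lambda>_L: "\<Lambda> a {#} = L a" and \<Lambda>_nonneg: "a \<in> P \<Longrightarrow> 0 \<le> \<Lambda> a m"
begin

lemma cancel1_\<Lambda>: "\<Lambda> ((1 + (g i)\<^sup>2) * a) (add_mset i m) = \<Lambda> a m"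
  using cancel_\<Lambda>[of "{#i#}" a m] by simp

lemmas \<Lambda>_simps = linear_add[OF linear_\<Lambda>] linear_diff[OF linear_\<Lambda>] linear_scale[OF linear_\<Lambda>]

text \<open>To become the moment of the biases indexed by \<open>m\<close> and of the complements
  indexed by \<open>n\<close>, multiplied by the unbounded factors 1 + t^2 listed in
  \<open>\<beta>\<close>, which are the reciprocals of the biases \<open>(i, True)\<close>. For
  empty \<open>\<beta>\<close> it is the functional to which \<open>hausdorff_moments\<close>
  applies.\<close>

definition \<Psi> :: "'i multiset \<Rightarrow> ('i \<times> bool) multiset \<Rightarrow> ('i \<times> bool) multiset \<Rightarrow> real" where
  "\<Psi> \<beta> m n = \<Lambda> (den \<beta> * ((\<Prod>x\<in>#m. heads_num x) * (\<Prod>x\<in>#n. tails_num x)))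
     (image_mset fst m + image_mset fst n)"

lemma \<Psi>_nonneg: "0 \<le> \<Psi> \<beta> m n"
  using num_prod_P(2)[OF one_P, of n]
  by (auto simp: \<Psi>_def intro!: \<Lambda>_nonneg den_mult_P num_prod_P(1))

lemma \<Psi>_split: "\<Psi> \<beta> (add_mset x m) n + \<Psi> \<beta> m (add_mset x n) = \<Psi> \<beta> m n"
proof -
  let ?a = "den \<beta> * ((\<Prod>x\<in>#m. heads_num x) * (\<Prod>x\<in>#n. tails_num x))"
  let ?k = "image_mset fst m + image_mset fst n"
  have "\<Psi> \<beta> (add_mset x m) n + \<Psi> \<beta> m (add_mset x n)
      = \<Lambda> (heads_num x * ?a) (add_mset (fst x) ?k) + \<Lambda> (tails_num x * ?a) (add_mset (fst x) ?k)"
    by (simp add: \<Psi>_def ac_simps)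
  also have "\<dots> = \<Lambda> ((1 + (g (fst x))\<^sup>2) * ?a) (add_mset (fst x) ?k)"
    by (simp only: \<Lambda>_simps[symmetric] distrib_right[symmetric] heads_plus_tails)
  also have "\<dots> = \<Psi> \<beta> m n" by (simp only: cancel1_\<Lambda> \<Psi>_def)
  finally show ?thesis .
qed

lemma \<Psi>_cancel: "\<Psi> (add_mset i \<beta>) (add_mset (i, True) m) n = \<Psi> \<beta> m n"
proof -
  have "\<Psi> (add_mset i \<beta>) (add_mset (i, True) m) n
      = \<Lambda> ((1 + (g i)\<^sup>2) * (den \<beta> * ((\<Prod>x\<in>#m. heads_num x) * (\<Prod>x\<in>#n. tails_num x))))
          (add_mset i (image_mset fst m + image_mset fst n))"
    by (simp add: \<Psi>_def heads_num_def mult.assoc)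
  then show ?thesis by (simp only: cancel1_\<Lambda> \<Psi>_def)
qed

lemma \<Psi>_one: "\<Psi> {#} {#} {#} = 1"
  by (simp add: \<Psi>_def \<Lambda>_L L_one)

text \<open>\<open>1 / U = (\<Sum>j. (1 - U) ^ j)\<close> in terms of moments.\<close>

lemma \<Psi>_geometric:
  "(\<Sum>j<k. \<Psi> \<beta> m (n + replicate_mset j (i, True)))
    = \<Psi> (add_mset i \<beta>) m n - \<Psi> (add_mset i \<beta>) m (n + replicate_mset k (i, True))"
proof (induction k)
  case (Suc k)
  have "\<Psi> (add_mset i \<beta>) m (n + replicate_mset k (i, True))
      = \<Psi> \<beta> m (n + replicate_mset k (i, True)) + \<Psi> (add_mset i \<beta>) m (n + replicate_mset (Suc k) (i, True))"
    using \<Psi>_split[of "add_mset i \<beta>" "(i, True)" m "n + replicate_mset k (i, True)"]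
    by (simp add: \<Psi>_cancel)
  then show ?case using Suc by simp
qed simp

text \<open>No mass escapes to t = infinity: the partial sums of the geometric series are bounded by
  the value with the additional factor 1 + t^2, so the terms tend to 0.\<close>

lemma \<Psi>_replicate_tendsto_0: "(\<lambda>k. \<Psi> \<beta> m (n + replicate_mset k (i, True))) \<longlonglongrightarrow> 0"
proof -
  have "summable (\<lambda>j. \<Psi> \<beta> m (n + replicate_mset j (i, True)))"
    by (rule summableI_nonneg_bounded[where x = "\<Psi> (add_mset i \<beta>) m n"])
      (simp_all add: \<Psi>_nonneg \<Psi>_geometric)
  then show ?thesis by (rule summable_LIMSEQ_zero)
qed

lemma \<Psi>_geometric_tendsto:
  "(\<lambda>k. \<Sum>j<k. \<Psi> \<beta> m (n + replicate_mset j (i, True))) \<longlonglongrightarrow> \<Psi> (add_mset i \<beta>) m n"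
  using tendsto_diff[OF tendsto_const \<Psi>_replicate_tendsto_0[of "add_mset i \<beta>" m n i], of "\<Psi> (add_mset i \<beta>) m n"]
  unfolding \<Psi>_geometric by simp

section \<open>Dividing by the biases: from bounded fractions back to the coordinates\<close>

context
  fixes N :: "'w measure" and Y :: "'i \<times> bool \<Rightarrow> 'w \<Rightarrow> real"
  assumes N: "prob_space N" and Y_meas [measurable]: "\<And>x. Y x \<in> borel_measurable N"
    and Y_unit: "\<And>x \<omega>. Y x \<omega> \<in> {0..1}"
    and Y_moment: "\<And>m n. (\<integral>\<omega>. (\<Prod>x\<in>#m. Y x \<omega>) * (\<Prod>x\<in>#n. 1 - Y x \<omega>) \<partial>N) = \<Psi> {#} m n"
begin

interpretation prob_space N by (rule N)

lemma Y_bounds [simp]: "0 \<le> Y x \<omega>" "Y x \<omega> \<le> 1"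
  using Y_unit[of x \<omega>] by auto

definition Yprod where
  "Yprod m n \<omega> = (\<Prod>x\<in>#m. Y x \<omega>) * (\<Prod>x\<in>#n. 1 - Y x \<omega>)"

lemma Yprod_meas [measurable]: "Yprod m n \<in> borel_measurable N"
  unfolding Yprod_def by measurable

lemma Yprod_unit: "0 \<le> Yprod m n \<omega>" "Yprod m n \<omega> \<le> 1"
  using prod_mset_unit_interval[of "\<lambda>x. Y x \<omega>" m] prod_mset_unit_interval[of "\<lambda>x. 1 - Y x \<omega>" n]
  by (auto simp: Yprod_def intro: mult_le_one)

lemma integrable_Yprod: "integrable N (Yprod m n)"
  using Yprod_unit by (intro integrable_const_bound[of _ 1]) auto

text \<open>On the event \<open>Y (i, True) = 0\<close> every power of the complement equals 1, so
  its probability is below all terms of a null sequence.\<close>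

lemma AE_pos: "AE \<omega> in N. 0 < Y (i, True) \<omega>"
proof -
  let ?Z = "{\<omega> \<in> space N. Y (i, True) \<omega> = 0}"
  have le: "measure N ?Z \<le> \<Psi> {#} {#} ({#} + replicate_mset k (i, True))" for k
  proof -
    have "measure N ?Z = (\<integral>\<omega>. indicator ?Z \<omega> \<partial>N)"
      by (simp add: Int_absorb2 subset_eq)
    also have "\<dots> \<le> (\<integral>\<omega>. Yprod {#} (replicate_mset k (i, True)) \<omega> \<partial>N)"
    proof (rule integral_mono)
      show "integrable N (indicat_real ?Z)"
        by (intro integrable_const_bound[of _ 1]) (auto simp: indicator_def)
      show "indicat_real ?Z \<omega> \<le> Yprod {#} (replicate_mset k (i, True)) \<omega>" for \<omega>
        by (auto simp: indicator_def Yprod_def)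
    qed (rule integrable_Yprod)
    also have "\<dots> = \<Psi> {#} {#} (replicate_mset k (i, True))"
      unfolding Yprod_def by (rule Y_moment)
    finally show ?thesis by simp
  qed
  have "measure N ?Z \<le> 0"
    by (rule LIMSEQ_le_const[OF \<Psi>_replicate_tendsto_0[of "{#}" "{#}" "{#}" i]]) (use le in blast)
  then have "emeasure N ?Z = 0" by (simp add: emeasure_eq_measure measure_le_0_iff)
  then have "AE \<omega> in N. Y (i, True) \<omega> \<noteq> 0"
    by (subst AE_iff_measurable[of ?Z]) auto
  then show ?thesis by eventually_elim (simp add: less_le)
qed

definition inv_prod where
  "inv_prod \<beta> \<omega> = (\<Prod>i\<in>#\<beta>. 1 / Y (i, True) \<omega>)"

lemma inv_prod_meas [measurable]: "inv_prod \<beta> \<in> borel_measurable N"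
  unfolding inv_prod_def by measurable

lemma inv_prod_nonneg: "0 \<le> inv_prod \<beta> \<omega>"
  unfolding inv_prod_def by (induction \<beta>) auto

text \<open>Monotone convergence for the geometric series of 1 / \<open>Y (i, True)\<close>, whose
  expected partial sums are known from \<open>\<Psi>_geometric_tendsto\<close>. Integrability comes
  out at the same time, since the limit is finite.\<close>

lemma inverse_moment:
  "integrable N (\<lambda>\<omega>. inv_prod \<beta> \<omega> * Yprod m n \<omega>)
    \<and> (\<integral>\<omega>. inv_prod \<beta> \<omega> * Yprod m n \<omega> \<partial>N) = \<Psi> \<beta> m n"
proof (induction \<beta> arbitrary: m n)
  case empty
  then show ?case using integrable_Yprod[of m n] Y_moment[of m n] by (simp add: inv_prod_def Yprod_def[abs_def])
next
  case (add i \<beta>)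
  define f where "f k \<omega> = (\<Sum>j<k. inv_prod \<beta> \<omega> * Yprod m (n + replicate_mset j (i, True)) \<omega>)" for k \<omega>
  have Yp: "Yprod m (n + replicate_mset j (i, True)) \<omega> = Yprod m n \<omega> * (1 - Y (i, True) \<omega>) ^ j" for j \<omega>
    by (simp add: Yprod_def)
  have int_f: "integrable N (f k)" for k
    unfolding f_def using add.IH by (intro Bochner_Integration.integrable_sum) auto
  have f_mono: "mono (\<lambda>k. f k \<omega>)" for \<omega>
    unfolding f_def by (intro monoI sum_mono2) (auto simp: inv_prod_nonneg Yprod_unit)
  have f_lim: "AE \<omega> in N. (\<lambda>k. f k \<omega>) \<longlonglongrightarrow> inv_prod (add_mset i \<beta>) \<omega> * Yprod m n \<omega>"
    using AE_pos[of i]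
  proof eventually_elim
    case (elim \<omega>)
    have "(\<lambda>j. (1 - Y (i, True) \<omega>) ^ j) sums (1 / (1 - (1 - Y (i, True) \<omega>)))"
      using elim Y_bounds[of "(i, True)" \<omega>] by (intro geometric_sums) auto
    then have "(\<lambda>j. inv_prod \<beta> \<omega> * Yprod m n \<omega> * (1 - Y (i, True) \<omega>) ^ j)
        sums (inv_prod \<beta> \<omega> * Yprod m n \<omega> * (1 / Y (i, True) \<omega>))"
      by (intro sums_mult) simp
    then show ?case unfolding sums_def f_def Yp by (simp add: inv_prod_def mult_ac)
  qed
  have f_int: "(\<lambda>k. \<integral>\<omega>. f k \<omega> \<partial>N) \<longlonglongrightarrow> \<Psi> (add_mset i \<beta>) m n"
  proof -
    have "(\<integral>\<omega>. f k \<omega> \<partial>N) = (\<Sum>j<k. \<Psi> \<beta> m (n + replicate_mset j (i, True)))" for k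
      unfolding f_def using add.IH by (subst Bochner_Integration.integral_sum) auto
    then show ?thesis using \<Psi>_geometric_tendsto by simp
  qed
  have "AE \<omega> in N. mono (\<lambda>k. f k \<omega>)" using f_mono by simp
  note mct = int_f this f_lim f_int
  show ?case
    by (intro conjI integrable_monotone_convergence[OF mct] integral_monotone_convergence[OF mct]) measurable
qed

definition centered_prod where
  "centered_prod \<alpha> \<omega> = (\<Prod>i\<in>#\<alpha>. Y (i, False) \<omega> - 1 / 2)"

text \<open>The bias \<open>(i, False)\<close> minus 1/2 stands for t / (1 + t^2), because (1 + t)^2
  / 2 - (1 + t^2) / 2 = t. The multiset \<open>m\<close> is kept arbitrary because each step uses
  the hypothesis also with \<open>(i, False)\<close> added to it.\<close>

lemma centered_moment:
  "integrable N (\<lambda>\<omega>. centered_prod \<alpha> \<omega> * (inv_prod \<beta> \<omega> * Yprod m {#} \<omega>))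
    \<and> (\<integral>\<omega>. centered_prod \<alpha> \<omega> * (inv_prod \<beta> \<omega> * Yprod m {#} \<omega>) \<partial>N)
      = \<Lambda> (den \<beta> * ((\<Prod>i\<in>#\<alpha>. g i) * (\<Prod>x\<in>#m. heads_num x))) (\<alpha> + image_mset fst m)"
proof (induction \<alpha> arbitrary: m)
  case empty
  then show ?case using inverse_moment[of \<beta> m "{#}"] by (simp add: centered_prod_def \<Psi>_def)
next
  case (add i \<alpha>)
  let ?X = "\<lambda>m \<omega>. centered_prod \<alpha> \<omega> * (inv_prod \<beta> \<omega> * Yprod m {#} \<omega>)"
  let ?a = "den \<beta> * ((\<Prod>i\<in>#\<alpha>. g i) * (\<Prod>x\<in>#m. heads_num x))"
  let ?k = "\<alpha> + image_mset fst m"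
  have X: "centered_prod (add_mset i \<alpha>) \<omega> * (inv_prod \<beta> \<omega> * Yprod m {#} \<omega>)
      = ?X (add_mset (i, False) m) \<omega> - (1 / 2) * ?X m \<omega>" for \<omega>
    by (simp add: centered_prod_def Yprod_def algebra_simps)
  have int: "integrable N (?X m)" for m using add.IH by blast
  have "(\<integral>\<omega>. ?X (add_mset (i, False) m) \<omega> - (1 / 2) * ?X m \<omega> \<partial>N)
      = (\<integral>\<omega>. ?X (add_mset (i, False) m) \<omega> \<partial>N) - (1 / 2) * (\<integral>\<omega>. ?X m \<omega> \<partial>N)"
    using int by (subst Bochner_Integration.integral_diff) (auto simp del: times_divide_eq_left)
  also have "\<dots> = \<Lambda> (heads_num (i, False) * ?a) (add_mset i ?k) - (1 / 2) * \<Lambda> ?a ?k"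
    using add.IH by (simp add: ac_simps)
  also have "\<Lambda> ?a ?k = \<Lambda> ((1 + (g i)\<^sup>2) * ?a) (add_mset i ?k)" by (rule cancel1_\<Lambda>[symmetric])
  also have "\<Lambda> (heads_num (i, False) * ?a) (add_mset i ?k) - (1 / 2) * \<Lambda> ((1 + (g i)\<^sup>2) * ?a) (add_mset i ?k)
      = \<Lambda> (heads_num (i, False) * ?a - (1 / 2) *\<^sub>R ((1 + (g i)\<^sup>2) * ?a)) (add_mset i ?k)"
    by (simp add: \<Lambda>_simps)
  also have "heads_num (i, False) * ?a - (1 / 2) *\<^sub>R ((1 + (g i)\<^sup>2) * ?a) = g i * ?a"
  proof -
    have "(1 + g i)\<^sup>2 = 1 + (g i)\<^sup>2 + 2 *\<^sub>R g i" by (simp add: power2_eq_square algebra_simps scaleR_2)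
    then have "heads_num (i, False) = (1 / 2) *\<^sub>R (1 + (g i)\<^sup>2) + g i"
      by (simp add: heads_num_def scaleR_add_right)
    then show ?thesis by (simp add: distrib_right)
  qed
  finally show ?case unfolding X using int by (simp add: ac_simps)
qed

theorem coordinate_moment:
  "integrable N (\<lambda>\<omega>. \<Prod>i\<in>#\<alpha>. (Y (i, False) \<omega> - 1 / 2) / Y (i, True) \<omega>)
    \<and> (\<integral>\<omega>. (\<Prod>i\<in>#\<alpha>. (Y (i, False) \<omega> - 1 / 2) / Y (i, True) \<omega>) \<partial>N) = L (\<Prod>i\<in>#\<alpha>. g i)"
proof -
  have "(\<Prod>i\<in>#\<alpha>. (Y (i, False) \<omega> - 1 / 2) / Y (i, True) \<omega>)
      = centered_prod \<alpha> \<omega> * (inv_prod \<alpha> \<omega> * Yprod {#} {#} \<omega>)" for \<omega>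
    by (induction \<alpha>) (simp_all add: centered_prod_def inv_prod_def Yprod_def)
  \<comment> \<open>With \<open>\<beta> = \<alpha>\<close> the factor \<open>den \<alpha>\<close>
    cancels the denominator, and the fraction is an element of the algebra.\<close>
  then show ?thesis
    using centered_moment[of \<alpha> \<alpha> "{#}"] cancel_\<Lambda>[of \<alpha> "\<Prod>i\<in>#\<alpha>. g i" "{#}"] by (simp add: \<Lambda>_L)
qed

end

end

theorem (in positive_cone) coordinates:
  obtains N :: "(('i \<times> bool) \<times> nat \<Rightarrow> real) measure" and T :: "'i \<Rightarrow> (('i \<times> bool) \<times> nat \<Rightarrow> real) \<Rightarrow> real"
  where "prob_space N" "\<And>i. T i \<in> borel_measurable N"
    "\<And>\<alpha>. integrable N (\<lambda>\<omega>. \<Prod>i\<in>#\<alpha>. T i \<omega>)"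
    "\<And>\<alpha>. (\<integral>\<omega>. (\<Prod>i\<in>#\<alpha>. T i \<omega>) \<partial>N) = L (\<Prod>i\<in>#\<alpha>. g i)"
proof -
  obtain \<Lambda> where \<Lambda>: "\<And>m. linear (\<lambda>a. \<Lambda> a m)" "\<And>a m n. \<Lambda> (den n * a) (m + n) = \<Lambda> a m"
    "\<And>a. \<Lambda> a {#} = L a" "\<And>a m. a \<in> P \<Longrightarrow> 0 \<le> \<Lambda> a m"
    by (rule extension_to_fractions) blast
  interpret fraction_functional L P g \<Lambda>
    by (rule fraction_functional.intro[OF positive_cone_axioms fraction_functional_axioms.intro[OF \<Lambda>]])
  interpret H: hausdorff_moments "\<Psi> {#}"
    by unfold_locales (simp_all add: \<Psi>_nonneg \<Psi>_one \<Psi>_split)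
  obtain N :: "(('i \<times> bool) \<times> nat \<Rightarrow> real) measure" and Y
    where N: "prob_space N" and Y [measurable]: "\<And>x. Y x \<in> borel_measurable N"
      and Y': "\<And>x \<omega>. Y x \<omega> \<in> {0..1}"
      "\<And>m n. (\<integral>\<omega>. (\<Prod>x\<in>#m. Y x \<omega>) * (\<Prod>x\<in>#n. 1 - Y x \<omega>) \<partial>N) = \<Psi> {#} m n"
    by (rule H.solution) blast
  show thesis
  proof (rule that[OF N, of "\<lambda>i \<omega>. (Y (i, False) \<omega> - 1 / 2) / Y (i, True) \<omega>"])
    show "(\<lambda>\<omega>. (Y (i, False) \<omega> - 1 / 2) / Y (i, True) \<omega>) \<in> borel_measurable N" for i by measurable
  qed (use coordinate_moment[OF N Y Y'] in blast)+
qed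

section \<open>Characters of the symmetric algebra\<close>

lemma char_ext_hom:
  assumes "linear \<xi>"
  shows "alg_hom (char_ext \<xi>)" "char_ext \<xi> (sym_incl v) = \<xi> v"
  using theI'[OF sym_alg_universal[OF assms]] unfolding char_ext_def by auto

lemma char_ext_simps:
  assumes "linear \<xi>"
  shows "char_ext \<xi> (a + b) = char_ext \<xi> a + char_ext \<xi> b" "char_ext \<xi> (r *\<^sub>R a) = r * char_ext \<xi> a"
    "char_ext \<xi> 1 = 1" "char_ext \<xi> (a * b) = char_ext \<xi> a * char_ext \<xi> b" "char_ext \<xi> 0 = 0"
    "char_ext \<xi> (a\<^sup>2) = (char_ext \<xi> a)\<^sup>2"
  using char_ext_hom(1)[OF assms] unfolding alg_hom_def
  by (auto simp: linear_add linear_scale linear_0 power2_eq_square)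

lemma char_ext_prod_mset:
  assumes "linear \<xi>"
  shows "char_ext \<xi> (\<Prod>i\<in>#\<alpha>. f i) = (\<Prod>i\<in>#\<alpha>. char_ext \<xi> (f i))"
  by (induction \<alpha>) (simp_all add: char_ext_simps[OF assms])

text \<open>A representing term exhibits f as a polynomial in finitely many vectors. Measurability
  of \<open>char_ext \<xi> f\<close>, its cylindrical form and the later change on null sets all
  rest on this.\<close>

lemma char_ext_term:
  assumes "linear \<xi>"
  shows "char_ext \<xi> (abs_sym_alg \<tau>) = term_eval \<xi> \<tau>"
  by (induction \<tau>)
    (simp_all add: char_ext_simps[OF assms] char_ext_hom[OF assms] sym_const sym_incl.abs_eq[symmetric]
      plus_sym_alg.abs_eq[symmetric] times_sym_alg.abs_eq[symmetric])

lemma abs_sym_alg_cases: obtains \<tau> where "f = abs_sym_alg \<tau>"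
  using Quotient3_abs_rep[OF Quotient3_sym_alg, of f] by metis

lemma term_eval_gens_cong:
  "(\<And>v. v \<in> set_sym_term \<tau> \<Longrightarrow> \<xi> v = \<eta> v) \<Longrightarrow> term_eval \<xi> \<tau> = term_eval \<eta> \<tau>"
  by (induction \<tau>) auto

lemma finite_set_sym_term: "finite (set_sym_term \<tau>)"
  by (induction \<tau>) auto

lemma borel_measurable_term_eval:
  fixes X :: "'w \<Rightarrow> 'v \<Rightarrow> real"
  assumes "\<And>v. v \<in> set_sym_term \<tau> \<Longrightarrow> (\<lambda>\<omega>. X \<omega> v) \<in> borel_measurable M"
  shows "(\<lambda>\<omega>. term_eval (X \<omega>) \<tau>) \<in> borel_measurable M"
  using assms by (induction \<tau>) auto

lemma span_mult_closed:
  fixes A :: "'a::real_algebra set"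
  assumes "\<And>a b. a \<in> A \<Longrightarrow> b \<in> A \<Longrightarrow> a * b \<in> span A" "x \<in> span A" "y \<in> span A"
  shows "x * y \<in> span A"
  using assms(2)
proof (induction rule: span_induct_alt)
  case base
  then show ?case by (simp add: span_zero)
next
  case (step c a z)
  have "a * y \<in> span A"
    using assms(3)
  proof (induction rule: span_induct_alt)
    case base
    then show ?case by (simp add: span_zero)
  next
    case (step d b w)
    then show ?case using assms(1)[OF \<open>a \<in> A\<close>] by (simp add: distrib_left span_add span_scale)
  qed
  then show ?case using step by (simp add: distrib_right span_add span_scale)
qed

lemma span_monomials:
  assumes "span S = UNIV"
  shows "f \<in> span {\<Prod>i\<in>#\<alpha>. sym_incl i |\<alpha>. set_mset \<alpha> \<subseteq> S}"
proof -
  let ?M = "{\<Prod>i\<in>#\<alpha>. sym_incl i |\<alpha>. set_mset \<alpha> \<subseteq> S}"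
  have one: "1 \<in> ?M" by (auto intro!: exI[of _ "{#}"])
  have mult: "a * b \<in> span ?M" if ab: "a \<in> ?M" "b \<in> ?M" for a b
  proof -
    obtain \<alpha> \<beta> where "a = (\<Prod>i\<in>#\<alpha>. sym_incl i)" "b = (\<Prod>i\<in>#\<beta>. sym_incl i)"
      and "set_mset \<alpha> \<subseteq> S" "set_mset \<beta> \<subseteq> S" using ab by auto
    then have "a * b = (\<Prod>i\<in>#\<alpha> + \<beta>. sym_incl i)" "set_mset (\<alpha> + \<beta>) \<subseteq> S" by auto
    then show ?thesis by (intro span_base) blast
  qed
  have gen: "sym_incl v \<in> span ?M" for v
  proof -
    have "v \<in> span S" using assms by simp
    then show ?thesis
    proof (induction rule: span_induct_alt)
      case base
      then show ?case by (simp add: span_zero linear_0[OF linear_sym_incl])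
    next
      case (step c x y)
      then have "sym_incl x = (\<Prod>i\<in>#{#x#}. sym_incl i)" "set_mset {#x#} \<subseteq> S" by auto
      then have "sym_incl x \<in> span ?M" by (intro span_base) blast
      then show ?case using step
        by (simp add: linear_add[OF linear_sym_incl] linear_scale[OF linear_sym_incl] span_add span_scale)
    qed
  qed
  obtain \<tau> where "f = abs_sym_alg \<tau>" by (rule abs_sym_alg_cases)
  moreover have "abs_sym_alg \<tau> \<in> span ?M"
  proof (induction \<tau>)
    case (SGen v)
    then show ?case using gen by (simp add: sym_incl.abs_eq)
  next
    case (SConst r)
    then show ?case using one by (simp add: sym_const span_scale span_base)
  next
    case (SAdd a b)
    then show ?case by (simp add: plus_sym_alg.abs_eq[symmetric] span_add)
  next
    case (SMul a b)
    then show ?case using span_mult_closed[OF mult] by (simp add: times_sym_alg.abs_eq[symmetric])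
  qed
  ultimately show ?thesis by simp
qed

lemma carleman_at_sym_incl:
  assumes "carleman L t"
  shows "carleman_at L (sym_incl t)"
proof (rule ccontr)
  define m where "m n = L (sym_incl t ^ (2 * Suc n))" for n
  assume "\<not> carleman_at L (sym_incl t)"
  then have m: "m n \<noteq> 0" "summable (\<lambda>n. m n powr (- 1 / (2 * real (Suc n))))" for n
    unfolding carleman_at_def m_def by blast+
  have "(\<Sum>n. ennreal (m n powr (- 1 / (2 * real (Suc n))))) \<noteq> \<infinity>"
    using m(2) by (subst suminf_ennreal2) auto
  moreover have "(\<Sum>n. ennreal (m n powr (- 1 / (2 * real (Suc n))))) = \<infinity>"
    using assms m(1) unfolding carleman_def m_def[symmetric] Let_def by simp
  ultimately show False by simp
qed

text \<open>The index type of \<open>positive_cone\<close> is all of \<open>'v\<close>, while the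
  basis is a subset. The remaining indices get the element 0, for which 1 + 0^2 = 1 makes division
  trivial.\<close>

definition coordinate :: "'v::real_vector set \<Rightarrow> 'v \<Rightarrow> 'v sym_alg" where
  "coordinate S s = (if s \<in> S then sym_incl s else 0)"

lemma positive_cone_sym_alg:
  fixes S :: "'v::real_vector set" and L :: "'v sym_alg \<Rightarrow> real"
  assumes L: "linear L" "L 1 = 1"
    and cond: "(\<forall>a\<in>sym_pos. 0 \<le> L a) \<or> ((\<forall>a. 0 \<le> L (a\<^sup>2)) \<and> (\<forall>t\<in>S. carleman L t))"
  shows "\<exists>P. positive_cone L P (coordinate S)"
  using cond
proof
  assume pos: "\<forall>a\<in>sym_pos. 0 \<le> L a"
  have "positive_cone L sym_pos (coordinate S)"
  proof (rule positive_cone.intro)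
    fix a b :: "'v sym_alg" and i
    show "a \<in> sym_pos" if "(1 + (coordinate S i)\<^sup>2) * a \<in> sym_pos"
      unfolding sym_pos_def
    proof (intro CollectI ballI)
      fix \<xi> :: "'v \<Rightarrow> real" assume "\<xi> \<in> alg_dual"
      then have lin: "linear \<xi>" and "0 \<le> char_ext \<xi> ((1 + (coordinate S i)\<^sup>2) * a)"
        using that by (auto simp: alg_dual_def sym_pos_def)
      then have "0 \<le> (1 + (char_ext \<xi> (coordinate S i))\<^sup>2) * char_ext \<xi> a" by (simp add: char_ext_simps)
      moreover have "0 < 1 + (char_ext \<xi> (coordinate S i))\<^sup>2" by (simp add: add_pos_nonneg)
      ultimately show "0 \<le> char_ext \<xi> a" by (simp add: zero_le_mult_iff)
    qed
  qed (use L pos in \<open>auto simp: sym_pos_def alg_dual_def char_ext_simps\<close>)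
  then show ?thesis by blast
next
  assume *: "(\<forall>a. 0 \<le> L (a\<^sup>2)) \<and> (\<forall>t\<in>S. carleman L t)"
  interpret psd_functional L using L(1) * by (intro psd_functional.intro) auto
  have "positive_cone L {a. \<forall>b. 0 \<le> L (a * b\<^sup>2)} (coordinate S)"
  proof (rule positive_cone.intro)
    fix a b :: "'v sym_alg" and i
    show "a \<in> {a. \<forall>b. 0 \<le> L (a * b\<^sup>2)}" if "(1 + (coordinate S i)\<^sup>2) * a \<in> {a. \<forall>b. 0 \<le> L (a * b\<^sup>2)}"
      using that positive_division[OF L(2) carleman_at_sym_incl] *
      by (cases "i \<in> S") (auto simp: coordinate_def)
    show "a * b\<^sup>2 \<in> {a. \<forall>b. 0 \<le> L (a * b\<^sup>2)}" if "a \<in> {a. \<forall>b. 0 \<le> L (a * b\<^sup>2)}"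
      using that by (simp add: mult.assoc flip: power_mult_distrib)
    show "0 \<le> L a" if "a \<in> {a. \<forall>b. 0 \<le> L (a * b\<^sup>2)}"
      using spec[of "\<lambda>b. 0 \<le> L (a * b\<^sup>2)" 1] that by simp
  qed (use L * in \<open>auto simp: distrib_right L_simps\<close>)
  then show ?thesis by blast
qed

text \<open>Arbitrary values on a basis extend linearly, so \<open>X \<omega>\<close> is linear for
  every outcome. Measurability of a single \<open>X \<omega> v\<close> involves only finitely many
  basis vectors, and the moments are compared on monomials, which span the algebra.\<close>

theorem random_linear_functional:
  fixes S :: "'v::real_vector set" and L :: "'v sym_alg \<Rightarrow> real"
  assumes basis: "independent S" "span S = UNIV"
    and L: "linear L" "L 1 = 1"
    and cond: "(\<forall>a\<in>sym_pos. 0 \<le> L a) \<or> ((\<forall>a. 0 \<le> L (a\<^sup>2)) \<and> (\<forall>t\<in>S. carleman L t))"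
  obtains N :: "(('v \<times> bool) \<times> nat \<Rightarrow> real) measure" and X
  where "prob_space N" "\<And>\<omega>. linear (X \<omega>)" "\<And>v. (\<lambda>\<omega>. X \<omega> v) \<in> borel_measurable N"
    "\<And>f. integrable N (\<lambda>\<omega>. char_ext (X \<omega>) f)" "\<And>f. (\<integral>\<omega>. char_ext (X \<omega>) f \<partial>N) = L f"
proof -
  obtain P where "positive_cone L P (coordinate S)"
    using positive_cone_sym_alg[OF L cond] by blast
  then interpret positive_cone L P "coordinate S" .
  obtain N :: "(('v \<times> bool) \<times> nat \<Rightarrow> real) measure" and T
    where N: "prob_space N" and T: "\<And>i. T i \<in> borel_measurable N"
    "\<And>\<alpha>. integrable N (\<lambda>\<omega>. \<Prod>i\<in>#\<alpha>. T i \<omega>)"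
    "\<And>\<alpha>. (\<integral>\<omega>. (\<Prod>i\<in>#\<alpha>. T i \<omega>) \<partial>N) = L (\<Prod>i\<in>#\<alpha>. coordinate S i)"
    by (rule coordinates) blast
  define X where "X \<omega> = construct S (\<lambda>s. T s \<omega>)" for \<omega>
  have lin_X: "linear (X \<omega>)" for \<omega>
    unfolding X_def by (rule real_vector.linear_construct[OF basis(1)])
  have X_basis: "X \<omega> s = T s \<omega>" if "s \<in> S" for \<omega> s
    unfolding X_def by (rule real_vector.construct_basis[OF basis(1) that])
  have meas: "(\<lambda>\<omega>. X \<omega> v) \<in> borel_measurable N" for v
  proof -
    have "v \<in> span S" using basis by simp
    then show ?thesis
    proof (induction rule: span_induct_alt)
      case base
      then show ?case by (simp add: linear_0[OF lin_X])
    next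
      case (step c x y)
      then show ?case using T(1) X_basis
        by (simp add: linear_add[OF lin_X] linear_scale[OF lin_X])
    qed
  qed
  have moments: "integrable N (\<lambda>\<omega>. char_ext (X \<omega>) f) \<and> (\<integral>\<omega>. char_ext (X \<omega>) f \<partial>N) = L f" for f
    using span_monomials[OF basis(2), of f]
  proof (induction rule: span_induct_alt)
    case base
    then show ?case by (simp add: char_ext_simps[OF lin_X] L_simps)
  next
    case (step c a b)
    then obtain \<alpha> where a: "a = (\<Prod>i\<in>#\<alpha>. sym_incl i)" and \<alpha>: "set_mset \<alpha> \<subseteq> S" by blast
    have eq: "char_ext (X \<omega>) a = (\<Prod>i\<in>#\<alpha>. T i \<omega>)" for \<omega>
    proof -
      have "char_ext (X \<omega>) a = (\<Prod>i\<in>#\<alpha>. X \<omega> i)"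
        unfolding a by (simp add: char_ext_prod_mset[OF lin_X] char_ext_hom[OF lin_X])
      also have "\<dots> = (\<Prod>i\<in>#\<alpha>. T i \<omega>)"
        using \<alpha> X_basis by (intro arg_cong[where f = prod_mset] image_mset_cong) auto
      finally show ?thesis .
    qed
    have "(\<Prod>i\<in>#\<alpha>. coordinate S i) = a"
      unfolding a using \<alpha> by (intro arg_cong[where f = prod_mset] image_mset_cong) (auto simp: coordinate_def)
    then have "integrable N (\<lambda>\<omega>. char_ext (X \<omega>) a) \<and> (\<integral>\<omega>. char_ext (X \<omega>) a \<partial>N) = L a"
      unfolding eq using T(2,3)[of \<alpha>] by simp
    then show ?case using step by (simp add: char_ext_simps[OF lin_X] L_simps)
  qed
  show thesis using that[of N X] N lin_X meas moments by blast
qed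

section \<open>Cylinder sets\<close>

text \<open>Common to \<open>alg_dual\<close> and \<open>top_dual T\<close>, so that both parts of
  the theorem share one treatment of cylinder sets.\<close>

locale dual_space =
  fixes D :: "('v::real_vector \<Rightarrow> real) set"
  assumes linear_D: "l \<in> D \<Longrightarrow> linear l" and zero_D: "(\<lambda>_. 0) \<in> D"
    and add_D: "l \<in> D \<Longrightarrow> m \<in> D \<Longrightarrow> (\<lambda>v. l v + m v) \<in> D"
    and diff_D: "l \<in> D \<Longrightarrow> m \<in> D \<Longrightarrow> (\<lambda>v. l v - m v) \<in> D"
begin

lemma dual_coset_eq_iff:
  assumes "l \<in> D" "m \<in> D"
  shows "dual_coset D F l = dual_coset D F m \<longleftrightarrow> (\<forall>f\<in>F. l f = m f)"
proof
  assume eq: "dual_coset D F l = dual_coset D F m"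
  have "l \<in> dual_coset D F l"
    using zero_D by (auto simp: dual_coset_def annihilator_def image_def intro!: bexI[of _ "\<lambda>_. 0"])
  then have "l \<in> dual_coset D F m" by (simp only: eq)
  then show "\<forall>f\<in>F. l f = m f" by (auto simp: dual_coset_def annihilator_def)
next
  have sub: "dual_coset D F l \<subseteq> dual_coset D F m"
    if lm: "l \<in> D" "m \<in> D" "\<forall>f\<in>F. l f = m f" for l m
  proof
    fix k assume "k \<in> dual_coset D F l"
    then obtain a where a: "a \<in> D" "\<forall>f\<in>F. a f = 0" "k = (\<lambda>v. l v + a v)"
      by (auto simp: dual_coset_def annihilator_def)
    have "(\<lambda>v. l v - m v + a v) \<in> annihilator D F"
      using a lm add_D[OF diff_D[OF lm(1,2)] a(1)] by (auto simp: annihilator_def)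
    moreover have "k = (\<lambda>v. m v + (l v - m v + a v))" using a(3) by auto
    ultimately show "k \<in> dual_coset D F m"
      unfolding dual_coset_def by (intro image_eqI[where x = "\<lambda>v. l v - m v + a v"])
  qed
  assume "\<forall>f\<in>F. l f = m f"
  then show "dual_coset D F l = dual_coset D F m"
    using sub[of l m] sub[of m l] assms by auto
qed

lemma open_dual_quot_subset: "openin (dual_quot_topology D F) U \<Longrightarrow> U \<subseteq> dual_quot D F"
  using openin_subset[of "dual_quot_topology D F" U]
  by (auto simp: dual_quot_topology_def dual_quot_def)

lemma dual_quot_borel_Pow: "dual_quot_borel D F \<subseteq> Pow (dual_quot D F)"
  using sigma_sets_into_sp[of "{U. openin (dual_quot_topology D F) U}" "dual_quot D F"]
    open_dual_quot_subset by (auto simp: dual_quot_borel_def)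

text \<open>Open sets are arbitrary unions, so measurability cannot be checked on the generators of
  the topology alone. Passing to sequence space turns them into Borel sets of a product, where
  measurability is coordinatewise. The vector 0 keeps the enumerated set nonempty.\<close>

lemma open_dual_quot_coordinates:
  assumes F: "F = span B" "finite B" and U: "openin (dual_quot_topology D F) U"
  shows "\<exists>W :: (nat \<Rightarrow> real) set. open W \<and>
    (\<forall>l\<in>D. dual_coset D F l \<in> U \<longleftrightarrow> (\<lambda>n. l (from_nat_into (insert 0 B) n)) \<in> W)"
proof -
  let ?e = "from_nat_into (insert 0 B)"
  let ?S = "{dual_coset D F ` {l \<in> D. l f \<in> V} |f V. f \<in> F \<and> open V}"
  have "generate_topology_on ?S U"
    using U unfolding dual_quot_topology_def by (rule openin_topology_generated_by)
  then show ?thesis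
  proof (induction rule: generate_topology_on.induct)
    case Empty
    then show ?case by (intro exI[of _ "{}"]) auto
  next
    case (Int a b)
    then obtain V W where "open V" "open W"
      "\<forall>l\<in>D. dual_coset D F l \<in> a \<longleftrightarrow> (\<lambda>n. l (?e n)) \<in> V"
      "\<forall>l\<in>D. dual_coset D F l \<in> b \<longleftrightarrow> (\<lambda>n. l (?e n)) \<in> W" by blast
    then show ?case by (intro exI[of _ "V \<inter> W"]) auto
  next
    case (UN K)
    then have "\<forall>k\<in>K. \<exists>W. open W \<and> (\<forall>l\<in>D. dual_coset D F l \<in> k \<longleftrightarrow> (\<lambda>n. l (?e n)) \<in> W)" by blast
    then obtain W where "\<forall>k\<in>K. open (W k) \<and> (\<forall>l\<in>D. dual_coset D F l \<in> k \<longleftrightarrow> (\<lambda>n. l (?e n)) \<in> W k)"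
      by metis
    then show ?case by (intro exI[of _ "\<Union>k\<in>K. W k"]) auto
  next
    case (Basis s)
    then obtain f V where s: "s = dual_coset D F ` {l \<in> D. l f \<in> V}" and f: "f \<in> F" and V: "open V" by blast
    obtain c where c: "f = (\<Sum>b\<in>B. c b *\<^sub>R b)"
      using f F by (auto simp: span_finite)
    \<comment> \<open>An index at which the enumeration takes the value \<open>b\<close>, so that
      l(f) is a finite combination of coordinates of the sequence.\<close>
    define k where "k b = (SOME n. ?e n = b)" for b
    have k: "?e (k b) = b" if "b \<in> B" for b
    proof -
      have "\<exists>n. ?e n = b"
        using from_nat_into_surj[of "insert 0 B" b] F(2) that by (auto simp: countable_finite)
      then show ?thesis unfolding k_def by (rule someI_ex)
    qed
    have lf: "l f = (\<Sum>b\<in>B. c b * l (?e (k b)))" if "l \<in> D" for l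
      using linear_D[OF that] k by (simp add: c linear_sum linear_scale cong: sum.cong)
    define W where "W = (\<lambda>x. \<Sum>b\<in>B. c b * x (k b)) -` V"
    have "continuous_on UNIV (\<lambda>x :: nat \<Rightarrow> real. \<Sum>b\<in>B. c b * x (k b))"
      by (intro continuous_intros continuous_on_product_coordinates)
    then have "open W" unfolding W_def using V by (simp add: open_vimage)
    moreover have "dual_coset D F l \<in> s \<longleftrightarrow> l f \<in> V" if "l \<in> D" for l
    proof
      assume "dual_coset D F l \<in> s"
      then obtain m where "m \<in> D" "m f \<in> V" "dual_coset D F l = dual_coset D F m" by (auto simp: s)
      then show "l f \<in> V" using dual_coset_eq_iff[OF that, of m F] f by auto
    qed (use that s in blast)
    ultimately show ?case using lf by (intro exI[of _ W]) (simp add: W_def)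
  qed
qed

end

section \<open>The law of a random functional as a cylinder measure\<close>

locale random_functional = dual_space D + prob_space N
  for D :: "('v::real_vector \<Rightarrow> real) set" and N :: "'w measure" +
  fixes X :: "'w \<Rightarrow> 'v \<Rightarrow> real"
  assumes X_D: "X \<omega> \<in> D" and X_meas: "(\<lambda>\<omega>. X \<omega> v) \<in> borel_measurable N"
begin

definition cyl_sigma :: "'v set \<Rightarrow> ('v \<Rightarrow> real) set measure" where
  "cyl_sigma F = sigma (dual_quot D F) {U. openin (dual_quot_topology D F) U}"

lemma space_cyl_sigma: "space (cyl_sigma F) = dual_quot D F"
  and sets_cyl_sigma: "sets (cyl_sigma F) = dual_quot_borel D F"
proof -
  have "{U. openin (dual_quot_topology D F) U} \<subseteq> Pow (dual_quot D F)"
    using open_dual_quot_subset by blast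
  then show "space (cyl_sigma F) = dual_quot D F" "sets (cyl_sigma F) = dual_quot_borel D F"
    by (simp_all add: cyl_sigma_def dual_quot_borel_def)
qed

lemma coset_measurable:
  assumes "fin_dim_subspace F"
  shows "(\<lambda>\<omega>. dual_coset D F (X \<omega>)) \<in> measurable N (cyl_sigma F)"
  unfolding cyl_sigma_def
proof (rule measurable_measure_of)
  show "{U. openin (dual_quot_topology D F) U} \<subseteq> Pow (dual_quot D F)"
    using open_dual_quot_subset by blast
  show "(\<lambda>\<omega>. dual_coset D F (X \<omega>)) \<in> space N \<rightarrow> dual_quot D F"
    using X_D by (auto simp: dual_quot_def)
  fix U assume "U \<in> {U. openin (dual_quot_topology D F) U}"
  moreover obtain B where B: "finite B" "F = span B" using assms by (auto simp: fin_dim_subspace_def)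
  ultimately obtain W :: "(nat \<Rightarrow> real) set" where W: "open W"
    "\<forall>l\<in>D. dual_coset D F l \<in> U \<longleftrightarrow> (\<lambda>n. l (from_nat_into (insert 0 B) n)) \<in> W"
    using open_dual_quot_coordinates by blast
  have "(\<lambda>\<omega>. \<lambda>n. X \<omega> (from_nat_into (insert 0 B) n)) \<in> borel_measurable N"
    by (intro measurable_coordinatewise_then_product X_meas)
  then have "(\<lambda>\<omega>. \<lambda>n. X \<omega> (from_nat_into (insert 0 B) n)) -` W \<inter> space N \<in> sets N"
    using W(1) by (intro measurable_sets) auto
  moreover have "(\<lambda>\<omega>. dual_coset D F (X \<omega>)) -` U \<inter> space N
      = (\<lambda>\<omega>. \<lambda>n. X \<omega> (from_nat_into (insert 0 B) n)) -` W \<inter> space N"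
    using W(2) X_D by auto
  ultimately show "(\<lambda>\<omega>. dual_coset D F (X \<omega>)) -` U \<inter> space N \<in> sets N" by simp
qed

lemma cyl_set_vimage:
  assumes "fin_dim_subspace F" "C \<in> cyl_sets_over D F"
  shows "X -` C \<inter> space N \<in> sets N"
proof -
  obtain M where M: "M \<in> dual_quot_borel D F" "C = cyl_set D F M"
    using assms(2) by (auto simp: cyl_sets_over_def)
  have "X -` C \<inter> space N = (\<lambda>\<omega>. dual_coset D F (X \<omega>)) -` M \<inter> space N"
    using X_D by (auto simp: M cyl_set_def)
  then show ?thesis
    using measurable_sets[OF coset_measurable[OF assms(1)]] M(1) by (simp add: sets_cyl_sigma)
qed

definition cyl_law :: "('v \<Rightarrow> real) set \<Rightarrow> real" where
  "cyl_law C = prob (X -` C \<inter> space N)"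

lemma cylinder_measure_cyl_law: "cylinder_measure D cyl_law"
  unfolding cylinder_measure_def
proof (intro conjI ballI allI impI)
  show "cyl_law D = 1"
    using X_D by (simp add: cyl_law_def prob_space vimage_def)
  fix F and C :: "nat \<Rightarrow> ('v \<Rightarrow> real) set"
  assume FC: "fin_dim_subspace F \<and> (\<forall>n. C n \<in> cyl_sets_over D F) \<and> disjoint_family C"
  have "(\<lambda>n. prob (X -` C n \<inter> space N)) sums prob (\<Union>n. X -` C n \<inter> space N)"
  proof (rule finite_measure_UNION)
    show "range (\<lambda>n. X -` C n \<inter> space N) \<subseteq> sets N" using FC cyl_set_vimage by auto
    show "disjoint_family (\<lambda>n. X -` C n \<inter> space N)" using FC unfolding disjoint_family_on_def by blast
  qed
  moreover have "(\<Union>n. X -` C n \<inter> space N) = X -` (\<Union>n. C n) \<inter> space N" by auto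
  ultimately show "(\<lambda>n. cyl_law (C n)) sums cyl_law (\<Union>n. C n)" by (simp add: cyl_law_def)
qed (simp_all add: cyl_law_def)

lemma cyl_marginal_eq_distr:
  assumes "fin_dim_subspace F"
  shows "cyl_marginal D cyl_law F = distr N (cyl_sigma F) (\<lambda>\<omega>. dual_coset D F (X \<omega>))"
proof -
  let ?R = "distr N (cyl_sigma F) (\<lambda>\<omega>. dual_coset D F (X \<omega>))"
  have "cyl_marginal D cyl_law F = measure_of (dual_quot D F) (dual_quot_borel D F) (emeasure ?R)"
    unfolding cyl_marginal_def
  proof (rule measure_of_eq[OF dual_quot_borel_Pow])
    fix M assume "M \<in> sigma_sets (dual_quot D F) (dual_quot_borel D F)"
    then have M: "M \<in> sets (cyl_sigma F)"
      using sets.sigma_sets_eq[of "cyl_sigma F"] by (simp add: sets_cyl_sigma space_cyl_sigma)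
    have "X -` cyl_set D F M \<inter> space N = (\<lambda>\<omega>. dual_coset D F (X \<omega>)) -` M \<inter> space N"
      using X_D by (auto simp: cyl_set_def)
    then show "ennreal (cyl_law (cyl_set D F M)) = emeasure ?R M"
      using M by (simp add: emeasure_distr[OF coset_measurable[OF assms]] cyl_law_def emeasure_eq_measure)
  qed
  also have "\<dots> = measure_of (space ?R) (sets ?R) (emeasure ?R)"
    by (simp add: space_cyl_sigma sets_cyl_sigma)
  also have "\<dots> = ?R" by (rule measure_of_of_measure)
  finally show ?thesis .
qed

text \<open>Every marginal is the law of a coset of \<open>X\<close>, so each representation gives
  the same expectation on \<open>N\<close>. This is the uniqueness behind the description in
  \<open>cyl_integral\<close>.\<close>

lemma cyl_representation_integral:
  assumes "cyl_representation D cyl_law f F h"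
  shows "integral\<^sup>L (cyl_marginal D cyl_law F) h = (\<integral>\<omega>. f (X \<omega>) \<partial>N)"
proof -
  have F: "fin_dim_subspace F" and f: "\<forall>l\<in>D. f l = h (dual_coset D F l)"
    and int: "integrable (cyl_marginal D cyl_law F) h"
    using assms by (auto simp: cyl_representation_def)
  have h: "h \<in> borel_measurable (cyl_sigma F)"
    using int by (auto simp: cyl_marginal_eq_distr[OF F] dest: borel_measurable_integrable)
  have "integral\<^sup>L (cyl_marginal D cyl_law F) h = (\<integral>\<omega>. h (dual_coset D F (X \<omega>)) \<partial>N)"
    unfolding cyl_marginal_eq_distr[OF F] by (rule integral_distr[OF coset_measurable[OF F] h])
  then show ?thesis using f X_D by simp
qed

lemma cyl_integral_eq:
  assumes "cyl_integrable D cyl_law f"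
  shows "cyl_integral D cyl_law f = (\<integral>\<omega>. f (X \<omega>) \<partial>N)"
  unfolding cyl_integral_def
proof (rule the_equality)
  obtain F h where rep: "cyl_representation D cyl_law f F h" using assms by (auto simp: cyl_integrable_def)
  show "\<exists>F h. cyl_representation D cyl_law f F h \<and> (\<integral>\<omega>. f (X \<omega>) \<partial>N) = integral\<^sup>L (cyl_marginal D cyl_law F) h"
    using rep cyl_representation_integral[OF rep] by (intro exI[of _ F] exI[of _ h]) simp
qed (use cyl_representation_integral in blast)

text \<open>The generating subspace is spanned by the vectors occurring in a term for f, and the
  base function evaluates the term at a representative of the coset.\<close>

lemma cyl_representation_char_ext:
  assumes "integrable N (\<lambda>\<omega>. char_ext (X \<omega>) f)"
  shows "cyl_integrable D cyl_law (\<lambda>\<xi>. char_ext \<xi> f)"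
proof -
  obtain \<tau> where \<tau>: "f = abs_sym_alg \<tau>" by (rule abs_sym_alg_cases)
  define F where "F = span (set_sym_term \<tau>)"
  have F: "fin_dim_subspace F" unfolding F_def fin_dim_subspace_def using finite_set_sym_term by blast
  \<comment> \<open>An arbitrary representative of the coset; its values on \<open>F\<close> do not
    depend on the choice, and only these are used.\<close>
  define rep where "rep c = (SOME l. l \<in> D \<and> dual_coset D F l = c)" for c
  have rep: "rep (dual_coset D F l) v = l v" if "l \<in> D" "v \<in> F" for l v
  proof -
    have "rep (dual_coset D F l) \<in> D \<and> dual_coset D F (rep (dual_coset D F l)) = dual_coset D F l"
      unfolding rep_def by (rule someI[of _ l]) (use that in simp)
    then show ?thesis using dual_coset_eq_iff[OF _ that(1)] that(2) by blast
  qed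
  have rep_meas: "(\<lambda>c. rep c v) \<in> borel_measurable (cyl_sigma F)" if v: "v \<in> F" for v
  proof (rule borel_measurableI)
    fix V :: "real set" assume "open V"
    have "(\<lambda>c. rep c v) -` V \<inter> space (cyl_sigma F) = dual_coset D F ` {l \<in> D. l v \<in> V}"
      using rep[OF _ v] by (auto simp: space_cyl_sigma dual_quot_def)
    moreover have "openin (dual_quot_topology D F) (dual_coset D F ` {l \<in> D. l v \<in> V})"
      unfolding dual_quot_topology_def using v \<open>open V\<close> by (intro topology_generated_by_Basis) blast
    ultimately show "(\<lambda>c. rep c v) -` V \<inter> space (cyl_sigma F) \<in> sets (cyl_sigma F)"
      by (simp add: sets_cyl_sigma dual_quot_borel_def sigma_sets.Basic)
  qed
  define h where "h c = term_eval (rep c) \<tau>" for c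
  have gens: "v \<in> F" if "v \<in> set_sym_term \<tau>" for v using that by (simp add: F_def span_base)
  have h_meas: "h \<in> borel_measurable (cyl_sigma F)"
    unfolding h_def using rep_meas gens by (intro borel_measurable_term_eval) blast
  have h_eq: "char_ext l f = h (dual_coset D F l)" if "l \<in> D" for l
    unfolding h_def \<tau> char_ext_term[OF linear_D[OF that]]
    using rep[OF that gens] by (intro term_eval_gens_cong) simp
  have "integrable (cyl_marginal D cyl_law F) h"
    unfolding cyl_marginal_eq_distr[OF F]
    using assms h_eq X_D by (subst integrable_distr_eq[OF coset_measurable[OF F] h_meas]) simp
  then show ?thesis
    using F h_eq by (auto simp: cyl_integrable_def cyl_representation_def)
qed

lemma char_ext_measurable: "(\<lambda>\<xi>. char_ext \<xi> f) \<in> borel_measurable (sigma D (cyl_sets D))"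
  and X_measurable: "X \<in> measurable N (sigma D (cyl_sets D))"
proof -
  have Pow: "cyl_sets D \<subseteq> Pow D" by (auto simp: cyl_sets_def cyl_sets_over_def cyl_set_def)
  have eval: "(\<lambda>\<xi>. \<xi> v) \<in> borel_measurable (sigma D (cyl_sets D))" for v
  proof (rule borel_measurableI)
    fix V :: "real set" assume "open V"
    let ?U = "dual_coset D (span {v}) ` {l \<in> D. l v \<in> V}"
    have "openin (dual_quot_topology D (span {v})) ?U"
      unfolding dual_quot_topology_def using \<open>open V\<close> span_base[of v "{v}"]
      by (intro topology_generated_by_Basis) blast
    then have "?U \<in> dual_quot_borel D (span {v})" by (simp add: dual_quot_borel_def sigma_sets.Basic)
    moreover have "fin_dim_subspace (span {v})" unfolding fin_dim_subspace_def by blast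
    ultimately have "cyl_set D (span {v}) ?U \<in> cyl_sets D" by (auto simp: cyl_sets_def cyl_sets_over_def)
    moreover have "(\<lambda>\<xi>. \<xi> v) -` V \<inter> space (sigma D (cyl_sets D)) = cyl_set D (span {v}) ?U"
      using dual_coset_eq_iff[of _ _ "span {v}"] span_base[of v "{v}"] Pow
      by (auto simp: cyl_set_def space_measure_of_conv)
    ultimately show "(\<lambda>\<xi>. \<xi> v) -` V \<inter> space (sigma D (cyl_sets D)) \<in> sets (sigma D (cyl_sets D))"
      using Pow by (simp add: sigma_sets.Basic)
  qed
  obtain \<tau> where \<tau>: "f = abs_sym_alg \<tau>" by (rule abs_sym_alg_cases)
  have "(\<lambda>\<xi>. term_eval \<xi> \<tau>) \<in> borel_measurable (sigma D (cyl_sets D))"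
    using eval by (intro borel_measurable_term_eval)
  moreover have "char_ext \<xi> f = term_eval \<xi> \<tau>" if "\<xi> \<in> space (sigma D (cyl_sets D))" for \<xi>
    using that by (simp add: \<tau> char_ext_term linear_D space_measure_of_conv)
  ultimately show "(\<lambda>\<xi>. char_ext \<xi> f) \<in> borel_measurable (sigma D (cyl_sets D))"
    by (simp cong: measurable_cong)
  show "X \<in> measurable N (sigma D (cyl_sets D))"
    using X_D cyl_set_vimage by (intro measurable_measure_of[OF Pow]) (auto simp: cyl_sets_def)
qed

end

lemma dual_space_alg_dual: "dual_space alg_dual"
  by (rule dual_space.intro)
    (auto simp: alg_dual_def linear_zero intro: linear_compose_add linear_compose_sub)

section \<open>Continuous duals of nuclear spaces\<close>

lemma dual_space_top_dual:
  assumes "topspace T = UNIV"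
  shows "dual_space (top_dual T)"
  by (rule dual_space.intro)
    (auto simp: top_dual_def linear_zero assms intro: linear_compose_add linear_compose_sub
      continuous_map_add continuous_map_diff)

lemma cont_seminorm_nonneg:
  assumes "cont_seminorm T p"
  shows "0 \<le> p x"
proof -
  have "p 0 = 0" "p (- x) = p x"
    using assms[unfolded cont_seminorm_def, THEN conjunct2, THEN conjunct1, rule_format, of 0 0]
      assms[unfolded cont_seminorm_def, THEN conjunct2, THEN conjunct1, rule_format, of "- 1" x]
    by simp_all
  moreover have "p (x + (- x)) \<le> p x + p (- x)" using assms unfolding cont_seminorm_def by blast
  ultimately show ?thesis by simp
qed

lemma continuous_of_seminorm_bound:
  assumes T: "locally_convex_hausdorff T" and p: "cont_seminorm T p"
    and l: "linear l" "\<And>x. \<bar>l x\<bar> \<le> C * p x"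
  shows "continuous_map T euclideanreal l"
proof -
  have top: "topspace T = UNIV" and add: "continuous_map (prod_topology T T) T (\<lambda>(x, y). x + y)"
    using T by (auto simp: locally_convex_hausdorff_def)
  have p_cont: "continuous_map T euclideanreal p" using p by (simp add: cont_seminorm_def)
  have p0: "p 0 = 0"
    using p[unfolded cont_seminorm_def, THEN conjunct2, THEN conjunct1, rule_format, of 0 0] by simp
  show ?thesis
    unfolding continuous_map_def
  proof (intro conjI allI impI)
    fix U :: "real set" assume "openin euclideanreal U"
    then have U: "open U" by simp
    show "openin T {x \<in> topspace T. l x \<in> U}"
    proof (subst openin_subopen, intro ballI)
      fix x assume "x \<in> {x \<in> topspace T. l x \<in> U}"
      then have "l x \<in> U" by simp
      then obtain e where e: "0 < e" "ball (l x) e \<subseteq> U" using openE[OF U] by blast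
      \<comment> \<open>A translate of a seminorm ball; the radius uses |C| + 1 to have a positive
        denominator whatever the sign of \<open>C\<close>.\<close>
      define G where "G = {y \<in> topspace T. p (y + (- x)) \<in> {..< e / (\<bar>C\<bar> + 1)}}"
      have "continuous_map T (prod_topology T T) (\<lambda>y. (y, - x))"
        by (simp add: continuous_map_pairedI top)
      from continuous_map_compose[OF this add]
      have "continuous_map T T (\<lambda>y. y + (- x))" by (simp add: o_def)
      from continuous_map_compose[OF this p_cont]
      have "continuous_map T euclideanreal (\<lambda>y. p (y + (- x)))" by (simp add: o_def)
      then have "openin T G" unfolding G_def
        by (rule openin_continuous_map_preimage) simp
      moreover have "x \<in> G" using e by (simp add: G_def top p0)
      moreover have "G \<subseteq> {x \<in> topspace T. l x \<in> U}"
      proof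
        fix y assume "y \<in> G"
        then have y: "p (y + (- x)) < e / (\<bar>C\<bar> + 1)" by (simp add: G_def)
        have "\<bar>l y - l x\<bar> = \<bar>l (y + (- x))\<bar>" by (simp add: linear_diff[OF l(1)])
        also have "\<dots> \<le> C * p (y + (- x))" by (rule l(2))
        also have "\<dots> \<le> (\<bar>C\<bar> + 1) * p (y + (- x))"
          using cont_seminorm_nonneg[OF p] by (intro mult_right_mono) auto
        also have "\<dots> < e" using y by (simp add: field_simps)
        finally have "l y \<in> ball (l x) e" by (simp add: dist_real_def abs_minus_commute)
        then show "y \<in> {x \<in> topspace T. l x \<in> U}" using e top by auto
      qed
      ultimately show "\<exists>Ta. openin T Ta \<and> x \<in> Ta \<and> Ta \<subseteq> {x \<in> topspace T. l x \<in> U}" by blast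
    qed
  qed auto
qed

text \<open>
  Expanding \<open>x\<close> by a nuclear representation regularises the process \<open>X\<close>: the series
  \<open>\<Sum>n. a n x * X \<omega> (y n)\<close> is almost surely a continuous functional of \<open>x\<close>.
\<close>

lemma nuclear_regularisation:
  fixes X :: "'w \<Rightarrow> 'v::real_vector \<Rightarrow> real"
  assumes "prob_space N"
    and lin_X: "\<And>\<omega>. linear (X \<omega>)" and meas: "\<And>v. (\<lambda>\<omega>. X \<omega> v) \<in> borel_measurable N"
    and square: "\<And>v. integrable N (\<lambda>\<omega>. (X \<omega> v)\<^sup>2)" "\<And>v. (\<integral>\<omega>. (X \<omega> v)\<^sup>2 \<partial>N) \<le> (q v)\<^sup>2"
    and T: "locally_convex_hausdorff T" and q: "cont_seminorm T q" "cont_seminorm T p"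
    and nuclear: "nuclear_canonical_map p q"
  obtains Z where "\<And>\<omega>. Z \<omega> \<in> top_dual T" "\<And>v. (\<lambda>\<omega>. Z \<omega> v) \<in> borel_measurable N"
    "\<And>v. AE \<omega> in N. Z \<omega> v = X \<omega> v"
proof -
  interpret prob_space N by fact
  note [measurable] = meas
  obtain a :: "nat \<Rightarrow> 'v \<Rightarrow> real" and c y where a: "\<And>n. linear (a n)" and c: "\<And>n. 0 \<le> c n"
    and ac: "\<And>n x. \<bar>a n x\<bar> \<le> c n * p x" and sum: "summable (\<lambda>n. c n * q (y n))"
    and approx: "\<And>x. (\<lambda>K. q (x - (\<Sum>n<K. a n x *\<^sub>R y n))) \<longlonglongrightarrow> 0"
    using nuclear unfolding nuclear_canonical_map_def by blast
  have q_nonneg: "0 \<le> q x" and p_nonneg: "0 \<le> p x" for x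
    using q cont_seminorm_nonneg by blast+
  have int_X: "integrable N (\<lambda>\<omega>. X \<omega> v)" for v
    using square_integrable_imp_integrable[OF meas square(1)] .
  have E_X: "(\<integral>\<omega>. \<bar>X \<omega> v\<bar> \<partial>N) \<le> q v" for v
  proof -
    have "((\<integral>\<omega>. \<bar>X \<omega> v\<bar> \<partial>N))\<^sup>2 \<le> (\<integral>\<omega>. (X \<omega> v)\<^sup>2 \<partial>N)"
      using variance_eq[of "\<lambda>\<omega>. \<bar>X \<omega> v\<bar>"] variance_positive[of "\<lambda>\<omega>. \<bar>X \<omega> v\<bar>"] int_X[of v] square(1)[of v]
      by simp
    also have "\<dots> \<le> (q v)\<^sup>2" by (rule square(2))
    finally show ?thesis using q_nonneg by (rule power2_le_imp_le)
  qed
  \<comment> \<open>This series does not involve the vector to be expanded, so one null set serves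
    all of them.\<close>
  define bound where "bound \<omega> = (\<Sum>n. ennreal (c n * \<bar>X \<omega> (y n)\<bar>))" for \<omega>
  have bound_meas [measurable]: "bound \<in> borel_measurable N" unfolding bound_def by measurable
  have "(\<integral>\<^sup>+\<omega>. bound \<omega> \<partial>N) = (\<Sum>n. \<integral>\<^sup>+\<omega>. ennreal (c n * \<bar>X \<omega> (y n)\<bar>) \<partial>N)"
    unfolding bound_def by (intro nn_integral_suminf) measurable
  also have "\<dots> = (\<Sum>n. ennreal (c n * (\<integral>\<omega>. \<bar>X \<omega> (y n)\<bar> \<partial>N)))"
    using int_X c by (subst nn_integral_eq_integral) auto
  also have "\<dots> \<le> (\<Sum>n. ennreal (c n * q (y n)))"
    using c E_X by (intro suminf_le ennreal_leI mult_left_mono) auto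
  also have "\<dots> < \<infinity>"
    using sum c q_nonneg by (subst suminf_ennreal2) auto
  finally have AE_bound: "AE \<omega> in N. bound \<omega> \<noteq> \<infinity>"
    by (intro nn_integral_noteq_infinite) auto
  \<comment> \<open>The value 0 on the exceptional null set makes every path a continuous linear
    functional.\<close>
  define Z where "Z \<omega> x = (if bound \<omega> \<noteq> \<infinity> then \<Sum>n. a n x * X \<omega> (y n) else 0)" for \<omega> x
  have summable_c: "summable (\<lambda>n. c n * \<bar>X \<omega> (y n)\<bar>)" if "bound \<omega> \<noteq> \<infinity>" for \<omega>
    using that c unfolding bound_def by (intro summable_suminf_not_top) auto
  have term_le: "\<bar>a n x * X \<omega> (y n)\<bar> \<le> p x * (c n * \<bar>X \<omega> (y n)\<bar>)" for n x \<omega>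
    using mult_right_mono[OF ac[of n x] abs_ge_zero[of "X \<omega> (y n)"]] by (simp add: abs_mult mult_ac)
  have summable_a: "summable (\<lambda>n. \<bar>a n x * X \<omega> (y n)\<bar>)" if "bound \<omega> \<noteq> \<infinity>" for \<omega> x
    by (rule summable_comparison_test'[OF summable_mult[OF summable_c[OF that]]]) (use term_le in simp)
  have Z_top: "Z \<omega> \<in> top_dual T" for \<omega>
  proof (cases "bound \<omega> \<noteq> \<infinity>")
    case True
    note sa = summable_rabs_cancel[OF summable_a[OF True]]
    have "linear (Z \<omega>)"
    proof (rule linearI)
      show "Z \<omega> (x + x') = Z \<omega> x + Z \<omega> x'" for x x'
        using True suminf_add[OF sa sa] by (simp add: Z_def linear_add[OF a] distrib_right)
      show "Z \<omega> (r *\<^sub>R x) = r *\<^sub>R Z \<omega> x" for r x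
        using True suminf_mult[OF sa, of r] by (simp add: Z_def linear_scale[OF a] mult.assoc)
    qed
    moreover have "\<bar>Z \<omega> x\<bar> \<le> (\<Sum>n. c n * \<bar>X \<omega> (y n)\<bar>) * p x" for x
    proof -
      have "\<bar>Z \<omega> x\<bar> \<le> (\<Sum>n. \<bar>a n x * X \<omega> (y n)\<bar>)"
        using True summable_rabs[OF summable_a[OF True]] by (simp add: Z_def)
      also have "\<dots> \<le> (\<Sum>n. p x * (c n * \<bar>X \<omega> (y n)\<bar>))"
        by (intro suminf_le term_le summable_a[OF True] summable_mult summable_c[OF True])
      finally show ?thesis using suminf_mult[OF summable_c[OF True], of "p x"] by (simp add: mult.commute)
    qed
    ultimately show ?thesis
      unfolding top_dual_def using continuous_of_seminorm_bound[OF T q(2)] by blast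
  next
    case False
    then have "Z \<omega> = (\<lambda>_. 0)" by (simp add: Z_def fun_eq_iff)
    then show ?thesis by (simp add: top_dual_def linear_zero)
  qed
  have Z_meas: "(\<lambda>\<omega>. Z \<omega> v) \<in> borel_measurable N" for v
    unfolding Z_def by measurable
  \<comment> \<open>The expected error of the K-th partial sum is at most q of the remainder of x,
    which tends to 0. A subsequence converges almost surely to \<open>X \<omega> x\<close>, while
    the full series converges to \<open>Z \<omega> x\<close>.\<close>
  have Z_X: "AE \<omega> in N. Z \<omega> x = X \<omega> x" for x
  proof -
    define u where "u K \<omega> = X \<omega> (x - (\<Sum>n<K. a n x *\<^sub>R y n))" for K \<omega>
    have u_eq: "u K \<omega> = X \<omega> x - (\<Sum>n<K. a n x * X \<omega> (y n))" for K \<omega>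
      by (simp add: u_def linear_diff[OF lin_X] linear_sum[OF lin_X] linear_scale[OF lin_X])
    have "(\<lambda>K. \<integral>\<omega>. norm (u K \<omega>) \<partial>N) \<longlonglongrightarrow> 0"
      using approx[of x] by (rule Lim_null_comparison[rotated]) (use E_X in \<open>auto simp: u_def\<close>)
    moreover have "integrable N (u K)" for K unfolding u_def by (rule int_X)
    ultimately obtain r where r: "strict_mono r" "AE \<omega> in N. (\<lambda>K. u (r K) \<omega>) \<longlonglongrightarrow> 0"
      using tendsto_L1_AE_subseq[of N u] by blast
    show ?thesis using r(2) AE_bound
    proof eventually_elim
      case (elim \<omega>)
      have "(\<lambda>K. \<Sum>n<K. a n x * X \<omega> (y n)) \<longlonglongrightarrow> Z \<omega> x"
        using elim(2) summable_LIMSEQ[OF summable_rabs_cancel[OF summable_a[OF elim(2)]]] by (simp add: Z_def)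
      then have "(\<lambda>K. u K \<omega>) \<longlonglongrightarrow> X \<omega> x - Z \<omega> x" unfolding u_eq by (intro tendsto_intros)
      then have "(\<lambda>K. u (r K) \<omega>) \<longlonglongrightarrow> X \<omega> x - Z \<omega> x"
        using r(1) LIMSEQ_subseq_LIMSEQ[of "\<lambda>K. u K \<omega>" _ r] by (simp add: o_def)
      then show ?case using elim(1) LIMSEQ_unique by fastforce
    qed
  qed
  show thesis using that[of Z] Z_top Z_meas Z_X by blast
qed

theorem theorem16:
  fixes S :: "'v::real_vector set" and L :: "'v sym_alg \<Rightarrow> real"
  assumes basis: "independent S" "span S = UNIV"
    and L: "linear L" "L 1 = 1"
    and cond: "(\<forall>a\<in>sym_pos. 0 \<le> L a) \<or>
               ((\<forall>a. 0 \<le> L (a\<^sup>2)) \<and> (\<forall>t\<in>S. carleman L t))"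
  shows "moment_functional L \<and>
    (\<forall>T. nuclear_topology T \<and>
         (\<exists>q. cont_seminorm T q \<and> (\<forall>t. L ((sym_incl t)\<^sup>2) \<le> (q t)\<^sup>2)) \<longrightarrow>
       (\<exists>M. space M = top_dual T \<and> sets M = sigma_sets (top_dual T) (cyl_sets (top_dual T)) \<and>
            (\<forall>f. integrable M (\<lambda>\<xi>. char_ext \<xi> f) \<and>
                 L f = (\<integral>\<xi>. char_ext \<xi> f \<partial>M))))"
proof -
  obtain N :: "(('v \<times> bool) \<times> nat \<Rightarrow> real) measure" and X
    where N: "prob_space N" and X: "\<And>\<omega>. linear (X \<omega>)" "\<And>v. (\<lambda>\<omega>. X \<omega> v) \<in> borel_measurable N"
    and int: "\<And>f. integrable N (\<lambda>\<omega>. char_ext (X \<omega>) f)" "\<And>f. (\<integral>\<omega>. char_ext (X \<omega>) f \<partial>N) = L f"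
    by (rule random_linear_functional[OF basis L cond]) blast
  show ?thesis
  proof (intro conjI allI impI)
    interpret random_functional alg_dual N X
      using X by (intro random_functional.intro dual_space_alg_dual N random_functional_axioms.intro)
        (auto simp: alg_dual_def)
    show "moment_functional L"
      unfolding moment_functional_def
      using cylinder_measure_cyl_law cyl_representation_char_ext[OF int(1)]
        cyl_integral_eq[OF cyl_representation_char_ext[OF int(1)]] int(2) by auto
  next
    fix T :: "'v topology"
    assume *: "nuclear_topology T \<and> (\<exists>q. cont_seminorm T q \<and> (\<forall>t. L ((sym_incl t)\<^sup>2) \<le> (q t)\<^sup>2))"
    then obtain q where q: "cont_seminorm T q" "\<And>t. L ((sym_incl t)\<^sup>2) \<le> (q t)\<^sup>2" by blast
    have T: "locally_convex_hausdorff T" using * by (simp add: nuclear_topology_def)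
    obtain p where p: "cont_seminorm T p" "nuclear_canonical_map p q"
      using * q(1) unfolding nuclear_topology_def by blast
    have square: "char_ext (X \<omega>) ((sym_incl v)\<^sup>2) = (X \<omega> v)\<^sup>2" for \<omega> v
      by (simp add: char_ext_simps[OF X(1)] char_ext_hom[OF X(1)])
    obtain Z where Z: "\<And>\<omega>. Z \<omega> \<in> top_dual T" "\<And>v. (\<lambda>\<omega>. Z \<omega> v) \<in> borel_measurable N"
      "\<And>v. AE \<omega> in N. Z \<omega> v = X \<omega> v"
    proof (rule nuclear_regularisation[OF N X _ _ T q(1) p])
      show "integrable N (\<lambda>\<omega>. (X \<omega> v)\<^sup>2)" "(\<integral>\<omega>. (X \<omega> v)\<^sup>2 \<partial>N) \<le> (q v)\<^sup>2" for v
        using int[of "(sym_incl v)\<^sup>2"] q(2)[of v] by (simp_all add: square)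
    qed blast
    have top: "topspace T = UNIV" using T by (simp add: locally_convex_hausdorff_def)
    interpret random_functional "top_dual T" N Z
      using Z(1,2) by (intro random_functional.intro dual_space_top_dual top N random_functional_axioms.intro)
    let ?\<Sigma> = "sigma (top_dual T) (cyl_sets (top_dual T))"
    have Pow: "cyl_sets (top_dual T) \<subseteq> Pow (top_dual T)"
      by (auto simp: cyl_sets_def cyl_sets_over_def cyl_set_def)
    \<comment> \<open>\<open>Z\<close> agrees with \<open>X\<close> at each vector up to a null set
      depending on the vector; a fixed f involves only finitely many vectors.\<close>
    have AE_char: "AE \<omega> in N. char_ext (Z \<omega>) f = char_ext (X \<omega>) f" for f
    proof -
      obtain \<tau> where \<tau>: "f = abs_sym_alg \<tau>" by (rule abs_sym_alg_cases)
      have "AE \<omega> in N. \<forall>v\<in>set_sym_term \<tau>. Z \<omega> v = X \<omega> v"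
        using Z(3) by (intro AE_finite_allI finite_set_sym_term)
      then show ?thesis
      proof eventually_elim
        case (elim \<omega>)
        then show ?case
          unfolding \<tau> char_ext_term[OF X(1)] char_ext_term[OF linear_D[OF Z(1)]]
          by (intro term_eval_gens_cong) blast
      qed
    qed
    have meas: "(\<lambda>\<omega>. char_ext (Z \<omega>) f) \<in> borel_measurable N" for f
      by (rule measurable_compose[OF X_measurable char_ext_measurable])
    have intZ: "integrable N (\<lambda>\<omega>. char_ext (Z \<omega>) f)" "(\<integral>\<omega>. char_ext (Z \<omega>) f \<partial>N) = L f" for f
      using integrable_cong_AE[OF meas borel_measurable_integrable[OF int(1)] AE_char, of f]
        integral_cong_AE[OF meas borel_measurable_integrable[OF int(1)] AE_char, of f] int[of f]
      by simp_all
    show "\<exists>M. space M = top_dual T \<and> sets M = sigma_sets (top_dual T) (cyl_sets (top_dual T)) \<and>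
        (\<forall>f. integrable M (\<lambda>\<xi>. char_ext \<xi> f) \<and> L f = (\<integral>\<xi>. char_ext \<xi> f \<partial>M))"
      using intZ Pow
      by (intro exI[of _ "distr N ?\<Sigma> Z"])
        (simp add: space_measure_of_conv integrable_distr_eq[OF X_measurable char_ext_measurable]
          integral_distr[OF X_measurable char_ext_measurable])
  qed
qed

end
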